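(* Let $n\in\mathbb{N}$, $m\in\mathbb{N}_0$ and let $a>m$ be real. Then $W^{m+1,1}_a(\mathbb{R}^{n+1}_+)=W^{m+1,1}_{0,a}(\mathbb{R}^{n+1}_+)$.
   Context: $\mathbb{N}_0=\{0,1,2,\dots\}$, $\mathbb{R}^{n+1}_+=\mathbb{R}^n\times(0,\infty)$ (open half space) with points $(x,t)$. $\nabla^{k}u$ is the tensor of all (weak) partial derivatives of order $k$ of $u$ jointly in $(x,t)$. $W^{m+1,1}_a(\mathbb{R}^{n+1}_+)$ is the space of all $u\in W^{m+1,1}_{\mathrm{loc}}(\mathbb{R}^{n+1}_+)$ with $$\|u\|_{W^{m+1,1}_a(\mathbb{R}^{n+1}_+)}:=\int_{\mathbb{R}^{n+1}_+}t^a|u(x,t)|\,dx\,dt+\sum_{j=1}^{m+1}\int_{\mathbb{R}^{n+1}_+}t^a|\nabla^ju(x,t)|\,dx\,dt<\infty.$$ $W^{m+1,1}_{0,a}(\mathbb{R}^{n+1}_+)$ is the completion of $C_c^\infty(\mathbb{R}^{n+1}_+)$ with respect to this norm, i.e. the closure of $C_c^\infty(\mathbb{R}^{n+1}_+)$ (smooth functions with compact support in the open half space) in $W^{m+1,1}_a(\mathbb{R}^{n+1}_+)$. *)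

theory Defs
  imports "HOL-Analysis.Analysis"
begin

text \<open>
  Elements of function spaces over an open set \<open>\<Omega>\<close> are represented by total functions on the
  ambient space. All conditions on Sobolev functions below are insensitive to changes on a null set
  and to the values outside \<open>\<Omega>\<close>, so each space is the set of all representatives of its
  almost-everywhere classes; equality of two such sets is equality of the spaces.
\<close>

text \<open>
  A partial derivative of order \<open>k\<close> is indexed by the list \<open>bs\<close> of the \<open>k\<close> coordinate directions
  (elements of \<^const>\<open>Basis\<close>), i.e. by an entry of the tensor \<open>\<nabla>\<^sup>k\<close>.
\<close>

fun iter_partial :: "'a::euclidean_space list \<Rightarrow> ('a \<Rightarrow> real) \<Rightarrow> 'a \<Rightarrow> real" where
  "iter_partial [] f = f"
| "iter_partial (b # bs) f = (\<lambda>x. frechet_derivative (iter_partial bs f) (at x) b)"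

definition smooth :: "('a::euclidean_space \<Rightarrow> real) \<Rightarrow> bool" where
  "smooth f \<longleftrightarrow> (\<forall>bs. set bs \<subseteq> Basis \<longrightarrow> iter_partial bs f differentiable_on UNIV)"

text \<open>\<open>C\<^sub>c\<^sup>\<infinity>(\<Omega>)\<close>, each function being extended by zero to the whole space.\<close>

definition Cc_infty :: "'a::euclidean_space set \<Rightarrow> ('a \<Rightarrow> real) set" where
  "Cc_infty \<Omega> = {\<phi>. smooth \<phi> \<and> compact (closure {x. \<phi> x \<noteq> 0}) \<and> closure {x. \<phi> x \<noteq> 0} \<subseteq> \<Omega>}"

definition L1_loc :: "'a::euclidean_space set \<Rightarrow> ('a \<Rightarrow> real) set" where
  "L1_loc \<Omega> = {u. \<forall>K. compact K \<and> K \<subseteq> \<Omega> \<longrightarrow> set_integrable lebesgue K u}"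

definition has_weak_deriv ::
  "'a::euclidean_space set \<Rightarrow> 'a list \<Rightarrow> ('a \<Rightarrow> real) \<Rightarrow> ('a \<Rightarrow> real) \<Rightarrow> bool" where
  "has_weak_deriv \<Omega> bs u g \<longleftrightarrow> u \<in> L1_loc \<Omega> \<and> g \<in> L1_loc \<Omega> \<and>
     (\<forall>\<phi>\<in>Cc_infty \<Omega>. (LINT x:\<Omega>|lebesgue. u x * iter_partial bs \<phi> x) =
        (-1) ^ length bs * (LINT x:\<Omega>|lebesgue. g x * \<phi> x))"

text \<open>For open \<open>\<Omega>\<close> the choice is irrelevant: weak derivatives are unique almost everywhere in \<open>\<Omega>\<close>.\<close>

definition weak_deriv :: "'a::euclidean_space set \<Rightarrow> 'a list \<Rightarrow> ('a \<Rightarrow> real) \<Rightarrow> 'a \<Rightarrow> real" where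
  "weak_deriv \<Omega> bs u = (SOME g. has_weak_deriv \<Omega> bs u g)"

text \<open>\<open>|\<nabla>\<^sup>j u(x)|\<close>, the Euclidean norm of the tensor of all weak partial derivatives of order \<open>j\<close>.\<close>

definition norm_weak_grad :: "'a::euclidean_space set \<Rightarrow> nat \<Rightarrow> ('a \<Rightarrow> real) \<Rightarrow> 'a \<Rightarrow> real" where
  "norm_weak_grad \<Omega> j u x =
     sqrt (\<Sum>bs | set bs \<subseteq> Basis \<and> length bs = j. (weak_deriv \<Omega> bs u x)\<^sup>2)"

definition W1_loc :: "nat \<Rightarrow> 'a::euclidean_space set \<Rightarrow> ('a \<Rightarrow> real) set" where
  "W1_loc k \<Omega> = {u \<in> L1_loc \<Omega>.
     \<forall>bs. set bs \<subseteq> Basis \<and> length bs \<le> k \<longrightarrow> (\<exists>g. has_weak_deriv \<Omega> bs u g)}"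

text \<open>Points \<open>(x, t)\<close> with \<open>x \<in> \<real>\<^sup>n\<close> and \<open>t > 0\<close>, where \<open>n = CARD('n) \<ge> 1\<close>.\<close>

definition half_space :: "((real ^ 'n::finite) \<times> real) set" where
  "half_space = UNIV \<times> {0<..}"

text \<open>The norm is extended-valued, so that it makes sense before its finiteness is known.\<close>

definition wnorm :: "nat \<Rightarrow> real \<Rightarrow> ((real ^ 'n::finite) \<times> real \<Rightarrow> real) \<Rightarrow> ennreal" where
  "wnorm k a u =
     (\<integral>\<^sup>+ z\<in>half_space. ennreal (snd z powr a * \<bar>u z\<bar>) \<partial>lebesgue) +
     (\<Sum>j=1..k. \<integral>\<^sup>+ z\<in>half_space. ennreal (snd z powr a * norm_weak_grad half_space j u z) \<partial>lebesgue)"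

definition W1_weighted :: "nat \<Rightarrow> real \<Rightarrow> ((real ^ 'n::finite) \<times> real \<Rightarrow> real) set" where
  "W1_weighted k a = {u \<in> W1_loc k half_space. wnorm k a u < \<infinity>}"

text \<open>The closure of \<open>C\<^sub>c\<^sup>\<infinity>\<close> of the open half space in \<^const>\<open>W1_weighted\<close>.\<close>

definition W1_weighted_0 :: "nat \<Rightarrow> real \<Rightarrow> ((real ^ 'n::finite) \<times> real \<Rightarrow> real) set" where
  "W1_weighted_0 k a = {u \<in> W1_weighted k a.
     \<forall>\<epsilon>>0. \<exists>\<phi>\<in>Cc_infty half_space. wnorm k a (\<lambda>z. u z - \<phi> z) < ennreal \<epsilon>}"

end

theory Submission
  imports Defs
begin

text \<open>
  No Hardy inequality is needed: \<open>u\<close> is first approximated by functions that are smooth up to the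
  boundary. Let \<open>\<rho>\<close> be a mollifier supported in a small ball contained in \<open>t > 0\<close>. Averaging \<open>u\<close> against
  \<open>\<rho>(\<sqdot> - z)\<close> only uses values of \<open>u\<close> at heights larger than that of \<open>z\<close>. As \<open>t\<^sup>a\<close> is increasing, this
  averaging converges in \<open>L\<^sup>1(t\<^sup>a)\<close>, it commutes with weak derivatives, and the result \<open>W\<close> extends
  to a smooth function on the whole space. Multiplying \<open>W\<close> by a cutoff at infinity gives a smooth,
  compactly supported \<open>V\<close>.

  It remains to multiply \<open>V\<close> by \<open>\<eta>(t / \<delta>)\<close>. A derivative of order \<open>p\<close> of this factor is \<open>O(t\<^sup>-\<^sup>p)\<close>
  uniformly in \<open>\<delta>\<close>, so up to order \<open>m + 1\<close> the weighted error terms are dominated by a multiple of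
  \<open>t\<^bsup>a-m-1\<^esup>\<close> on a bounded set. This is integrable because \<open>a > m\<close>, and the errors tend to zero
  pointwise.
\<close>

section \<open>Smooth functions\<close>

text \<open>The order of the steps is what avoids Hardy. A boundary cutoff applied to
  \<open>u\<close> itself would produce terms t^-p \<bar>D^q u\<bar> whose integrability is not
  given. Applied to \<open>V\<close>, whose derivatives are bounded up to t = 0, it asks only for
  integrability of the weight, and the worst exponent satisfies a - (m + 1) > -1 exactly when a > m.
  Uniformity in \<delta> holds because each derivative of the step costs 1 / \<delta> but lives only
  where t \<le> 2 \<delta>. The other obstacle is the encoding. Weak derivatives are chosen by
  \<open>SOME\<close>, so the norm of \<open>u - \<phi>\<close> refers to an unspecified
  representative; uniqueness almost everywhere (\<open>fundamental_lemma\<close>) ties it to the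
  derivatives of \<open>u\<close> and \<phi>. Lebesgue measurable functions are replaced by Borel
  ones before Tonelli or translations are used. Higher derivatives are lists of directions in a
  fixed order, so integration by parts relies on the symmetry of mixed partials.\<close>

lemma iter_partial_single: "iter_partial [b] f = (\<lambda>x. frechet_derivative f (at x) b)"
  by simp

lemma iter_partial_append: "iter_partial (bs @ cs) f = iter_partial bs (iter_partial cs f)"
  by (induction bs) auto

lemma frechet_derivative_eq: "(f has_derivative D) (at x) \<Longrightarrow> frechet_derivative f (at x) = D"
  using frechet_derivative_at by blast

lemma frechet_derivative_add:
  "f differentiable (at x) \<Longrightarrow> g differentiable (at x) \<Longrightarrow>
    frechet_derivative (\<lambda>x. f x + g x) (at x) h = frechet_derivative f (at x) h + frechet_derivative g (at x) h"
  by (simp add: frechet_derivative_eq[OF has_derivative_add] frechet_derivative_works)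

lemma frechet_derivative_mult:
  fixes f g :: "'a::real_normed_vector \<Rightarrow> real"
  shows "f differentiable (at x) \<Longrightarrow> g differentiable (at x) \<Longrightarrow>
    frechet_derivative (\<lambda>x. f x * g x) (at x) h = f x * frechet_derivative g (at x) h + frechet_derivative f (at x) h * g x"
  by (simp add: frechet_derivative_eq[OF has_derivative_mult] frechet_derivative_works)

text \<open>The common route to smoothness: exhibit a class of differentiable functions closed under
  single partials. It serves for \<open>smooth_alg\<close>, for classes of real functions and for
  the averages of a fixed \<open>U\<close>.\<close>

lemma smooth_coinduct:
  assumes "P f"
    and diff: "\<And>g x. P g \<Longrightarrow> g differentiable (at x)"
    and step: "\<And>g b. P g \<Longrightarrow> b \<in> Basis \<Longrightarrow> P (iter_partial [b] g)"
  shows "smooth f"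
proof -
  have "P (iter_partial bs f)" if "set bs \<subseteq> Basis" for bs
    using that
  proof (induction bs)
    case (Cons b bs)
    then show ?case using step[of "iter_partial bs f" b] by simp
  qed (simp add: assms)
  then show ?thesis
    unfolding smooth_def differentiable_on_def
    using diff differentiable_at_withinI by blast
qed

lemma smooth_iter_partial: "smooth f \<Longrightarrow> set bs \<subseteq> Basis \<Longrightarrow> smooth (iter_partial bs f)"
  unfolding smooth_def by (metis iter_partial_append set_append Un_least)

lemma smooth_differentiable: "smooth f \<Longrightarrow> f differentiable (at x)"
  unfolding smooth_def differentiable_on_def
  by (metis UNIV_I empty_set empty_subsetI iter_partial.simps(1))

lemma smooth_has_derivative:
  "smooth f \<Longrightarrow> (f has_derivative frechet_derivative f (at x)) (at x)"
  using smooth_differentiable frechet_derivative_works by blast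

lemma smooth_continuous: "smooth f \<Longrightarrow> continuous_on UNIV f"
  by (metis continuous_at_imp_continuous_on differentiable_imp_continuous_within smooth_differentiable)

lemma smooth_borel_measurable [measurable_dest]: "smooth f \<Longrightarrow> f \<in> borel_measurable borel"
  by (simp add: borel_measurable_continuous_onI smooth_continuous)

lemma frechet_derivative_eq_sum_partial:
  fixes f :: "'a::euclidean_space \<Rightarrow> real"
  assumes "smooth f"
  shows "frechet_derivative f (at x) h = (\<Sum>b\<in>Basis. (h \<bullet> b) * iter_partial [b] f x)"
proof -
  have "linear (frechet_derivative f (at x))"
    using smooth_has_derivative[OF assms] has_derivative_linear by blast
  then have "frechet_derivative f (at x) (\<Sum>b\<in>Basis. (h \<bullet> b) *\<^sub>R b)
      = (\<Sum>b\<in>Basis. (h \<bullet> b) *\<^sub>R frechet_derivative f (at x) b)"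
    by (simp add: linear_sum linear_scale)
  then show ?thesis by (simp add: euclidean_representation)
qed

text \<open>Derivatives are local. This passes vanishing off a closed set, or constancy on an open
  set, to all derivatives. The point is arbitrary in the induction because the next derivative needs
  equality in a whole neighbourhood.\<close>

lemma iter_partial_cong_open:
  assumes "open A" and "\<And>x. x \<in> A \<Longrightarrow> f x = g x" and "x \<in> A"
  shows "iter_partial bs f x = iter_partial bs g x"
  using assms(3)
proof (induction bs arbitrary: x)
  case (Cons b bs)
  have "(iter_partial bs f has_derivative D) (at x) \<longleftrightarrow> (iter_partial bs g has_derivative D) (at x)" for D
    by (metis Cons has_derivative_transform_within_open[OF _ assms(1) Cons.prems])
  then show ?case by (simp add: frechet_derivative_def)
qed (use assms in simp)

lemma iter_partial_const: "bs \<noteq> [] \<Longrightarrow> iter_partial bs (\<lambda>x::'a::euclidean_space. c) = (\<lambda>x. 0)"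
proof (induction bs)
  case (Cons b bs)
  then show ?case
    by (cases "bs = []") (auto simp: frechet_derivative_const)
qed simp

text \<open>Every derivative contributes one factor \<open>c\<close>. The value 1 gives translated
  kernels, the values 1 / (k + 1) and k + 1 give the rescaled cutoffs.\<close>

lemma iter_partial_affine:
  fixes f :: "'a::euclidean_space \<Rightarrow> real"
  assumes "smooth f" "set bs \<subseteq> Basis"
  shows "iter_partial bs (\<lambda>x. f (c *\<^sub>R x + d)) = (\<lambda>x. c ^ length bs * iter_partial bs f (c *\<^sub>R x + d))"
  using assms(2)
proof (induction bs)
  case (Cons b bs)
  have "frechet_derivative (\<lambda>x. c ^ length bs * iter_partial bs f (c *\<^sub>R x + d)) (at x) =
     (\<lambda>h. c ^ length bs * frechet_derivative (iter_partial bs f) (at (c *\<^sub>R x + d)) (c *\<^sub>R h))" for x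
  proof -
    have "smooth (iter_partial bs f)" using Cons.prems assms(1) smooth_iter_partial by auto
    then have "((\<lambda>x. iter_partial bs f (c *\<^sub>R x + d)) has_derivative
        (\<lambda>h. frechet_derivative (iter_partial bs f) (at (c *\<^sub>R x + d)) (c *\<^sub>R h))) (at x)"
      by (intro has_derivative_compose[where f = "\<lambda>x. c *\<^sub>R x + d" and g = "iter_partial bs f"] smooth_has_derivative)
        (auto intro!: derivative_eq_intros)
    then show ?thesis by (intro frechet_derivative_eq has_derivative_mult_right)
  qed
  moreover have "linear (frechet_derivative (iter_partial bs f) (at z))" for z
    using smooth_has_derivative[OF smooth_iter_partial[OF assms(1), of bs]] has_derivative_linear Cons.prems
    by (metis insert_subset list.simps(15))
  moreover have "iter_partial bs (\<lambda>x. f (c *\<^sub>R x + d)) = (\<lambda>x. c ^ length bs * iter_partial bs f (c *\<^sub>R x + d))"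
    using Cons by auto
  ultimately show ?case
    by (simp add: linear_scale mult_ac)
qed simp

text \<open>
  This class is closed under partial derivatives by construction, so one coinduction yields all
  closure properties of \<^const>\<open>smooth\<close>.
\<close>

inductive smooth_alg :: "('a::euclidean_space \<Rightarrow> real) \<Rightarrow> bool" where
  smooth: "smooth f \<Longrightarrow> smooth_alg f"
| const: "smooth_alg (\<lambda>x. c)"
| inner: "smooth_alg (\<lambda>x. x \<bullet> v)"
| affine: "smooth f \<Longrightarrow> smooth_alg (\<lambda>x. f (c *\<^sub>R x + d))"
| add: "smooth_alg f \<Longrightarrow> smooth_alg g \<Longrightarrow> smooth_alg (\<lambda>x. f x + g x)"
| mult: "smooth_alg f \<Longrightarrow> smooth_alg g \<Longrightarrow> smooth_alg (\<lambda>x. f x * g x)"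
| compose: "smooth (F :: real \<Rightarrow> real) \<Longrightarrow> smooth_alg g \<Longrightarrow> smooth_alg (\<lambda>x. F (g x))"

lemma smooth_alg_partial:
  assumes "smooth_alg f"
  shows "(\<forall>x. f differentiable (at x)) \<and> (\<forall>b\<in>Basis. smooth_alg (iter_partial [b] f))"
  using assms
proof induction
  case (smooth f)
  then show ?case using smooth_differentiable smooth_iter_partial[of f "[b]" for b] smooth_alg.smooth by auto
next
  case (const c)
  then show ?case using smooth_alg.const[where 'a='a, of 0] by simp
next
  case (inner v)
  have *: "((\<lambda>x::'a. x \<bullet> v) has_derivative (\<lambda>h. h \<bullet> v)) (at x)" for x
    by (auto intro!: derivative_eq_intros)
  then show ?case using smooth_alg.const
    by (auto simp: differentiable_def frechet_derivative_eq[OF *])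
next
  case (affine f c d)
  have "smooth_alg (iter_partial [b] (\<lambda>x. f (c *\<^sub>R x + d)))" if "b \<in> Basis" for b
  proof -
    have "set [b] \<subseteq> Basis" using that by simp
    then show ?thesis
      using smooth_alg.mult[OF smooth_alg.const smooth_alg.affine[OF smooth_iter_partial[OF affine]], of "[b]" "c ^ length [b]" c d]
      unfolding iter_partial_affine[OF affine \<open>set [b] \<subseteq> Basis\<close>] by blast
  qed
  moreover have "(\<lambda>x. f (c *\<^sub>R x + d)) differentiable (at x)" for x
    using differentiable_compose[of f "\<lambda>x. c *\<^sub>R x + d" x UNIV] smooth_differentiable[OF affine]
    by auto
  ultimately show ?case by blast
next
  case (add f g)
  have *: "iter_partial [b] (\<lambda>x. f x + g x) = (\<lambda>x. iter_partial [b] f x + iter_partial [b] g x)" for b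
    using add by (auto simp: frechet_derivative_add)
  have "smooth_alg (iter_partial [b] (\<lambda>x. f x + g x))" if "b \<in> Basis" for b
    unfolding * using add that by (intro smooth_alg.add) blast+
  then show ?case using add by auto
next
  case (mult f g)
  have *: "iter_partial [b] (\<lambda>x. f x * g x) = (\<lambda>x. f x * iter_partial [b] g x + iter_partial [b] f x * g x)" for b
    using mult by (auto simp: frechet_derivative_mult)
  have "smooth_alg (iter_partial [b] (\<lambda>x. f x * g x))" if "b \<in> Basis" for b
    unfolding * using mult that by (intro smooth_alg.add smooth_alg.mult) blast+
  then show ?case using mult by auto
next
  case (compose F g)
  have d: "((\<lambda>x. F (g x)) has_derivative (\<lambda>h. frechet_derivative F (at (g x)) (frechet_derivative g (at x) h))) (at x)" for x
    using has_derivative_compose[OF _ smooth_has_derivative[OF compose.hyps(1)]] compose(3) frechet_derivative_works by blast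
  \<comment> \<open>A linear map on the reals is multiplication by its value at 1, so the chain rule
    becomes a product of two members of the class.\<close>
  have l: "frechet_derivative F (at y) h = iter_partial [1] F y * h" for y h
    using frechet_derivative_eq_sum_partial[OF compose(1), of y h] by (simp del: iter_partial.simps)
  have *: "iter_partial [b] (\<lambda>x. F (g x)) = (\<lambda>x. iter_partial [1] F (g x) * iter_partial [b] g x)" for b
    unfolding iter_partial_single[of b] frechet_derivative_eq[OF d] by (rule ext) (rule l)
  have "smooth_alg (iter_partial [b] (\<lambda>x. F (g x)))" if "b \<in> Basis" for b
    unfolding * using compose that
    by (intro smooth_alg.mult[OF smooth_alg.compose[OF smooth_iter_partial]]) auto
  then show ?case using d unfolding differentiable_def by blast
qed

lemma smooth_alg_smooth: "smooth_alg f \<Longrightarrow> smooth f"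
  by (rule smooth_coinduct[of smooth_alg]) (use smooth_alg_partial in auto)

lemma smooth_const [intro, simp]: "smooth (\<lambda>x. c)"
  and smooth_inner [intro]: "smooth (\<lambda>x. x \<bullet> v)"
  by (auto intro: smooth_alg_smooth smooth_alg.intros)

lemma smooth_add [intro]: "smooth f \<Longrightarrow> smooth g \<Longrightarrow> smooth (\<lambda>x. f x + g x)"
  and smooth_mult [intro]: "smooth f \<Longrightarrow> smooth g \<Longrightarrow> smooth (\<lambda>x. f x * g x)"
  by (auto intro!: smooth_alg_smooth intro: smooth_alg.intros)

lemma smooth_affine: "smooth f \<Longrightarrow> smooth (\<lambda>x. f (c *\<^sub>R x + d))"
  and smooth_compose: "smooth (F :: real \<Rightarrow> real) \<Longrightarrow> smooth g \<Longrightarrow> smooth (\<lambda>x. F (g x))"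
  by (auto intro!: smooth_alg_smooth intro: smooth_alg.intros)

lemma smooth_diff: "smooth f \<Longrightarrow> smooth g \<Longrightarrow> smooth (\<lambda>x. f x - g x)"
  using smooth_add[of f "\<lambda>x. (-1) * g x"] smooth_mult[of "\<lambda>x. -1" g] by simp

text \<open>All ways to hand each entry of a list of directions to one of two factors, with
  repetitions. Enumerating them as a list gives the product rule with all coefficients 1, and the
  number of entries is the constant in later estimates.\<close>

fun splits :: "'b list \<Rightarrow> ('b list \<times> 'b list) list" where
  "splits [] = [([], [])]"
| "splits (b # bs) = map (\<lambda>(p, q). (p, b # q)) (splits bs) @ map (\<lambda>(p, q). (b # p, q)) (splits bs)"

lemma splits_props:
  "(p, q) \<in> set (splits bs) \<Longrightarrow> length p + length q = length bs \<and> set p \<subseteq> set bs \<and> set q \<subseteq> set bs"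
  by (induction bs arbitrary: p q) (fastforce+)

lemma Leibniz:
  fixes f g :: "'a::euclidean_space \<Rightarrow> real"
  assumes "smooth f" "smooth g" "set bs \<subseteq> Basis"
  shows "iter_partial bs (\<lambda>x. f x * g x) = (\<lambda>x. \<Sum>(p, q)\<leftarrow>splits bs. iter_partial p f x * iter_partial q g x)"
  using assms(3)
proof (induction bs)
  case (Cons b bs)
  define S where "S = splits bs"
  have S: "set p \<subseteq> Basis \<and> set q \<subseteq> Basis" if "(p, q) \<in> set S" for p q
    using splits_props[of p q bs] that Cons.prems unfolding S_def by auto
  have *: "((\<lambda>x. \<Sum>(p, q)\<leftarrow>S. iter_partial p f x * iter_partial q g x) has_derivative
    (\<lambda>h. \<Sum>(p, q)\<leftarrow>S. iter_partial p f x * frechet_derivative (iter_partial q g) (at x) h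
       + frechet_derivative (iter_partial p f) (at x) h * iter_partial q g x)) (at x)" for x
    using S
  proof (induction S)
    case (Cons s S)
    obtain p q where s: "s = (p, q)" by force
    have "(iter_partial p f has_derivative frechet_derivative (iter_partial p f) (at x)) (at x)"
      "(iter_partial q g has_derivative frechet_derivative (iter_partial q g) (at x)) (at x)"
      using Cons.prems assms smooth_iter_partial smooth_has_derivative unfolding s by (metis list.set_intros(1))+
    from has_derivative_mult[OF this] Cons show ?case
      unfolding s by (auto intro!: has_derivative_add)
  qed simp
  have "iter_partial (b # bs) (\<lambda>x. f x * g x) = (\<lambda>x. \<Sum>(p, q)\<leftarrow>S. iter_partial p f x * iter_partial (b # q) g x
       + iter_partial (b # p) f x * iter_partial q g x)"
  proof -
    have IH: "iter_partial bs (\<lambda>x. f x * g x) = (\<lambda>x. \<Sum>(p, q)\<leftarrow>S. iter_partial p f x * iter_partial q g x)"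
      using Cons unfolding S_def by simp
    show ?thesis
      unfolding iter_partial.simps IH frechet_derivative_eq[OF *] ..
  qed
  also have "\<dots> = (\<lambda>x. \<Sum>(p, q)\<leftarrow>splits (b # bs). iter_partial p f x * iter_partial q g x)"
    unfolding splits.simps S_def[symmetric] map_append sum_list_append map_map
    by (simp only: o_def case_prod_unfold fst_conv snd_conv sum_list_addf)
  finally show ?case .
qed simp

section \<open>A smooth step function\<close>

lemma smooth_realI:
  fixes f :: "real \<Rightarrow> real"
  assumes "P f" and step: "\<And>g. P g \<Longrightarrow> \<exists>g'. P g' \<and> (\<forall>t. (g has_real_derivative g' t) (at t))"
  shows "smooth f"
  using assms(1)
proof (rule smooth_coinduct)
  fix g :: "real \<Rightarrow> real" and x assume "P g"
  then show "g differentiable (at x)"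
    using step[of g] unfolding has_field_derivative_def differentiable_def by blast
next
  fix g :: "real \<Rightarrow> real" and b assume "P g" "b \<in> (Basis :: real set)"
  then obtain g' where g': "P g'" "\<And>t. (g has_derivative (\<lambda>h. g' t * h)) (at t)" "b = 1"
    using step[of g] by (auto simp: has_field_derivative_def)
  then have "iter_partial [b] g = g'"
    using frechet_derivative_eq[OF g'(2)] by auto
  then show "P (iter_partial [b] g)" using g' by simp
qed

text \<open>For \<open>k = 0\<close> this is the classical flat function exp(-1/t). The powers of
  1/t are built in because differentiation produces them.\<close>

definition flat_exp :: "nat \<Rightarrow> real \<Rightarrow> real" where
  "flat_exp k t = (if t > 0 then (1 / t) ^ k * exp (- (1 / t)) else 0)"

lemma flat_exp_at_right_0: "(flat_exp k \<longlongrightarrow> 0) (at_right 0)"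
proof -
  have "((\<lambda>s::real. s ^ k / exp s) \<longlongrightarrow> 0) at_top" by (rule tendsto_power_div_exp_0)
  then have "((\<lambda>t::real. (inverse t) ^ k / exp (inverse t)) \<longlongrightarrow> 0) (at_right 0)"
    using filterlim_compose[OF _ filterlim_inverse_at_top_right] by blast
  then show ?thesis
    by (rule Lim_transform_eventually)
      (auto simp: eventually_at_right_field flat_exp_def inverse_eq_divide exp_minus intro!: exI[of _ 1])
qed

lemma flat_exp_has_real_derivative:
  "(flat_exp k has_real_derivative flat_exp (k + 2) t - real k * flat_exp (k + 1) t) (at t)"
proof -
  consider "t > 0" | "t < 0" | "t = 0" by linarith
  then show ?thesis
  proof cases
    case 1
    have "((\<lambda>t. (1 / t) ^ k * exp (- (1 / t))) has_real_derivative
        flat_exp (k + 2) t - real k * flat_exp (k + 1) t) (at t)"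
    proof -
      have "((\<lambda>t. 1 / t) has_real_derivative - ((1 / t)\<^sup>2)) (at t)"
        using 1 by (auto intro!: derivative_eq_intros simp: power2_eq_square)
      note q = this
      have e: "((\<lambda>t. exp (- (1 / t))) has_real_derivative exp (- (1 / t)) * (1 / t)\<^sup>2) (at t)"
        using DERIV_chain2[OF DERIV_exp DERIV_minus[OF q]] by simp
      \<comment> \<open>Natural subtraction truncates \<open>k - 1\<close> at \<open>k = 0\<close>;
        there both sides vanish because of the factor \<open>real k\<close>.\<close>
      have "real k * ((- (s\<^sup>2)) * s ^ (k - 1)) = - real k * s ^ (k + 1)" for s :: real
        by (cases k) (simp_all add: power2_eq_square algebra_simps)
      from this[of "1 / t"]
      have p: "((\<lambda>t. (1 / t) ^ k) has_real_derivative - real k * (1 / t) ^ (k + 1)) (at t)"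
        using DERIV_power[OF q, of k] by simp
      show ?thesis
        using DERIV_mult[OF p e] 1 by (simp add: flat_exp_def algebra_simps power2_eq_square)
    qed
    then show ?thesis
      by (rule has_field_derivative_transform_within_open[where S = "{0<..}"]) (use 1 in \<open>auto simp: flat_exp_def\<close>)
  next
    case 2
    have "((\<lambda>t. 0) has_real_derivative flat_exp (k + 2) t - real k * flat_exp (k + 1) t) (at t)"
      using 2 by (auto simp: flat_exp_def)
    then show ?thesis
      by (rule has_field_derivative_transform_within_open[where S = "{..<0}"]) (use 2 in \<open>auto simp: flat_exp_def\<close>)
  next
    case 3
    have "((\<lambda>h. (flat_exp k h - flat_exp k 0) / h) \<longlongrightarrow> 0) (at 0)"
      unfolding filterlim_at_split
    proof
      show "((\<lambda>h. (flat_exp k h - flat_exp k 0) / h) \<longlongrightarrow> 0) (at_left 0)"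
        by (rule Lim_transform_eventually[OF tendsto_const])
          (auto simp: eventually_at_left_field flat_exp_def intro!: exI[of _ "-1"])
      \<comment> \<open>To the right of 0, dividing by \<open>h\<close> turns
        \<open>flat_exp k\<close> into \<open>flat_exp (k + 1)\<close>, whose limit at 0 is already
        known.\<close>
      show "((\<lambda>h. (flat_exp k h - flat_exp k 0) / h) \<longlongrightarrow> 0) (at_right 0)"
        by (rule Lim_transform_eventually[OF flat_exp_at_right_0[of "k + 1"]])
          (auto simp: eventually_at_right_field flat_exp_def field_simps intro!: exI[of _ 1])
    qed
    then show ?thesis using 3 by (simp add: has_field_derivative_iff flat_exp_def)
  qed
qed

text \<open>The derivative of one generator is a combination of two others, so it is the linear span
  that is closed under differentiation and can serve as the invariant in
  \<open>smooth_realI\<close>.\<close>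

inductive flat_span :: "(real \<Rightarrow> real) \<Rightarrow> bool" where
  base: "flat_span (\<lambda>t. c * flat_exp k t)"
| add: "flat_span f \<Longrightarrow> flat_span g \<Longrightarrow> flat_span (\<lambda>t. f t + g t)"

lemma smooth_flat_exp: "smooth (flat_exp 0)"
proof (rule smooth_realI[of flat_span])
  show "flat_span (flat_exp 0)" using flat_span.base[of 1 0] by simp
  fix g assume "flat_span g"
  then show "\<exists>g'. flat_span g' \<and> (\<forall>t. (g has_real_derivative g' t) (at t))"
  proof induction
    case (base c k)
    have "flat_span (\<lambda>t. c * flat_exp (k + 2) t + (- c * real k) * flat_exp (k + 1) t)"
      by (intro flat_span.intros)
    moreover have "((\<lambda>t. c * flat_exp k t) has_real_derivative
        c * flat_exp (k + 2) t + (- c * real k) * flat_exp (k + 1) t) (at t)" for t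
      using DERIV_cmult[OF flat_exp_has_real_derivative[of k t], of c] by (simp add: algebra_simps)
    ultimately show ?case by blast
  next
    case (add f g)
    then obtain f' g' where "flat_span f'" "flat_span g'"
      "\<And>t. (f has_real_derivative f' t) (at t)" "\<And>t. (g has_real_derivative g' t) (at t)" by blast
    then show ?case by (intro exI[of _ "\<lambda>t. f' t + g' t"]) (auto intro: DERIV_add flat_span.add)
  qed
qed

lemma flat_exp_pos: "t > 0 \<Longrightarrow> flat_exp 0 t > 0"
  and flat_exp_eq_0: "t \<le> 0 \<Longrightarrow> flat_exp 0 t = 0"
  and flat_exp_nonneg: "flat_exp 0 t \<ge> 0"
  by (auto simp: flat_exp_def)

lemma flat_exp_mono: "s \<le> t \<Longrightarrow> flat_exp 0 s \<le> flat_exp 0 t"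
  by (simp add: flat_exp_def divide_left_mono)

text \<open>
  Since \<open>flat_exp 0\<close> vanishes on negative arguments, the inner difference is constant for \<open>t \<ge> 1\<close>
  and nonpositive for \<open>t \<le> 0\<close>; no quotient of nonconstant functions is needed.
\<close>

definition smooth_step :: "real \<Rightarrow> real" where
  "smooth_step t = flat_exp 0 (flat_exp 0 1 - flat_exp 0 (1 - t)) / flat_exp 0 (flat_exp 0 1)"

lemma smooth_step_eq_0: "t \<le> 0 \<Longrightarrow> smooth_step t = 0"
  using flat_exp_mono[of 1 "1 - t"] by (simp add: smooth_step_def flat_exp_eq_0)

lemma smooth_step_eq_1: "t \<ge> 1 \<Longrightarrow> smooth_step t = 1"
  using flat_exp_pos[OF flat_exp_pos[of 1]] by (simp add: smooth_step_def flat_exp_eq_0)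

lemma smooth_smooth_step: "smooth smooth_step"
proof -
  have 1: "smooth (\<lambda>t. flat_exp 0 (1 - t))"
    using smooth_affine[OF smooth_flat_exp, of "-1" 1] by simp
  have "smooth (\<lambda>t. flat_exp 0 (flat_exp 0 1 - flat_exp 0 (1 - t)))"
    by (intro smooth_compose[OF smooth_flat_exp] smooth_diff 1 smooth_const)
  from smooth_mult[OF this smooth_const[of "1 / flat_exp 0 (flat_exp 0 1)"]]
  show ?thesis by (simp add: smooth_step_def[abs_def])
qed

section \<open>Symmetry of partial derivatives\<close>

lemma directional_mvt:
  fixes f :: "'a::euclidean_space \<Rightarrow> real"
  assumes "smooth f" "0 < h"
  shows "\<exists>s. 0 < s \<and> s < h \<and> f (x + h *\<^sub>R b) - f x = h * iter_partial [b] f (x + s *\<^sub>R b)"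
proof -
  have d: "((\<lambda>s. f (x + s *\<^sub>R b)) has_real_derivative iter_partial [b] f (x + s *\<^sub>R b)) (at s)" for s
  proof -
    have "((\<lambda>s. f (x + s *\<^sub>R b)) has_derivative (\<lambda>v. frechet_derivative f (at (x + s *\<^sub>R b)) (v *\<^sub>R b))) (at s)"
      by (rule has_derivative_compose[where f = "\<lambda>s. x + s *\<^sub>R b" and g = f, OF _ smooth_has_derivative[OF assms(1)]])
        (auto intro!: derivative_eq_intros)
    moreover have "linear (frechet_derivative f (at (x + s *\<^sub>R b)))"
      using smooth_has_derivative[OF assms(1)] has_derivative_linear by blast
    ultimately show ?thesis
      by (simp add: has_field_derivative_def linear_scale mult.commute[of _ "frechet_derivative _ _ _"])
  qed
  from MVT2[OF assms(2), of "\<lambda>s. f (x + s *\<^sub>R b)", OF d] show ?thesis by auto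
qed

text \<open>The second difference is g(x + h b) - g(x) with g(y) = f(y + h c) - f(y); one mean value
  step in direction \<open>b\<close> and one in direction \<open>c\<close> produce the mixed
  derivative at an intermediate point. The difference is symmetric in \<open>b\<close> and
  \<open>c\<close>, whereas the order of differentiation on the right is not.\<close>

lemma mixed_difference:
  fixes f :: "'a::euclidean_space \<Rightarrow> real"
  assumes f: "smooth f" and h: "0 < h" and b: "b \<in> Basis"
  shows "\<exists>s r. 0 < s \<and> s < h \<and> 0 < r \<and> r < h \<and>
    f (x + h *\<^sub>R b + h *\<^sub>R c) - f (x + h *\<^sub>R b) - f (x + h *\<^sub>R c) + f x
      = h\<^sup>2 * iter_partial [c, b] f (x + s *\<^sub>R b + r *\<^sub>R c)"
proof -
  define g where "g = (\<lambda>y. f (y + h *\<^sub>R c) - f y)"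
  have sh: "smooth (\<lambda>y. f (y + h *\<^sub>R c))"
    using smooth_affine[OF f, of 1 "h *\<^sub>R c"] by simp
  have g: "smooth g" unfolding g_def by (intro smooth_diff f sh)
  have "iter_partial [b] (\<lambda>y. f (y + h *\<^sub>R c)) y = iter_partial [b] f (y + h *\<^sub>R c)" for y
    using iter_partial_affine[OF f, of "[b]" 1 "h *\<^sub>R c"] b by (simp del: iter_partial.simps)
  then have gb: "iter_partial [b] g y = iter_partial [b] f (y + h *\<^sub>R c) - iter_partial [b] f y" for y
    using has_derivative_diff[OF smooth_has_derivative[OF sh, of y] smooth_has_derivative[OF f, of y]]
    unfolding g_def iter_partial_single by (simp add: frechet_derivative_eq)
  obtain s where s: "0 < s" "s < h" "g (x + h *\<^sub>R b) - g x = h * iter_partial [b] g (x + s *\<^sub>R b)"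
    using directional_mvt[OF g h] by blast
  obtain r where r: "0 < r" "r < h" "iter_partial [b] f (x + s *\<^sub>R b + h *\<^sub>R c) - iter_partial [b] f (x + s *\<^sub>R b)
      = h * iter_partial [c] (iter_partial [b] f) (x + s *\<^sub>R b + r *\<^sub>R c)"
    using directional_mvt[OF smooth_iter_partial[OF f, of "[b]"] h, of "x + s *\<^sub>R b" c] b
    by (metis empty_set empty_subsetI insert_subset list.simps(15))
  have "iter_partial [c] (iter_partial [b] f) = iter_partial [c, b] f" by simp
  then have "g (x + h *\<^sub>R b) - g x = h * (h * iter_partial [c, b] f (x + s *\<^sub>R b + r *\<^sub>R c))"
    using s(3) r(3) unfolding gb by (simp only:)
  then show ?thesis
    using s r by (intro exI[of _ s] exI[of _ r]) (simp add: g_def power2_eq_square algebra_simps del: iter_partial.simps)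
qed

text \<open>The symmetric second difference is evaluated once for each order of the directions. Both
  intermediate points tend to \<open>x\<close>, and continuity of the second partials identifies the
  two limits.\<close>

lemma iter_partial_commute:
  fixes f :: "'a::euclidean_space \<Rightarrow> real"
  assumes f: "smooth f" and b: "b \<in> Basis" and c: "c \<in> Basis"
  shows "iter_partial [b, c] f = iter_partial [c, b] f"
proof
  fix x
  define h where "h n = 1 / real (Suc n)" for n
  have h: "h n > 0" for n by (simp add: h_def)
  have h0: "h \<longlonglongrightarrow> 0" unfolding h_def using LIMSEQ_inverse_real_of_nat by (simp add: inverse_eq_divide)
  obtain s r where sr: "\<And>n. 0 < s n \<and> s n < h n \<and> 0 < r n \<and> r n < h n \<and>
    f (x + h n *\<^sub>R b + h n *\<^sub>R c) - f (x + h n *\<^sub>R b) - f (x + h n *\<^sub>R c) + f x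
      = (h n)\<^sup>2 * iter_partial [c, b] f (x + s n *\<^sub>R b + r n *\<^sub>R c)"
    using mixed_difference[OF f h b, where x = x and c = c] by metis
  obtain s' r' where sr': "\<And>n. 0 < s' n \<and> s' n < h n \<and> 0 < r' n \<and> r' n < h n \<and>
    f (x + h n *\<^sub>R c + h n *\<^sub>R b) - f (x + h n *\<^sub>R c) - f (x + h n *\<^sub>R b) + f x
      = (h n)\<^sup>2 * iter_partial [b, c] f (x + s' n *\<^sub>R c + r' n *\<^sub>R b)"
    using mixed_difference[OF f h c, where x = x and c = b] by metis
  have lim: "(\<lambda>n. x + p n *\<^sub>R v + q n *\<^sub>R w) \<longlonglongrightarrow> x" if "\<And>n. 0 < p n \<and> p n < h n" "\<And>n. 0 < q n \<and> q n < h n"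
    for p q v w
  proof -
    have "p \<longlonglongrightarrow> 0" "q \<longlonglongrightarrow> 0"
      by (rule tendsto_sandwich[OF _ _ tendsto_const h0]; use that in \<open>auto intro!: always_eventually less_imp_le\<close>)+
    then have "(\<lambda>n. x + p n *\<^sub>R v + q n *\<^sub>R w) \<longlonglongrightarrow> x + 0 *\<^sub>R v + 0 *\<^sub>R w"
      by (intro tendsto_intros)
    then show ?thesis by simp
  qed
  have cont: "isCont (iter_partial bs f) x" if "set bs \<subseteq> Basis" for bs
    using smooth_continuous[OF smooth_iter_partial[OF f that]] by (simp add: continuous_on_eq_continuous_at)
  have eq: "iter_partial [c, b] f (x + s n *\<^sub>R b + r n *\<^sub>R c) = iter_partial [b, c] f (x + s' n *\<^sub>R c + r' n *\<^sub>R b)" for n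
  proof -
    have "(h n)\<^sup>2 * iter_partial [c, b] f (x + s n *\<^sub>R b + r n *\<^sub>R c)
        = (h n)\<^sup>2 * iter_partial [b, c] f (x + s' n *\<^sub>R c + r' n *\<^sub>R b)"
      using sr[of n] sr'[of n] by (simp add: algebra_simps del: iter_partial.simps)
    then show ?thesis using h[of n] by (simp del: iter_partial.simps)
  qed
  have "(\<lambda>n. iter_partial [c, b] f (x + s n *\<^sub>R b + r n *\<^sub>R c)) \<longlonglongrightarrow> iter_partial [c, b] f x"
    using sr b c by (intro isCont_tendsto_compose[OF cont] lim) auto
  moreover have "(\<lambda>n. iter_partial [b, c] f (x + s' n *\<^sub>R c + r' n *\<^sub>R b)) \<longlonglongrightarrow> iter_partial [b, c] f x"
    using sr' b c by (intro isCont_tendsto_compose[OF cont] lim) auto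
  ultimately show "iter_partial [b, c] f x = iter_partial [c, b] f x"
    unfolding eq using LIMSEQ_unique by blast
qed

text \<open>Integration by parts takes the outermost derivative off one factor and puts it innermost
  on the other; this moves it back to the outside.\<close>

lemma iter_partial_rotate:
  fixes f :: "'a::euclidean_space \<Rightarrow> real"
  assumes "smooth f" "b \<in> Basis" "set bs \<subseteq> Basis"
  shows "iter_partial bs (iter_partial [b] f) = iter_partial (b # bs) f"
  using assms(3)
proof (induction bs)
  case (Cons c bs)
  have app: "iter_partial (c # ds) g = iter_partial [c] (iter_partial ds g)"
    "iter_partial [c, d] g = iter_partial [c] (iter_partial [d] g)" for c d ds and g :: "'a \<Rightarrow> real"
    by auto
  have "iter_partial (c # bs) (iter_partial [b] f) = iter_partial [c] (iter_partial (b # bs) f)"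
    using Cons by simp
  also have "\<dots> = iter_partial [c, b] (iter_partial bs f)" by simp
  also have "\<dots> = iter_partial [b, c] (iter_partial bs f)"
    using Cons.prems assms by (intro iter_partial_commute smooth_iter_partial) auto
  finally show ?case by simp
qed simp

section \<open>Test functions\<close>

lemma Cc_inftyI:
  assumes "smooth f" "compact K" "K \<subseteq> \<Omega>" "\<And>x. x \<notin> K \<Longrightarrow> f x = 0"
  shows "f \<in> Cc_infty \<Omega>"
proof -
  have "closure {x. f x \<noteq> 0} \<subseteq> K"
    using assms by (intro closure_minimal) (auto simp: compact_imp_closed)
  then show ?thesis
    using assms compact_Int_closed[OF assms(2) closed_closure, of "{x. f x \<noteq> 0}"]
    by (auto simp: Cc_infty_def Int_absorb1)
qed

lemma Cc_inftyE:
  assumes "f \<in> Cc_infty \<Omega>"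
  obtains K where "smooth f" "compact K" "K \<subseteq> \<Omega>" "\<And>x. x \<notin> K \<Longrightarrow> f x = 0"
proof
  show "smooth f" "compact (closure {x. f x \<noteq> 0})" "closure {x. f x \<noteq> 0} \<subseteq> \<Omega>"
    using assms by (simp_all add: Cc_infty_def)
  show "f x = 0" if "x \<notin> closure {x. f x \<noteq> 0}" for x
    using that closure_subset[of "{x. f x \<noteq> 0}"] by blast
qed

lemma Cc_infty_UNIV: "f \<in> Cc_infty \<Omega> \<Longrightarrow> f \<in> Cc_infty UNIV"
  by (simp add: Cc_infty_def)

lemma Cc_infty_smooth: "f \<in> Cc_infty \<Omega> \<Longrightarrow> smooth f"
  by (simp add: Cc_infty_def)

lemma iter_partial_eq_0:
  assumes "closed K" "\<And>x. x \<notin> K \<Longrightarrow> f x = 0" "x \<notin> K"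
  shows "iter_partial bs f x = 0"
proof -
  have "iter_partial bs f x = iter_partial bs (\<lambda>x. 0) x"
    by (rule iter_partial_cong_open[of "- K"]) (use assms in auto)
  also have "\<dots> = 0" by (cases "bs = []") (simp_all add: iter_partial_const)
  finally show ?thesis .
qed

lemma iter_partial_Cc_infty:
  assumes "f \<in> Cc_infty \<Omega>" "set bs \<subseteq> Basis"
  shows "iter_partial bs f \<in> Cc_infty \<Omega>"
  using assms(1)
proof (rule Cc_inftyE)
  fix K assume K: "smooth f" "compact K" "K \<subseteq> \<Omega>" "\<And>x. x \<notin> K \<Longrightarrow> f x = 0"
  then show ?thesis
    using iter_partial_eq_0[OF compact_imp_closed[OF K(2)] K(4)] assms(2)
    by (intro Cc_inftyI[of _ K] smooth_iter_partial) auto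
qed

lemma Cc_infty_cmult: "f \<in> Cc_infty \<Omega> \<Longrightarrow> (\<lambda>x. c * f x) \<in> Cc_infty \<Omega>"
  by (erule Cc_inftyE, rule Cc_inftyI) (auto intro: smooth_mult smooth_const)

lemma Cc_infty_mult: "smooth g \<Longrightarrow> f \<in> Cc_infty \<Omega> \<Longrightarrow> (\<lambda>x. g x * f x) \<in> Cc_infty \<Omega>"
  by (erule Cc_inftyE, rule Cc_inftyI) auto

lemma Cc_infty_bounded:
  assumes "f \<in> Cc_infty \<Omega>"
  obtains B where "B \<ge> 0" "\<And>x. \<bar>f x\<bar> \<le> B"
  using assms
proof (rule Cc_inftyE)
  fix K assume K: "smooth f" "compact K" "K \<subseteq> \<Omega>" "\<And>x. x \<notin> K \<Longrightarrow> f x = 0"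
  have "compact (f ` K)"
    using K smooth_continuous continuous_on_subset by (intro compact_continuous_image) blast+
  then obtain B where "B > 0" "\<And>y. y \<in> f ` K \<Longrightarrow> norm y \<le> B"
    using compact_imp_bounded bounded_pos by metis
  then have "\<bar>f x\<bar> \<le> B" for x
    using K(4)[of x] by (cases "x \<in> K") auto
  then show thesis using \<open>B > 0\<close> by (intro that[of B]) simp_all
qed

lemma Cc_infty_integrable:
  assumes f: "f \<in> Cc_infty \<Omega>"
  shows "integrable lborel f"
proof -
  obtain K where K: "smooth f" "compact K" "K \<subseteq> \<Omega>" "\<And>x. x \<notin> K \<Longrightarrow> f x = 0"
    using f Cc_inftyE by blast
  have "integrable lborel (\<lambda>x. indicator K x *\<^sub>R f x)"
    by (rule borel_integrable_compact[OF K(2)]) (use K(1) smooth_continuous continuous_on_subset in blast)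
  moreover have "(\<lambda>x. indicator K x *\<^sub>R f x) = f"
    using K(4) by (auto simp: indicator_def fun_eq_iff)
  ultimately show ?thesis by simp
qed

section \<open>Continuity of translations in \<open>L\<^sup>1\<close>\<close>

lemma lborel_nn_integral_shift:
  fixes f :: "'a::euclidean_space \<Rightarrow> ennreal"
  assumes [measurable]: "f \<in> borel_measurable borel"
  shows "(\<integral>\<^sup>+z. f (z + y) \<partial>lborel) = (\<integral>\<^sup>+z. f z \<partial>lborel)"
  by (subst (2) lborel_distr_plus[of y, symmetric]) (simp add: nn_integral_distr add.commute)

lemma lborel_integral_shift:
  fixes f :: "'a::euclidean_space \<Rightarrow> real"
  assumes [measurable]: "f \<in> borel_measurable borel"
  shows "(\<integral>z. f (z + y) \<partial>lborel) = (\<integral>z. f z \<partial>lborel)"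
  by (subst (2) lborel_distr_plus[of y, symmetric]) (simp add: integral_distr add.commute)

text \<open>Inner regularity by closed sets, followed by intersection with a large ball; finiteness
  of the measure makes the part outside the ball small.\<close>

lemma borel_inner_compact:
  fixes A :: "'a::euclidean_space set"
  assumes A [measurable]: "A \<in> sets borel" and fin: "emeasure lborel A < \<infinity>" and e: "(0::real) < e"
  obtains K where "compact K" "K \<subseteq> A" "emeasure lborel (A - K) < e"
proof -
  have A': "A \<in> sets lebesgue" using A by simp
  obtain T where T: "closed T" "T \<subseteq> A" "emeasure lebesgue (A - T) < ennreal (e/2)"
    by (rule sets_lebesgue_inner_closed[OF A', of "e/2"]) (use e in simp)
  have "(\<lambda>n. emeasure lborel (A - cball 0 (real n))) \<longlonglongrightarrow> emeasure lborel (\<Inter>n. A - cball 0 (real n))"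
  proof (rule Lim_emeasure_decseq)
    show "decseq (\<lambda>n. A - cball 0 (real n))" by (auto simp: decseq_def)
    show "emeasure lborel (A - cball 0 (real n)) \<noteq> \<infinity>" for n
      using fin emeasure_mono[of "A - cball 0 (real n)" A lborel] by (auto simp: top_unique)
    show "range (\<lambda>n. A - cball 0 (real n)) \<subseteq> sets lborel"
      by (intro image_subsetI) simp
  qed
  moreover have "(\<Inter>n. A - cball 0 (real n)) = {}"
  proof -
    have "\<exists>n. x \<in> cball 0 (real n)" for x :: 'a
      using real_arch_simple[of "norm x"] by simp
    then show ?thesis by fast
  qed
  ultimately have "(\<lambda>n. emeasure lborel (A - cball 0 (real n))) \<longlonglongrightarrow> 0"
    by (simp only: emeasure_empty)
  then have "\<forall>\<^sub>F n in sequentially. emeasure lborel (A - cball 0 (real n)) < ennreal (e/2)"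
    using e by (intro order_tendstoD) auto
  then obtain n where n: "emeasure lborel (A - cball 0 (real n)) < ennreal (e/2)"
    by (auto simp: eventually_sequentially)
  have "emeasure lborel (A - (T \<inter> cball 0 (real n))) \<le> emeasure lborel ((A - T) \<union> (A - cball 0 (real n)))"
    using T by (intro emeasure_mono) auto
  also have "\<dots> \<le> emeasure lborel (A - T) + emeasure lborel (A - cball 0 (real n))"
    using T by (intro emeasure_subadditive) auto
  also have "\<dots> < ennreal (e/2) + ennreal (e/2)"
    using T n by (intro add_strict_mono) (auto simp: )
  also have "\<dots> = e" using e by (simp flip: ennreal_plus)
  finally show ?thesis
    using T by (intro that[of "T \<inter> cball 0 (real n)"]) auto
qed

lemma translation_indicator:
  fixes A :: "'a::euclidean_space set"
  assumes A [measurable]: "A \<in> sets borel" and fin: "emeasure lborel A < \<infinity>" and e: "(0::real) < e"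
  shows "\<exists>d>0. \<forall>y. norm y < d \<longrightarrow> (\<integral>\<^sup>+z. ennreal \<bar>indicator A (z + y) - indicator A z\<bar> \<partial>lborel) < e"
proof -
  obtain K where K: "compact K" "K \<subseteq> A" "emeasure lborel (A - K) < ennreal (e/4)"
    by (rule borel_inner_compact[OF A fin, of "e/4"]) (use e in simp)
  obtain V where V: "open V" "A \<subseteq> V" "emeasure lborel (V - A) < ennreal (e/4)"
    by (rule outer_regular_lborel[OF A, of "e/4"]) (use e in simp)
  have [measurable]: "V \<in> sets borel" "K \<in> sets borel" using K V by (auto simp: compact_imp_closed)
  obtain d where d: "d > 0" "\<And>x y. x \<in> K \<Longrightarrow> y \<in> - V \<Longrightarrow> d \<le> dist x y"
    using separate_compact_closed[OF K(1), of "-V"] V K by blast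
  have Kd: "x + y \<in> V" "x - y \<in> V" if "x \<in> K" "norm y < d" for x y
    using d(2)[OF that(1), of "x + y"] d(2)[OF that(1), of "x - y"] that(2) by (auto simp: dist_norm)
  have VK: "emeasure lborel (V - K) < ennreal (e/2)"
  proof -
    have "emeasure lborel (V - K) \<le> emeasure lborel ((A - K) \<union> (V - A))"
      by (intro emeasure_mono) auto
    also have "\<dots> \<le> emeasure lborel (A - K) + emeasure lborel (V - A)"
      by (intro emeasure_subadditive) auto
    also have "\<dots> < ennreal (e/4) + ennreal (e/4)"
      using K V by (intro add_strict_mono) auto
    finally show ?thesis using e by (simp flip: ennreal_plus)
  qed
  have "(\<integral>\<^sup>+z. ennreal \<bar>indicator A (z + y) - indicator A z\<bar> \<partial>lborel) < e" if y: "norm y < d" for y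
  proof -
    have "(\<integral>\<^sup>+z. ennreal \<bar>indicator A (z + y) - indicator A z\<bar> \<partial>lborel)
       \<le> (\<integral>\<^sup>+z. indicator (V - K) (z + y) + indicator (V - K) z \<partial>lborel)"
    proof (rule nn_integral_mono)
      fix z :: 'a
      \<comment> \<open>If exactly one of \<open>z\<close> and \<open>z + y\<close> is in
        \<open>A\<close>, one of them lies in \<open>V - K\<close>: a point of \<open>A\<close>
        outside \<open>K\<close> does, and a point of \<open>K\<close> is moved into
        \<open>V\<close>, hence into \<open>V - K\<close> if it leaves \<open>A\<close>.\<close>
      show "ennreal \<bar>indicator A (z + y) - indicator A z\<bar> \<le> indicator (V - K) (z + y) + indicator (V - K) z"
        using Kd[of z y] Kd[of "z + y" y] y V(2) K(2)
        by (auto simp: indicator_def split: if_splits)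
    qed
    also have "\<dots> = emeasure lborel (V - K) + emeasure lborel (V - K)"
      by (subst nn_integral_add) (auto simp: lborel_nn_integral_shift)
    also have "\<dots> < ennreal (e/2) + ennreal (e/2)"
      using VK by (intro add_strict_mono) auto
    finally show ?thesis using e by (simp flip: ennreal_plus)
  qed
  then show ?thesis using d by blast
qed

lemma ennreal_abs_triangle:
  fixes x y z :: real
  shows "ennreal \<bar>x - z\<bar> \<le> ennreal \<bar>x - y\<bar> + ennreal \<bar>y - z\<bar>"
proof -
  have "ennreal \<bar>x - z\<bar> \<le> ennreal (\<bar>x - y\<bar> + \<bar>y - z\<bar>)" by (intro ennreal_leI) simp
  then show ?thesis by (simp only: ennreal_plus[OF abs_ge_zero abs_ge_zero])
qed

text \<open>Indicators of sets of finite measure are covered by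
  \<open>translation_indicator\<close>. The property passes to sums, and to dominated limits by an
  e/3 argument in which translation invariance makes the shifted error equal to the unshifted
  one.\<close>

lemma translation_continuous_L1:
  fixes f :: "'a::euclidean_space \<Rightarrow> real"
  assumes "integrable lborel f" "(0::real) < e"
  shows "\<exists>d>0. \<forall>y. norm y < d \<longrightarrow> (\<integral>\<^sup>+z. ennreal \<bar>f (z + y) - f z\<bar> \<partial>lborel) < e"
  using assms
proof (induction arbitrary: e rule: integrable_induct)
  case (base A c)
  \<comment> \<open>Dividing by \<bar>c\<bar> + 1 instead of \<bar>c\<bar> covers
    \<open>c = 0\<close> and makes the final inequality strict.\<close>
  then obtain d where d: "d > 0"
    "\<And>y. norm y < d \<Longrightarrow> (\<integral>\<^sup>+z. ennreal \<bar>indicator A (z + y) - indicator A z\<bar> \<partial>lborel) < e / (\<bar>c\<bar> + 1)"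
    using translation_indicator[of A "e / (\<bar>c\<bar> + 1)"] by auto
  have [measurable]: "A \<in> sets borel" using base by simp
  have "(\<integral>\<^sup>+z. ennreal \<bar>indicator A (z + y) *\<^sub>R c - indicator A z *\<^sub>R c\<bar> \<partial>lborel) < e" if y: "norm y < d" for y
  proof -
    have "(\<integral>\<^sup>+z. ennreal \<bar>indicator A (z + y) *\<^sub>R c - indicator A z *\<^sub>R c\<bar> \<partial>lborel)
      = (\<integral>\<^sup>+z. ennreal \<bar>c\<bar> * ennreal \<bar>indicator A (z + y) - indicator A z\<bar> \<partial>lborel)"
      by (intro nn_integral_cong) (simp add: abs_mult flip: ennreal_mult left_diff_distrib)
    also have "\<dots> = ennreal \<bar>c\<bar> * (\<integral>\<^sup>+z. ennreal \<bar>indicator A (z + y) - indicator A z\<bar> \<partial>lborel)"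
      by (intro nn_integral_cmult) auto
    also have "\<dots> \<le> ennreal \<bar>c\<bar> * ennreal (e / (\<bar>c\<bar> + 1))"
      using d(2)[OF y] by (intro mult_left_mono) auto
    also have "\<dots> = ennreal (\<bar>c\<bar> * (e / (\<bar>c\<bar> + 1)))"
      using base by (intro ennreal_mult[symmetric]) auto
    also have "\<dots> < ennreal e"
      using base by (intro ennreal_lessI) (auto simp: field_simps)
    finally show ?thesis .
  qed
  then show ?case using d by blast
next
  case (add f g)
  from add(3)[of "e/2"] add(4)[of "e/2"] add(5) obtain d1 d2 where d: "d1 > 0" "d2 > 0"
    "\<And>y. norm y < d1 \<Longrightarrow> (\<integral>\<^sup>+z. ennreal \<bar>f (z + y) - f z\<bar> \<partial>lborel) < e/2"
    "\<And>y. norm y < d2 \<Longrightarrow> (\<integral>\<^sup>+z. ennreal \<bar>g (z + y) - g z\<bar> \<partial>lborel) < e/2"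
    by auto
  have [measurable]: "f \<in> borel_measurable borel" "g \<in> borel_measurable borel" using add by auto
  have "(\<integral>\<^sup>+z. ennreal \<bar>(f (z + y) + g (z + y)) - (f z + g z)\<bar> \<partial>lborel) < e" if y: "norm y < min d1 d2" for y
  proof -
    have "(\<integral>\<^sup>+z. ennreal \<bar>(f (z + y) + g (z + y)) - (f z + g z)\<bar> \<partial>lborel)
      \<le> (\<integral>\<^sup>+z. ennreal \<bar>f (z + y) - f z\<bar> + ennreal \<bar>g (z + y) - g z\<bar> \<partial>lborel)"
    proof (rule nn_integral_mono)
      fix z
      have "ennreal \<bar>(f (z + y) + g (z + y)) - (f z + g z)\<bar> \<le> ennreal (\<bar>f (z + y) - f z\<bar> + \<bar>g (z + y) - g z\<bar>)"
        by (intro ennreal_leI) simp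
      then show "ennreal \<bar>(f (z + y) + g (z + y)) - (f z + g z)\<bar> \<le> ennreal \<bar>f (z + y) - f z\<bar> + ennreal \<bar>g (z + y) - g z\<bar>"
        by (simp only: ennreal_plus[OF abs_ge_zero abs_ge_zero])
    qed
    also have "\<dots> = (\<integral>\<^sup>+z. ennreal \<bar>f (z + y) - f z\<bar> \<partial>lborel) + (\<integral>\<^sup>+z. ennreal \<bar>g (z + y) - g z\<bar> \<partial>lborel)"
      by (intro nn_integral_add) auto
    also have "\<dots> < ennreal (e/2) + ennreal (e/2)"
      using d y by (intro add_strict_mono) auto
    finally show ?thesis using add(5) by (simp flip: ennreal_plus)
  qed
  then show ?case using d by (intro exI[of _ "min d1 d2"]) auto
next
  case (lim f s)
  have [measurable]: "f \<in> borel_measurable borel" "\<And>i. s i \<in> borel_measurable borel" using lim by auto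
  have "(\<lambda>i. \<integral>\<^sup>+z. ennreal (norm (f z - s i z)) \<partial>lborel) \<longlonglongrightarrow> 0"
  proof (rule nn_integral_dominated_convergence_norm[where w = "\<lambda>z. 2 * norm (f z)"])
    show "(\<integral>\<^sup>+ z. ennreal (2 * norm (f z)) \<partial>lborel) < \<infinity>"
    proof -
      have "integrable lborel (\<lambda>z. 2 * norm (f z))"
        using \<open>integrable lborel f\<close> by simp
      then show ?thesis unfolding integrable_iff_bounded by simp
    qed
  qed (use lim in auto)
  then have "\<forall>\<^sub>F i in sequentially. (\<integral>\<^sup>+z. ennreal (norm (f z - s i z)) \<partial>lborel) < ennreal (e/3)"
    using lim by (intro order_tendstoD) auto
  then obtain i where i: "(\<integral>\<^sup>+z. ennreal \<bar>f z - s i z\<bar> \<partial>lborel) < ennreal (e/3)"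
    by (auto simp: eventually_sequentially)
  obtain d where d: "d > 0" "\<And>y. norm y < d \<Longrightarrow> (\<integral>\<^sup>+z. ennreal \<bar>s i (z + y) - s i z\<bar> \<partial>lborel) < ennreal (e/3)"
    using lim.IH[of "e/3" i] \<open>0 < e\<close> by auto
  have "(\<integral>\<^sup>+z. ennreal \<bar>f (z + y) - f z\<bar> \<partial>lborel) < e" if y: "norm y < d" for y
  proof -
    have "(\<integral>\<^sup>+z. ennreal \<bar>f (z + y) - f z\<bar> \<partial>lborel)
      \<le> (\<integral>\<^sup>+z. ennreal \<bar>f (z + y) - s i (z + y)\<bar> + (ennreal \<bar>s i (z + y) - s i z\<bar> + ennreal \<bar>f z - s i z\<bar>) \<partial>lborel)"
    proof (rule nn_integral_mono)
      fix z
      show "ennreal \<bar>f (z + y) - f z\<bar> \<le> ennreal \<bar>f (z + y) - s i (z + y)\<bar> + (ennreal \<bar>s i (z + y) - s i z\<bar> + ennreal \<bar>f z - s i z\<bar>)"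
        using order_trans[OF ennreal_abs_triangle[of "f (z + y)" "f z" "s i (z + y)"]
          add_left_mono[OF ennreal_abs_triangle[of "s i (z + y)" "f z" "s i z"]]]
        by (simp only: abs_minus_commute[of "s i z" "f z"])
    qed
    also have "\<dots> = (\<integral>\<^sup>+z. ennreal \<bar>f (z + y) - s i (z + y)\<bar> \<partial>lborel) +
        ((\<integral>\<^sup>+z. ennreal \<bar>s i (z + y) - s i z\<bar> \<partial>lborel) + (\<integral>\<^sup>+z. ennreal \<bar>f z - s i z\<bar> \<partial>lborel))"
      by (simp add: nn_integral_add)
    also have "\<dots> < ennreal (e/3) + (ennreal (e/3) + ennreal (e/3))"
      using d y i lborel_nn_integral_shift[of "\<lambda>z. ennreal \<bar>f z - s i z\<bar>" y]
      by (intro add_strict_mono) auto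
    finally show ?thesis using lim(6) by (simp flip: ennreal_plus)
  qed
  then show ?case using d by blast
qed

section \<open>Averages against test functions\<close>

lemma Cc_infty_support:
  assumes "f \<in> Cc_infty \<Omega>"
  shows "\<exists>K. compact K \<and> K \<subseteq> \<Omega> \<and> (\<forall>x. x \<notin> K \<longrightarrow> f x = 0)"
  by (rule Cc_inftyE[OF assms]) metis

lemma partial_Cc_infty: "f \<in> Cc_infty \<Omega> \<Longrightarrow> b \<in> Basis \<Longrightarrow> iter_partial [b] f \<in> Cc_infty \<Omega>"
  by (rule iter_partial_Cc_infty) simp_all

lemma Cc_infty_derivative_bound:
  fixes f :: "'a::euclidean_space \<Rightarrow> real"
  assumes f: "f \<in> Cc_infty \<Omega>"
  obtains L where "L \<ge> 0" "\<And>x v. \<bar>frechet_derivative f (at x) v\<bar> \<le> L * norm v"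
    "\<And>x y. \<bar>f x - f y\<bar> \<le> L * norm (x - y)"
proof -
  have "\<exists>B. \<forall>x. \<bar>iter_partial [b] f x\<bar> \<le> B" if "b \<in> Basis" for b
    using Cc_infty_bounded[OF partial_Cc_infty[OF f that]] by blast
  then obtain B where B: "\<And>b x. b \<in> Basis \<Longrightarrow> \<bar>iter_partial [b] f x\<bar> \<le> B b" by metis
  define L where "L = (\<Sum>b\<in>Basis. B b)"
  have "0 \<le> B b" if "b \<in> Basis" for b using B[OF that, of 0] by linarith
  then have L0: "L \<ge> 0" unfolding L_def by (intro sum_nonneg)
  have L1: "\<bar>frechet_derivative f (at x) v\<bar> \<le> L * norm v" for x v
  proof -
    have "\<bar>frechet_derivative f (at x) v\<bar> \<le> (\<Sum>b\<in>Basis. \<bar>(v \<bullet> b) * iter_partial [b] f x\<bar>)"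
      unfolding frechet_derivative_eq_sum_partial[OF Cc_infty_smooth[OF f], of x v] by (rule sum_abs)
    also have "\<dots> \<le> (\<Sum>b\<in>Basis. norm v * B b)"
      unfolding abs_mult by (intro sum_mono mult_mono B Basis_le_norm) auto
    finally show ?thesis by (simp add: L_def sum_distrib_left mult.commute)
  qed
  have "\<bar>f x - f y\<bar> \<le> L * norm (x - y)" for x y
    using differentiable_bound[of UNIV f "\<lambda>x. frechet_derivative f (at x)" L x y]
      smooth_has_derivative[OF Cc_infty_smooth[OF f]] L1 onorm_le[of "frechet_derivative f (at _)" L]
    by simp
  then show thesis using that L0 L1 by blast
qed

text \<open>
  The kernel is not reflected: if \<open>\<rho>\<close> lives in the upper half space, the average at \<open>z\<close> only sees
  points above \<open>z\<close>. Each derivative falling on \<open>\<rho>\<close> then costs a sign, which the sign in the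
  definition of the weak derivative cancels.
\<close>

definition conv_against :: "('a::euclidean_space \<Rightarrow> real) \<Rightarrow> ('a \<Rightarrow> real) \<Rightarrow> 'a \<Rightarrow> real" where
  "conv_against U \<rho> z = (\<integral>y. U y * \<rho> (y - z) \<partial>lborel)"

lemma conv_integrable:
  fixes U :: "'a::euclidean_space \<Rightarrow> real"
  assumes U: "integrable lborel U" and [measurable]: "\<rho> \<in> borel_measurable borel" and B: "\<And>x. \<bar>\<rho> x\<bar> \<le> B"
  shows "integrable lborel (\<lambda>y. U y * \<rho> (y - z))"
proof (rule Bochner_Integration.integrable_bound)
  show "integrable lborel (\<lambda>y. B * U y)" using U by simp
  have "\<bar>\<rho> (y - z)\<bar> \<le> \<bar>B\<bar>" for y using B[of "y - z"] by linarith
  then have "\<bar>\<rho> (y - z)\<bar> * \<bar>U y\<bar> \<le> \<bar>B\<bar> * \<bar>U y\<bar>" for y by (intro mult_right_mono) auto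
  then show "AE y in lborel. norm (U y * \<rho> (y - z)) \<le> norm (B * U y)"
    by (simp add: abs_mult mult.commute)
qed (use U in measurable)

text \<open>Differentiation under the integral sign. The regularity comes from the kernel alone,
  \<open>U\<close> being merely integrable; since the kernel enters as \<rho>(y - z), each
  derivative contributes a minus sign.\<close>

lemma conv_has_derivative:
  fixes U :: "'a::euclidean_space \<Rightarrow> real"
  assumes U: "integrable lborel U" and \<rho>: "\<rho> \<in> Cc_infty UNIV"
  shows "(conv_against U \<rho> has_derivative
    (\<lambda>v. \<Sum>b\<in>Basis. (v \<bullet> b) * - conv_against U (iter_partial [b] \<rho>) z)) (at z)"
proof -
  have [measurable]: "U \<in> borel_measurable borel" using U by auto
  have sm: "smooth \<rho>" using \<rho> Cc_infty_smooth by blast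
  have [measurable]: "\<rho> \<in> borel_measurable borel" using sm by (rule smooth_borel_measurable)
  have pm [measurable]: "iter_partial [b] \<rho> \<in> borel_measurable borel" if "b \<in> Basis" for b
    using smooth_iter_partial[OF sm, of "[b]"] that by (intro smooth_borel_measurable) simp
  define D where "D x v = frechet_derivative \<rho> (at x) v" for x v
  obtain L where L: "L \<ge> 0" "\<And>x v. \<bar>D x v\<bar> \<le> L * norm v" "\<And>x y. \<bar>\<rho> x - \<rho> y\<bar> \<le> L * norm (x - y)"
    using Cc_infty_derivative_bound[OF \<rho>] unfolding D_def by blast
  have Dsum: "D x v = (\<Sum>b\<in>Basis. (v \<bullet> b) * iter_partial [b] \<rho> x)" for x v
    unfolding D_def by (rule frechet_derivative_eq_sum_partial[OF sm])
  have Dm [measurable]: "(\<lambda>x. D x v) \<in> borel_measurable borel" for v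
    unfolding Dsum by measurable
  have int_p: "integrable lborel (\<lambda>y. U y * iter_partial [b] \<rho> (y - z))" if b: "b \<in> Basis" for b
  proof -
    obtain B where "\<And>x. \<bar>iter_partial [b] \<rho> x\<bar> \<le> B"
      using Cc_infty_bounded[OF partial_Cc_infty[OF \<rho> b]] by blast
    then show ?thesis using conv_integrable[OF U pm[OF b]] by blast
  qed
  have int_\<rho>: "integrable lborel (\<lambda>y. U y * \<rho> (y - z))" for z
  proof -
    obtain B where "\<And>x. \<bar>\<rho> x\<bar> \<le> B" using Cc_infty_bounded[OF \<rho>] by blast
    then show ?thesis by (intro conv_integrable[OF U]) auto
  qed
  have D_eq: "(\<Sum>b\<in>Basis. (v \<bullet> b) * - conv_against U (iter_partial [b] \<rho>) z) = - (\<integral>y. U y * D (y - z) v \<partial>lborel)" for v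
  proof -
    have "(\<integral>y. U y * D (y - z) v \<partial>lborel) = (\<integral>y. (\<Sum>b\<in>Basis. (v \<bullet> b) * (U y * iter_partial [b] \<rho> (y - z))) \<partial>lborel)"
      unfolding Dsum sum_distrib_left by (simp only: mult.left_commute)
    also have "\<dots> = (\<Sum>b\<in>Basis. (v \<bullet> b) * conv_against U (iter_partial [b] \<rho>) z)"
      unfolding conv_against_def using int_p
      by (subst Bochner_Integration.integral_sum) (auto simp del: iter_partial.simps)
    finally show ?thesis by (simp add: sum_negf del: iter_partial.simps)
  qed
  have int_D: "integrable lborel (\<lambda>y. U y * D (y - z) v)" for v
  proof -
    have "(\<lambda>y. U y * D (y - z) v) = (\<lambda>y. \<Sum>b\<in>Basis. (v \<bullet> b) * (U y * iter_partial [b] \<rho> (y - z)))"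
      unfolding Dsum sum_distrib_left by (simp only: mult.left_commute)
    then show ?thesis using int_p by (simp del: iter_partial.simps)
  qed
  \<comment> \<open>The normalised first-order remainder of the kernel as a function of
    \<open>w\<close>, with a plus sign before \<open>D\<close> because of the argument y - w. It is
    bounded by 2 L, one L from the Lipschitz estimate and one from the linear part, so 2 L
    \<bar>U\<bar> is a dominating function.\<close>
  define q where "q w y = (\<rho> (y - w) - \<rho> (y - z) + D (y - z) (w - z)) / norm (w - z)" for w y
  have q_bound: "\<bar>q w y\<bar> \<le> 2 * L" for w y
  proof (cases "w = z")
    case False
    have "\<bar>\<rho> (y - w) - \<rho> (y - z)\<bar> \<le> L * norm (w - z)"
      using L(3)[of "y - w" "y - z"] by (simp add: norm_minus_commute)
    then have "\<bar>\<rho> (y - w) - \<rho> (y - z) + D (y - z) (w - z)\<bar> \<le> 2 * L * norm (w - z)"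
      using L(2)[of "y - z" "w - z"] by linarith
    then show ?thesis using False by (simp add: q_def divide_le_eq abs_divide)
  qed (use L in \<open>simp add: q_def\<close>)
  have q_lim: "((\<lambda>w. q w y) \<longlongrightarrow> 0) (at z)" for y
  proof -
    have "((\<lambda>w. \<rho> (y - w)) has_derivative (\<lambda>v. D (y - z) (- v))) (at z)"
      unfolding D_def
      by (rule has_derivative_compose[where f = "\<lambda>w. y - w" and g = \<rho>, OF _ smooth_has_derivative[OF sm]])
        (auto intro!: derivative_eq_intros)
    moreover have "D x (- v) = - D x v" for x v
      unfolding D_def by (rule linear_neg) (use smooth_has_derivative[OF sm] has_derivative_linear in blast)
    ultimately have "((\<lambda>w. (\<rho> (y - w) - \<rho> (y - z) - - D (y - z) (w - z)) /\<^sub>R norm (w - z)) \<longlongrightarrow> 0) (at z)"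
      by (simp add: has_derivative_at_within)
    then show ?thesis by (simp add: q_def divide_inverse mult.commute)
  qed
  show ?thesis
    unfolding has_derivative_at_within
  proof
    show "bounded_linear (\<lambda>v. \<Sum>b\<in>Basis. (v \<bullet> b) * - conv_against U (iter_partial [b] \<rho>) z)"
      by (intro bounded_linear_sum bounded_linear_compose[OF bounded_linear_mult_left bounded_linear_inner_left])
    show "((\<lambda>w. (conv_against U \<rho> w - conv_against U \<rho> z -
        (\<Sum>b\<in>Basis. ((w - z) \<bullet> b) * - conv_against U (iter_partial [b] \<rho>) z)) /\<^sub>R norm (w - z)) \<longlongrightarrow> 0) (at z)"
      unfolding D_eq tendsto_at_iff_sequentially
    proof (intro allI impI)
      fix X :: "nat \<Rightarrow> 'a" assume X: "\<forall>i. X i \<in> UNIV - {z}" "X \<longlonglongrightarrow> z"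
      have "(\<lambda>n. \<integral>y. U y * q (X n) y \<partial>lborel) \<longlonglongrightarrow> (\<integral>y. 0 \<partial>(lborel :: 'a measure))"
      proof (rule integral_dominated_convergence[where w = "\<lambda>y. 2 * L * \<bar>U y\<bar>"])
        show "integrable lborel (\<lambda>y. 2 * L * \<bar>U y\<bar>)" using U by simp
        show "(\<lambda>y. U y * q (X n) y) \<in> borel_measurable lborel" for n
          unfolding q_def by measurable
        show "AE y in lborel. (\<lambda>n. U y * q (X n) y) \<longlonglongrightarrow> 0"
        proof (rule AE_I2)
          fix y
          have "(\<lambda>n. q (X n) y) \<longlonglongrightarrow> 0"
            using q_lim[of y] X unfolding tendsto_at_iff_sequentially by (auto simp: o_def)
          then show "(\<lambda>n. U y * q (X n) y) \<longlonglongrightarrow> 0" by (rule tendsto_mult_right_zero)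
        qed
        show "AE y in lborel. norm (U y * q (X n) y) \<le> 2 * L * \<bar>U y\<bar>" for n
          using q_bound[of "X n"] by (simp add: abs_mult mult.commute[of _ "\<bar>U _\<bar>"] mult_left_mono)
      qed simp
      moreover have "(\<integral>y. U y * q w y \<partial>lborel) = (conv_against U \<rho> w - conv_against U \<rho> z - - (\<integral>y. U y * D (y - z) (w - z) \<partial>lborel)) /\<^sub>R norm (w - z)" for w
      proof -
        have "(\<integral>y. U y * q w y \<partial>lborel) = (\<integral>y. inverse (norm (w - z)) * (U y * \<rho> (y - w) - U y * \<rho> (y - z) + U y * D (y - z) (w - z)) \<partial>lborel)"
          unfolding q_def by (intro Bochner_Integration.integral_cong) (auto simp: field_simps)
        also have "\<dots> = inverse (norm (w - z)) * (\<integral>y. (U y * \<rho> (y - w) - U y * \<rho> (y - z) + U y * D (y - z) (w - z)) \<partial>lborel)"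
          by simp
        also have "(\<integral>y. (U y * \<rho> (y - w) - U y * \<rho> (y - z) + U y * D (y - z) (w - z)) \<partial>lborel)
            = conv_against U \<rho> w - conv_against U \<rho> z + (\<integral>y. U y * D (y - z) (w - z) \<partial>lborel)"
          unfolding conv_against_def using int_\<rho> int_D by simp
        finally show ?thesis by simp
      qed
      ultimately show "((\<lambda>w. (conv_against U \<rho> w - conv_against U \<rho> z - - (\<integral>y. U y * D (y - z) (w - z) \<partial>lborel)) /\<^sub>R norm (w - z)) \<circ> X) \<longlonglongrightarrow> 0"
        by (simp add: o_def)
    qed
  qed
qed

lemma conv_partial:
  fixes U :: "'a::euclidean_space \<Rightarrow> real"
  assumes "integrable lborel U" "\<rho> \<in> Cc_infty UNIV" "b \<in> Basis"
  shows "iter_partial [b] (conv_against U \<rho>) = (\<lambda>z. - conv_against U (iter_partial [b] \<rho>) z)"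
proof
  fix z
  have "iter_partial [b] (conv_against U \<rho>) z = (\<Sum>c\<in>Basis. (b \<bullet> c) * - conv_against U (iter_partial [c] \<rho>) z)"
    unfolding iter_partial_single[of b] frechet_derivative_eq[OF conv_has_derivative[OF assms(1,2)]] ..
  also have "\<dots> = (\<Sum>c\<in>Basis. if c = b then - conv_against U (iter_partial [c] \<rho>) z else 0)"
    by (intro sum.cong) (use assms(3) in \<open>auto simp: inner_Basis\<close>)
  finally show "iter_partial [b] (conv_against U \<rho>) z = - conv_against U (iter_partial [b] \<rho>) z"
    using assms(3) by (simp del: iter_partial.simps)
qed

text \<open>Averages of the same \<open>U\<close> against varying test kernels form a class closed
  under partials: the derivative and its sign are absorbed by the kernel.\<close>

lemma conv_smooth:
  fixes U :: "'a::euclidean_space \<Rightarrow> real"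
  assumes U: "integrable lborel U" and \<rho>: "\<rho> \<in> Cc_infty UNIV"
  shows "smooth (conv_against U \<rho>)"
proof (rule smooth_coinduct[of "\<lambda>f. \<exists>\<rho>\<in>Cc_infty UNIV. f = conv_against U \<rho>"])
  show "\<exists>\<rho>'\<in>Cc_infty UNIV. conv_against U \<rho> = conv_against U \<rho>'" using \<rho> by blast
next
  fix g x assume "\<exists>\<rho>\<in>Cc_infty UNIV. g = conv_against U \<rho>"
  then show "g differentiable (at x)"
    using conv_has_derivative[OF U] unfolding differentiable_def by blast
next
  fix g and b :: 'a assume "\<exists>\<rho>\<in>Cc_infty UNIV. g = conv_against U \<rho>" and b: "b \<in> Basis"
  then obtain \<rho> where \<rho>: "\<rho> \<in> Cc_infty UNIV" "g = conv_against U \<rho>" by blast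
  have "(\<lambda>x. -1 * iter_partial [b] \<rho> x) \<in> Cc_infty UNIV"
    by (intro Cc_infty_cmult iter_partial_Cc_infty \<rho>) (use b in simp)
  moreover have "iter_partial [b] g = conv_against U (\<lambda>x. -1 * iter_partial [b] \<rho> x)"
    unfolding \<rho>(2) conv_partial[OF U \<rho>(1) b] by (simp add: conv_against_def fun_eq_iff del: iter_partial.simps)
  ultimately show "\<exists>\<rho>\<in>Cc_infty UNIV. iter_partial [b] g = conv_against U \<rho>" by blast
qed

lemma conv_iter_partial:
  fixes U :: "'a::euclidean_space \<Rightarrow> real"
  assumes U: "integrable lborel U" and \<rho>: "\<rho> \<in> Cc_infty UNIV" and bs: "set bs \<subseteq> Basis"
  shows "iter_partial bs (conv_against U \<rho>) z = (-1) ^ length bs * conv_against U (iter_partial bs \<rho>) z"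
  using bs
proof (induction bs arbitrary: z)
  case (Cons b bs)
  have \<rho>': "iter_partial bs \<rho> \<in> Cc_infty UNIV" using Cons.prems by (intro iter_partial_Cc_infty \<rho>) simp
  have b: "b \<in> Basis" using Cons.prems by simp
  have "iter_partial bs (conv_against U \<rho>) = (\<lambda>z. (-1) ^ length bs * conv_against U (iter_partial bs \<rho>) z)"
    using Cons by auto
  then have "iter_partial (b # bs) (conv_against U \<rho>) z =
      frechet_derivative (\<lambda>z. (-1) ^ length bs * conv_against U (iter_partial bs \<rho>) z) (at z) b" by simp
  also have "\<dots> = (-1) ^ length bs * iter_partial [b] (conv_against U (iter_partial bs \<rho>)) z"
    unfolding iter_partial_single
    using has_derivative_mult_right[OF smooth_has_derivative[OF conv_smooth[OF U \<rho>']], of "(-1) ^ length bs" z]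
    by (simp add: frechet_derivative_eq)
  also have "\<dots> = (-1) ^ length bs * - conv_against U (iter_partial (b # bs) \<rho>) z"
    unfolding conv_partial[OF U \<rho>' b] by simp
  finally show ?case by simp
qed simp

text \<open>
  The average of the indicator of a large ball against \<open>\<rho>\<close> is constant near the origin, and its
  derivative there is minus the integral in question.
\<close>

lemma integral_partial_eq_0:
  fixes \<rho> :: "'a::euclidean_space \<Rightarrow> real"
  assumes \<rho>: "\<rho> \<in> Cc_infty UNIV" and b: "b \<in> Basis"
  shows "(\<integral>y. iter_partial [b] \<rho> y \<partial>lborel) = 0"
proof -
  obtain K where K: "smooth \<rho>" "compact K" "\<And>x. x \<notin> K \<Longrightarrow> \<rho> x = 0"
    using Cc_infty_support[OF \<rho>] Cc_infty_smooth[OF \<rho>] by metis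
  obtain R where R: "\<And>x. x \<in> K \<Longrightarrow> norm x \<le> R"
    using compact_imp_bounded[OF K(2)] unfolding bounded_iff by blast
  define U :: "'a \<Rightarrow> real" where "U = indicator (cball 0 (R + 1))"
  have U: "integrable lborel U"
    unfolding U_def
    by (intro integrable_real_indicator emeasure_bounded_finite) simp_all
  have [measurable]: "\<rho> \<in> borel_measurable borel" using K(1) by (rule smooth_borel_measurable)
  have const: "conv_against U \<rho> z = (\<integral>y. \<rho> y \<partial>lborel)" if "z \<in> ball 0 1" for z
  proof -
    have "U y * \<rho> (y - z) = \<rho> (y - z)" for y
    proof (cases "y - z \<in> K")
      case True
      then have "norm y \<le> R + 1"
        using R[OF True] that norm_triangle_ineq[of "y - z" z] by simp
      then show ?thesis by (simp add: U_def)
    qed (simp add: K)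
    then have "conv_against U \<rho> z = (\<integral>y. \<rho> (y - z) \<partial>lborel)"
      unfolding conv_against_def by (simp only:)
    then show ?thesis
      using lborel_integral_shift[of \<rho> "- z"] by simp
  qed
  have "iter_partial [b] (conv_against U \<rho>) 0 = iter_partial [b] (\<lambda>z. \<integral>y. \<rho> y \<partial>lborel) 0"
    by (rule iter_partial_cong_open[of "ball 0 1"]) (auto simp: const)
  also have "\<dots> = 0" by simp
  finally have "conv_against U (iter_partial [b] \<rho>) 0 = 0"
    unfolding conv_partial[OF U \<rho> b] by simp
  moreover have "U y * iter_partial [b] \<rho> (y - 0) = iter_partial [b] \<rho> y" for y
  proof (cases "y \<in> K")
    case True
    then show ?thesis using R[OF True] by (simp add: U_def del: iter_partial.simps)
  next
    case False
    then show ?thesis using iter_partial_eq_0[OF compact_imp_closed[OF K(2)] K(3) False, where bs = "[b]"]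
      by (simp del: iter_partial.simps)
  qed
  ultimately show ?thesis unfolding conv_against_def by (simp only:)
qed

text \<open>The product of \<psi> with any derivative of \<phi> is a test function, so the integral
  of its partial derivative vanishes. \<psi> is arbitrary in the induction because it collects the
  derivatives taken off \<phi>.\<close>

lemma integration_by_parts:
  fixes \<phi> \<psi> :: "'a::euclidean_space \<Rightarrow> real"
  assumes \<phi>: "\<phi> \<in> Cc_infty UNIV" and \<psi>: "smooth \<psi>" and bs: "set bs \<subseteq> Basis"
  shows "(\<integral>y. \<psi> y * iter_partial bs \<phi> y \<partial>lborel) = (-1) ^ length bs * (\<integral>y. iter_partial bs \<psi> y * \<phi> y \<partial>lborel)"
  using \<psi> bs
proof (induction bs arbitrary: \<psi>)
  case (Cons b bs)
  define f where "f = iter_partial bs \<phi>"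
  have f: "f \<in> Cc_infty UNIV" and b: "b \<in> Basis" and bs: "set bs \<subseteq> Basis"
    unfolding f_def using Cons.prems by (auto intro: iter_partial_Cc_infty \<phi>)
  have pf: "iter_partial [b] f \<in> Cc_infty UNIV" using b by (intro iter_partial_Cc_infty f) simp
  have p\<psi>: "smooth (iter_partial [b] \<psi>)" using b by (intro smooth_iter_partial Cons.prems) simp
  have prod: "iter_partial [b] (\<lambda>y. \<psi> y * f y) = (\<lambda>y. \<psi> y * iter_partial [b] f y + iter_partial [b] \<psi> y * f y)"
    by (rule ext) (simp add: frechet_derivative_mult smooth_differentiable Cons.prems(1) Cc_infty_smooth[OF f])
  have "0 = (\<integral>y. iter_partial [b] (\<lambda>y. \<psi> y * f y) y \<partial>lborel)"
    using integral_partial_eq_0[OF Cc_infty_mult[OF Cons.prems(1) f] b] by simp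
  also have "\<dots> = (\<integral>y. \<psi> y * iter_partial [b] f y \<partial>lborel) + (\<integral>y. iter_partial [b] \<psi> y * f y \<partial>lborel)"
    unfolding prod
    by (intro Bochner_Integration.integral_add Cc_infty_integrable[where \<Omega> = UNIV] Cc_infty_mult pf f p\<psi> Cons.prems)
  also have "(\<integral>y. iter_partial [b] \<psi> y * f y \<partial>lborel)
      = (-1) ^ length bs * (\<integral>y. iter_partial bs (iter_partial [b] \<psi>) y * \<phi> y \<partial>lborel)"
    unfolding f_def by (rule Cons.IH[OF p\<psi> bs])
  also have "iter_partial bs (iter_partial [b] \<psi>) = iter_partial (b # bs) \<psi>"
    by (rule iter_partial_rotate[OF Cons.prems(1) b bs])
  finally have *: "0 = (\<integral>y. \<psi> y * iter_partial [b] f y \<partial>lborel) +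
      (-1) ^ length bs * (\<integral>y. iter_partial (b # bs) \<psi> y * \<phi> y \<partial>lborel)" .
  have "iter_partial [b] f = iter_partial (b # bs) \<phi>" by (simp add: f_def)
  then show ?case using * by (simp del: iter_partial.simps)
qed simp

section \<open>Mollification in the weighted space\<close>

lemma smooth_sum: "(\<And>i. i \<in> I \<Longrightarrow> smooth (f i)) \<Longrightarrow> smooth (\<lambda>x. \<Sum>i\<in>I. f i x)"
  by (induction I rule: infinite_finite_induct) (auto intro: smooth_add smooth_const)

lemma smooth_inner_self: "smooth (\<lambda>x::'a::euclidean_space. x \<bullet> x)"
proof -
  have "(\<lambda>x::'a. x \<bullet> x) = (\<lambda>x. \<Sum>b\<in>Basis. (x \<bullet> b) * (x \<bullet> b))"
    by (rule ext) (rule euclidean_inner)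
  then show ?thesis by (auto intro!: smooth_sum smooth_mult smooth_inner)
qed

text \<open>The bump is a flat exponential of r^2 - \<bar>x - p\<bar>^2, which is polynomial in
  \<open>x\<close> and positive exactly on the open ball. It can be normalised: with zero integral
  it would vanish almost everywhere, but the ball has positive measure.\<close>

lemma mollifier_exists:
  fixes p :: "'a::euclidean_space"
  assumes r: "r > 0"
  shows "\<exists>\<rho>\<in>Cc_infty UNIV. (\<forall>x. \<rho> x \<ge> 0) \<and> (\<forall>x. x \<notin> cball p r \<longrightarrow> \<rho> x = 0) \<and> (\<integral>x. \<rho> x \<partial>lborel) = 1"
proof -
  define f where "f x = flat_exp 0 (r\<^sup>2 - (x - p) \<bullet> (x - p))" for x
  have 1: "smooth (\<lambda>x. (x - p) \<bullet> (x - p))"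
    using smooth_affine[OF smooth_inner_self, of 1 "- p"] by simp
  have sm: "smooth f"
    unfolding f_def[abs_def] by (intro smooth_compose[OF smooth_flat_exp] smooth_diff 1 smooth_const)
  have lt: "0 < r\<^sup>2 - (x - p) \<bullet> (x - p) \<longleftrightarrow> x \<in> ball p r" for x
    using r by (simp add: dist_norm norm_minus_commute abs_square_less_1 flip: power2_norm_eq_inner)
      (metis abs_of_pos abs_norm_cancel power2_less_imp_less power_strict_mono norm_ge_zero less_imp_le zero_less_numeral)
  have f0: "f x = 0" if "x \<notin> cball p r" for x
    using lt[of x] that ball_subset_cball[of p r] by (auto simp: f_def flat_exp_eq_0)
  have f: "f \<in> Cc_infty UNIV"
    by (rule Cc_inftyI[OF sm, of "cball p r"]) (auto simp: f0)
  have nonneg: "f x \<ge> 0" for x by (simp add: f_def flat_exp_nonneg)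
  have "(\<integral>x. f x \<partial>lborel) \<noteq> 0"
  proof
    assume "(\<integral>x. f x \<partial>lborel) = 0"
    then have "AE x in lborel. f x = 0"
      using integral_nonneg_eq_0_iff_AE[OF Cc_infty_integrable[OF f]] nonneg by simp
    then have "AE x in lborel. x \<notin> ball p r"
    proof eventually_elim
      case (elim x)
      then show ?case using lt[of x] flat_exp_pos[of "r\<^sup>2 - (x - p) \<bullet> (x - p)"] unfolding f_def by linarith
    qed
    then have "emeasure lborel (ball p r) = 0"
      by (subst (asm) AE_iff_null_sets[symmetric]) (auto intro: null_setsD1)
    then show False
      using content_ball_pos[OF r, of p] by (simp add: measure_def)
  qed
  moreover have "(\<integral>x. f x \<partial>lborel) \<ge> 0" using nonneg by simp
  ultimately have I: "(\<integral>x. f x \<partial>lborel) > 0" by simp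
  show ?thesis
  proof (intro bexI[of _ "\<lambda>x. (1 / (\<integral>x. f x \<partial>lborel)) * f x"] Cc_infty_cmult f conjI allI impI)
    show "(\<integral>x. 1 / (\<integral>x. f x \<partial>lborel) * f x \<partial>lborel) = 1" using I by simp
  qed (use I nonneg f0 in auto)
qed

lemma mem_half_space: "z \<in> half_space \<longleftrightarrow> 0 < snd z"
  by (cases z) (simp add: half_space_def)

lemma open_half_space: "open half_space"
  unfolding half_space_def by (intro open_Times) auto

lemma half_space_borel [measurable]: "half_space \<in> sets borel"
  by (intro borel_open open_half_space)

lemma snd_borel_measurable [measurable]:
  "snd \<in> borel_measurable (borel :: ('a::euclidean_space \<times> 'b::euclidean_space) measure)"
  by (intro borel_measurable_continuous_onI continuous_on_snd continuous_on_id)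

text \<open>The L1 norm with weight t^a over the half space. It is extended-valued and taken over
  \<open>lborel\<close>, so it can be formed before integrability is known and is meant for Borel
  representatives.\<close>

definition weighted_err :: "real \<Rightarrow> ((real ^ 'n::finite) \<times> real \<Rightarrow> real) \<Rightarrow> ennreal" where
  "weighted_err a g = (\<integral>\<^sup>+z. indicator half_space z * ennreal (snd z powr a * \<bar>g z\<bar>) \<partial>lborel)"

lemma weighted_err_add:
  fixes f g h :: "(real ^ 'n::finite) \<times> real \<Rightarrow> real"
  assumes [measurable]: "f \<in> borel_measurable borel" "g \<in> borel_measurable borel"
    and "\<And>z. z \<in> half_space \<Longrightarrow> \<bar>h z\<bar> \<le> \<bar>f z\<bar> + \<bar>g z\<bar>"
  shows "weighted_err a h \<le> weighted_err a f + weighted_err a g"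
proof -
  have "weighted_err a h \<le> (\<integral>\<^sup>+z. indicator half_space z * ennreal (snd z powr a * \<bar>f z\<bar>)
      + indicator half_space z * ennreal (snd z powr a * \<bar>g z\<bar>) \<partial>lborel)"
    unfolding weighted_err_def
  proof (rule nn_integral_mono)
    fix z :: "(real ^ 'n) \<times> real"
    have "ennreal (snd z powr a * \<bar>h z\<bar>) \<le> ennreal (snd z powr a * \<bar>f z\<bar> + snd z powr a * \<bar>g z\<bar>)" if "z \<in> half_space"
      using mult_left_mono[OF assms(3)[OF that], of "snd z powr a"]
      by (intro ennreal_leI) (simp add: distrib_left)
    then show "indicator half_space z * ennreal (snd z powr a * \<bar>h z\<bar>) \<le>
      indicator half_space z * ennreal (snd z powr a * \<bar>f z\<bar>) + indicator half_space z * ennreal (snd z powr a * \<bar>g z\<bar>)"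
      by (cases "z \<in> half_space") (simp_all add: ennreal_plus)
  qed
  also have "\<dots> = weighted_err a f + weighted_err a g"
    unfolding weighted_err_def by (rule nn_integral_add) measurable
  finally show ?thesis .
qed

text \<open>With G = t^a g, extended by zero, t^a g(z + y) = q G(z + y) where q = (t / (t + s))^a
  and s is the height of \<open>y\<close>. As s \<ge> 0 and a \<ge> 0, q lies in [0, 1], and the
  error is at most \<bar>G(z + y) - G(z)\<bar> + (1 - q) \<bar>G(z + y)\<bar>. The first term is
  continuity of translations in L1, the second is handled by dominated convergence. A downward shift
  would leave the half space near the boundary.\<close>

lemma weighted_translation:
  fixes g :: "(real ^ 'n::finite) \<times> real \<Rightarrow> real"
  assumes gm [measurable]: "g \<in> borel_measurable borel" and a: "a \<ge> 0"
    and fin: "weighted_err a g < \<infinity>" and e: "(e::real) > 0"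
  shows "\<exists>d>0. \<forall>y. norm y < d \<and> 0 \<le> snd y \<longrightarrow> weighted_err a (\<lambda>z. g (z + y) - g z) < e"
proof -
  define G where "G z = indicator half_space z * (snd z powr a * g z)" for z
  have Gm [measurable]: "G \<in> borel_measurable borel" unfolding G_def by measurable
  have G: "integrable lborel G"
  proof (rule integrableI_bounded)
    have "(\<integral>\<^sup>+z. ennreal (norm (G z)) \<partial>lborel) = weighted_err a g"
      unfolding weighted_err_def by (intro nn_integral_cong) (auto simp: G_def indicator_def abs_mult)
    then show "(\<integral>\<^sup>+z. ennreal (norm (G z)) \<partial>lborel) < \<infinity>" using fin by simp
  qed simp
  \<comment> \<open>\<open>\<kappa> \<eta>\<close> at the shifted point bounds 1 - q for every shift
    of height at most \<eta>. Since it depends on the shifted point alone, translation invariance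
    removes \<open>y\<close>. The maximum with 0 covers points lower than \<eta>; as \<eta> tends to
    0 the bound vanishes pointwise in the half space.\<close>
  define \<kappa> where "\<kappa> \<eta> z = 1 - (max 0 (snd z - \<eta>) / snd z) powr a" for \<eta> :: real and z :: "(real ^ 'n) \<times> real"
  have [measurable]: "\<kappa> \<eta> \<in> borel_measurable borel" for \<eta> unfolding \<kappa>_def by measurable
  have \<kappa>: "0 \<le> \<kappa> \<eta> z \<and> \<kappa> \<eta> z \<le> 1" if "0 < snd z" "0 \<le> \<eta>" for \<eta> z
  proof -
    have "(max 0 (snd z - \<eta>) / snd z) powr a \<le> 1 powr a"
      using that by (intro powr_mono2 a) (auto simp: divide_le_eq)
    then show ?thesis by (simp add: \<kappa>_def)
  qed
  define h where "h n = 1 / real (Suc n)" for n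
  have h: "h n > 0" for n by (simp add: h_def)
  have h0: "h \<longlonglongrightarrow> 0" unfolding h_def using LIMSEQ_inverse_real_of_nat by (simp add: inverse_eq_divide)
  have "(\<lambda>n. \<integral>\<^sup>+z. ennreal (norm (0 - G z * \<kappa> (h n) z)) \<partial>lborel) \<longlonglongrightarrow> 0"
  proof (rule nn_integral_dominated_convergence_norm[where w = "\<lambda>z. \<bar>G z\<bar>"])
    show "AE z in lborel. norm (G z * \<kappa> (h n) z) \<le> \<bar>G z\<bar>" for n
    proof (rule AE_I2)
      fix z
      show "norm (G z * \<kappa> (h n) z) \<le> \<bar>G z\<bar>"
        using \<kappa>[of z "h n"] h[of n]
        by (cases "z \<in> half_space") (auto simp: G_def mem_half_space abs_mult mult_left_le)
    qed
    show "(\<integral>\<^sup>+z. ennreal \<bar>G z\<bar> \<partial>lborel) < \<infinity>" using G by (simp add: integrable_iff_bounded)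
    show "AE z in lborel. (\<lambda>n. G z * \<kappa> (h n) z) \<longlonglongrightarrow> 0"
    proof (rule AE_I2)
      fix z :: "(real ^ 'n) \<times> real"
      show "(\<lambda>n. G z * \<kappa> (h n) z) \<longlonglongrightarrow> 0"
      proof (cases "z \<in> half_space")
        case True
        then have t: "snd z > 0" by (simp add: mem_half_space)
        have "(\<lambda>n. max 0 (snd z - h n) / snd z) \<longlonglongrightarrow> max 0 (snd z - 0) / snd z"
          using t by (intro tendsto_intros h0) auto
        then have "(\<lambda>n. max 0 (snd z - h n) / snd z) \<longlonglongrightarrow> 1" using t by simp
        then have "(\<lambda>n. (max 0 (snd z - h n) / snd z) powr a) \<longlonglongrightarrow> 1 powr a"
          by (intro tendsto_powr tendsto_const) auto
        then have "(\<lambda>n. \<kappa> (h n) z) \<longlonglongrightarrow> 1 - 1 powr a"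
          unfolding \<kappa>_def by (rule tendsto_diff[OF tendsto_const])
        then show ?thesis using tendsto_mult_right_zero[of "\<lambda>n. \<kappa> (h n) z"] by simp
      qed (simp add: G_def)
    qed
  qed measurable
  then have "\<forall>\<^sub>F n in sequentially. (\<integral>\<^sup>+z. ennreal (norm (0 - G z * \<kappa> (h n) z)) \<partial>lborel) < ennreal (e/2)"
    using e by (intro order_tendstoD) auto
  then obtain n where n: "(\<integral>\<^sup>+z. ennreal \<bar>G z * \<kappa> (h n) z\<bar> \<partial>lborel) < ennreal (e/2)"
    by (auto simp: eventually_sequentially)
  obtain d where d: "d > 0" "\<And>y. norm y < d \<Longrightarrow> (\<integral>\<^sup>+z. ennreal \<bar>G (z + y) - G z\<bar> \<partial>lborel) < ennreal (e/2)"
    using translation_continuous_L1[OF G, of "e/2"] e by auto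
  have "weighted_err a (\<lambda>z. g (z + y) - g z) < e" if y: "norm y < min d (h n)" "0 \<le> snd y" for y
  proof -
    have sy: "snd y \<le> h n" using norm_snd_le[where x = "fst y" and y = "snd y"] y by simp
    have "weighted_err a (\<lambda>z. g (z + y) - g z)
      \<le> (\<integral>\<^sup>+z. ennreal \<bar>G (z + y) - G z\<bar> + ennreal \<bar>G (z + y) * \<kappa> (h n) (z + y)\<bar> \<partial>lborel)"
      unfolding weighted_err_def
    proof (rule nn_integral_mono)
      fix z :: "(real ^ 'n) \<times> real"
      show "indicator half_space z * ennreal (snd z powr a * \<bar>g (z + y) - g z\<bar>)
        \<le> ennreal \<bar>G (z + y) - G z\<bar> + ennreal \<bar>G (z + y) * \<kappa> (h n) (z + y)\<bar>"
      proof (cases "z \<in> half_space")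
        case True
        then have t: "snd z > 0" "snd (z + y) > 0" using y by (auto simp: mem_half_space)
        define q where "q = (snd z / snd (z + y)) powr a"
        have qG: "snd z powr a * g (z + y) = q * G (z + y)"
          using t by (simp add: q_def G_def mem_half_space powr_divide)
        have Gz: "snd z powr a * g z = G z" using t by (simp add: G_def mem_half_space)
        have "(max 0 (snd (z + y) - h n) / snd (z + y)) powr a \<le> q"
          unfolding q_def using t sy y(2) by (intro powr_mono2 a divide_right_mono) (auto simp: )
        moreover have "q \<le> 1 powr a"
          unfolding q_def using t y(2) by (intro powr_mono2 a) (auto simp: divide_le_eq)
        ultimately have q: "0 \<le> 1 - q" "1 - q \<le> \<kappa> (h n) (z + y)" by (auto simp: \<kappa>_def)
        have "snd z powr a * \<bar>g (z + y) - g z\<bar> = \<bar>snd z powr a * g (z + y) - snd z powr a * g z\<bar>"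
          by (simp add: abs_mult flip: right_diff_distrib)
        also have "\<dots> = \<bar>(G (z + y) - G z) - G (z + y) * (1 - q)\<bar>"
          unfolding qG Gz by (simp add: algebra_simps)
        also have "\<dots> \<le> \<bar>G (z + y) - G z\<bar> + \<bar>G (z + y)\<bar> * (1 - q)"
          using abs_triangle_ineq4[of "G (z + y) - G z" "G (z + y) * (1 - q)"] q by (simp add: abs_mult)
        also have "\<dots> \<le> \<bar>G (z + y) - G z\<bar> + \<bar>G (z + y) * \<kappa> (h n) (z + y)\<bar>"
          using q by (auto simp: abs_mult intro!: mult_left_mono)
        finally have "ennreal (snd z powr a * \<bar>g (z + y) - g z\<bar>)
          \<le> ennreal (\<bar>G (z + y) - G z\<bar> + \<bar>G (z + y) * \<kappa> (h n) (z + y)\<bar>)" by (rule ennreal_leI)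
        then show ?thesis using True by (simp only: ennreal_plus[OF abs_ge_zero abs_ge_zero]) simp
      qed simp
    qed
    also have "\<dots> = (\<integral>\<^sup>+z. ennreal \<bar>G (z + y) - G z\<bar> \<partial>lborel) + (\<integral>\<^sup>+z. ennreal \<bar>G (z + y) * \<kappa> (h n) (z + y)\<bar> \<partial>lborel)"
      by (rule nn_integral_add) measurable
    also have "(\<integral>\<^sup>+z. ennreal \<bar>G (z + y) * \<kappa> (h n) (z + y)\<bar> \<partial>lborel) = (\<integral>\<^sup>+z. ennreal \<bar>G z * \<kappa> (h n) z\<bar> \<partial>lborel)"
      by (rule lborel_nn_integral_shift) measurable
    also have "(\<integral>\<^sup>+z. ennreal \<bar>G (z + y) - G z\<bar> \<partial>lborel) + (\<integral>\<^sup>+z. ennreal \<bar>G z * \<kappa> (h n) z\<bar> \<partial>lborel)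
        < ennreal (e/2) + ennreal (e/2)"
      using n d(2)[of y] y by (intro add_strict_mono) auto
    finally show ?thesis using e by (simp flip: ennreal_plus)
  qed
  then show ?thesis using d(1) h[of n] by (intro exI[of _ "min d (h n)"]) auto
qed

lemma conv_against_shift:
  fixes g :: "'a::euclidean_space \<Rightarrow> real"
  assumes [measurable]: "g \<in> borel_measurable borel" "\<rho> \<in> borel_measurable borel"
  shows "conv_against g \<rho> z = (\<integral>y. g (z + y) * \<rho> y \<partial>lborel)"
  unfolding conv_against_def
  by (subst lborel_integral_shift[of "\<lambda>y. g y * \<rho> (y - z)" z, symmetric]) (simp_all add: add.commute)

text \<open>As \<rho> has mass 1, the average minus g(z) is the average of g(z + y) - g(z), and
  Tonelli bounds the error by the \<rho>-mean of translation errors, each below \<open>e\<close>.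
  The radius \<open>d\<close> depends on \<open>g\<close> but not on \<rho>, so several functions
  can share one kernel.\<close>

lemma weighted_mollify:
  fixes g :: "(real ^ 'n::finite) \<times> real \<Rightarrow> real"
  assumes gm [measurable]: "g \<in> borel_measurable borel" and a: "a \<ge> 0"
    and fin: "weighted_err a g < \<infinity>" and e: "(e::real) > 0"
  shows "\<exists>d>0. \<forall>\<rho>. integrable lborel \<rho> \<and> (\<forall>y. 0 \<le> \<rho> y) \<and> (\<integral>y. \<rho> y \<partial>lborel) = 1 \<and>
    (\<forall>y. \<rho> y \<noteq> 0 \<longrightarrow> norm y < d \<and> 0 \<le> snd y) \<longrightarrow>
    weighted_err a (\<lambda>z. conv_against g \<rho> z - g z) \<le> e"
proof -
  obtain d where d: "d > 0" "\<And>y. norm y < d \<Longrightarrow> 0 \<le> snd y \<Longrightarrow> weighted_err a (\<lambda>z. g (z + y) - g z) < e"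
    using weighted_translation[OF assms] by blast
  have "weighted_err a (\<lambda>z. conv_against g \<rho> z - g z) \<le> e"
    if \<rho>: "integrable lborel \<rho>" "\<And>y. 0 \<le> \<rho> y" "(\<integral>y. \<rho> y \<partial>lborel) = 1"
      "\<And>y. \<rho> y \<noteq> 0 \<Longrightarrow> norm y < d \<and> 0 \<le> snd y" for \<rho>
  proof -
    have [measurable]: "\<rho> \<in> borel_measurable borel" using \<rho>(1) by auto
    have pt: "ennreal \<bar>conv_against g \<rho> z - g z\<bar> \<le> (\<integral>\<^sup>+y. ennreal (\<bar>g (z + y) - g z\<bar> * \<rho> y) \<partial>lborel)" for z
      \<comment> \<open>if the average at \<open>z\<close> is an undefined integral (with value 0), the right-hand side is infinite\<close>
    proof (cases "(\<integral>\<^sup>+y. ennreal (\<bar>g (z + y) - g z\<bar> * \<rho> y) \<partial>lborel) < \<infinity>")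
      case True
      have int: "integrable lborel (\<lambda>y. (g (z + y) - g z) * \<rho> y)"
      proof (rule integrableI_bounded)
        show "(\<integral>\<^sup>+y. ennreal (norm ((g (z + y) - g z) * \<rho> y)) \<partial>lborel) < \<infinity>"
          using True \<rho>(2) by (simp add: abs_mult)
      qed measurable
      have "conv_against g \<rho> z = (\<integral>y. (g (z + y) - g z) * \<rho> y + g z * \<rho> y \<partial>lborel)"
        by (subst conv_against_shift) (auto simp: algebra_simps)
      also have "\<dots> = (\<integral>y. (g (z + y) - g z) * \<rho> y \<partial>lborel) + g z"
        using int \<rho>(1,3) by simp
      finally have "conv_against g \<rho> z - g z = (\<integral>y. (g (z + y) - g z) * \<rho> y \<partial>lborel)" by simp
      then have "ennreal \<bar>conv_against g \<rho> z - g z\<bar> = ennreal (norm (\<integral>y. (g (z + y) - g z) * \<rho> y \<partial>lborel))" by simp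
      also have "\<dots> \<le> (\<integral>\<^sup>+y. ennreal (norm ((g (z + y) - g z) * \<rho> y)) \<partial>lborel)"
        by (rule integral_norm_bound_ennreal[OF int])
      finally show ?thesis using \<rho>(2) by (simp add: abs_mult)
    qed (simp add: not_less top_unique)
    have "weighted_err a (\<lambda>z. conv_against g \<rho> z - g z)
      \<le> (\<integral>\<^sup>+z. (\<integral>\<^sup>+y. ennreal (\<rho> y) * (indicator half_space z * ennreal (snd z powr a * \<bar>g (z + y) - g z\<bar>)) \<partial>lborel) \<partial>lborel)"
      unfolding weighted_err_def
    proof (rule nn_integral_mono)
      fix z :: "(real ^ 'n) \<times> real"
      have "indicator half_space z * ennreal (snd z powr a * \<bar>conv_against g \<rho> z - g z\<bar>)
        = (indicator half_space z * ennreal (snd z powr a)) * ennreal \<bar>conv_against g \<rho> z - g z\<bar>"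
        by (simp add: ennreal_mult mult.assoc)
      also have "\<dots> \<le> (indicator half_space z * ennreal (snd z powr a)) * (\<integral>\<^sup>+y. ennreal (\<bar>g (z + y) - g z\<bar> * \<rho> y) \<partial>lborel)"
        by (intro mult_left_mono pt) simp
      also have "\<dots> = (\<integral>\<^sup>+y. (indicator half_space z * ennreal (snd z powr a)) * ennreal (\<bar>g (z + y) - g z\<bar> * \<rho> y) \<partial>lborel)"
        by (rule nn_integral_cmult[symmetric]) measurable
      also have "\<dots> = (\<integral>\<^sup>+y. ennreal (\<rho> y) * (indicator half_space z * ennreal (snd z powr a * \<bar>g (z + y) - g z\<bar>)) \<partial>lborel)"
        using \<rho>(2) by (intro nn_integral_cong) (simp add: ennreal_mult mult_ac)
      finally show "indicator half_space z * ennreal (snd z powr a * \<bar>conv_against g \<rho> z - g z\<bar>) \<le> \<dots>" .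
    qed
    also have "\<dots> = (\<integral>\<^sup>+y. (\<integral>\<^sup>+z. ennreal (\<rho> y) * (indicator half_space z * ennreal (snd z powr a * \<bar>g (z + y) - g z\<bar>)) \<partial>lborel) \<partial>lborel)"
      by (rule lborel_pair.Fubini'[symmetric]) measurable
    also have "\<dots> = (\<integral>\<^sup>+y. ennreal (\<rho> y) * weighted_err a (\<lambda>z. g (z + y) - g z) \<partial>lborel)"
      unfolding weighted_err_def by (intro nn_integral_cong nn_integral_cmult) measurable
    also have "\<dots> \<le> (\<integral>\<^sup>+y. ennreal (\<rho> y) * ennreal e \<partial>lborel)"
    proof (rule nn_integral_mono)
      fix y
      show "ennreal (\<rho> y) * weighted_err a (\<lambda>z. g (z + y) - g z) \<le> ennreal (\<rho> y) * ennreal e"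
      proof (cases "\<rho> y = 0")
        case False
        then show ?thesis using d(2)[of y] \<rho>(4)[of y] by (intro mult_left_mono) auto
      qed simp
    qed
    also have "\<dots> = (\<integral>\<^sup>+y. ennreal (\<rho> y) \<partial>lborel) * ennreal e"
      by (rule nn_integral_multc) measurable
    also have "(\<integral>\<^sup>+y. ennreal (\<rho> y) \<partial>lborel) = 1"
      using nn_integral_eq_integral[OF \<rho>(1)] \<rho>(2,3) by simp
    finally show ?thesis by simp
  qed
  then show ?thesis using d(1) by blast
qed

section \<open>Weak derivatives on the half space\<close>

definition exhaustion :: "nat \<Rightarrow> ((real ^ 'n::finite) \<times> real) set" where
  "exhaustion n = cball 0 (real n) \<inter> {z. 1 / real (Suc n) \<le> snd z}"

lemma compact_exhaustion: "compact (exhaustion n)"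
  unfolding exhaustion_def
  by (intro compact_Int_closed compact_cball closed_Collect_le continuous_intros)

lemma exhaustion_subset: "exhaustion n \<subseteq> half_space"
proof
  fix z assume "z \<in> exhaustion n"
  then have "1 / real (Suc n) \<le> snd z" by (simp add: exhaustion_def)
  moreover have "0 < 1 / real (Suc n)" by simp
  ultimately show "z \<in> half_space" unfolding mem_half_space by linarith
qed

lemma eventually_exhaustion:
  assumes "z \<in> half_space"
  shows "\<forall>\<^sub>F n in sequentially. z \<in> exhaustion n"
proof -
  have "(\<lambda>n. 1 / real (Suc n)) \<longlonglongrightarrow> 0"
    using LIMSEQ_inverse_real_of_nat by (simp add: inverse_eq_divide)
  then have "\<forall>\<^sub>F n in sequentially. 1 / real (Suc n) < snd z"
    using assms by (intro order_tendstoD(2)) (auto simp: mem_half_space)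
  moreover have "\<forall>\<^sub>F n in sequentially. norm z \<le> real n"
    using eventually_ge_at_top[of "nat \<lceil>norm z\<rceil>"] by eventually_elim linarith
  ultimately show ?thesis
    by eventually_elim (simp add: exhaustion_def)
qed

lemma exhaustion_borel [measurable]: "exhaustion n \<in> sets borel"
  by (intro borel_closed compact_imp_closed compact_exhaustion)

text \<open>Integrability on compact sets gives measurability only there; the exhaustion recovers it
  on the whole half space as a pointwise limit.\<close>

lemma L1_loc_measurable:
  assumes "u \<in> L1_loc half_space"
  shows "(\<lambda>z. indicator half_space z * u z) \<in> borel_measurable lebesgue"
proof (rule borel_measurable_LIMSEQ_real)
  show "(\<lambda>z. indicator (exhaustion i) z * u z) \<in> borel_measurable lebesgue" for i
    using assms compact_exhaustion[of i] exhaustion_subset[of i]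
    unfolding L1_loc_def set_integrable_def by (auto dest!: borel_measurable_integrable)
  fix z :: "(real ^ 'a) \<times> real"
  show "(\<lambda>i. indicator (exhaustion i) z * u z) \<longlonglongrightarrow> indicator half_space z * u z"
  proof (cases "z \<in> half_space")
    case True
    show ?thesis
      by (rule tendsto_eventually, rule eventually_mono[OF eventually_exhaustion[OF True]]) (use True in simp)
  next
    case False
    then have "z \<notin> exhaustion i" for i using exhaustion_subset by blast
    then show ?thesis using False by simp
  qed
qed

text \<open>
  Functions in \<^const>\<open>L1_loc\<close> are merely Lebesgue measurable on compact sets; Borel
  representatives make Tonelli and translation invariance available.
\<close>

definition borel_rep :: "((real ^ 'n::finite) \<times> real \<Rightarrow> real) \<Rightarrow> ((real ^ 'n) \<times> real \<Rightarrow> real) \<Rightarrow> bool" where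
  "borel_rep u v \<longleftrightarrow> u \<in> L1_loc half_space \<and> v \<in> borel_measurable borel \<and>
     (AE z in lborel. indicator half_space z * u z = v z)"

lemma borel_rep_exists: "u \<in> L1_loc half_space \<Longrightarrow> \<exists>v. borel_rep u v"
  using completion_ex_borel_measurable_real[OF L1_loc_measurable, of u] unfolding borel_rep_def by auto

lemma borel_rep_measurable: "borel_rep u v \<Longrightarrow> v \<in> borel_measurable borel"
  by (simp add: borel_rep_def)

lemma borel_rep_AE: "borel_rep u v \<Longrightarrow> AE z in lborel. z \<in> half_space \<longrightarrow> u z = v z"
  unfolding borel_rep_def by (auto elim!: eventually_mono)

lemma borel_rep_integral:
  assumes r: "borel_rep u v" and [measurable]: "\<psi> \<in> borel_measurable borel"
  shows "(LINT z:half_space|lebesgue. u z * \<psi> z) = (\<integral>z. v z * \<psi> z \<partial>lborel)"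
proof -
  have [measurable]: "v \<in> borel_measurable borel" using r by (rule borel_rep_measurable)
  have [measurable]: "(\<lambda>z. indicator half_space z * u z) \<in> borel_measurable lebesgue"
    using r by (intro L1_loc_measurable) (simp add: borel_rep_def)
  have \<psi>: "\<psi> \<in> borel_measurable lebesgue" "v \<in> borel_measurable lebesgue"
    by (auto intro!: measurable_completion)
  have "(LINT z:half_space|lebesgue. u z * \<psi> z) = (\<integral>z. (indicator half_space z * u z) * \<psi> z \<partial>lebesgue)"
    unfolding set_lebesgue_integral_def by (simp add: mult.assoc)
  also have "\<dots> = (\<integral>z. v z * \<psi> z \<partial>lebesgue)"
  proof (rule integral_cong_AE)
    have "AE z in lebesgue. indicator half_space z * u z = v z"
      using r unfolding borel_rep_def by (blast intro: AE_completion)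
    then show "AE z in lebesgue. indicator half_space z * u z * \<psi> z = v z * \<psi> z"
      by eventually_elim simp
  qed (use \<psi> in measurable)
  also have "\<dots> = (\<integral>z. v z * \<psi> z \<partial>lborel)"
    by (rule integral_completion) measurable
  finally show ?thesis .
qed

lemma borel_rep_integrable_compact:
  assumes r: "borel_rep u v" and K: "compact K" "K \<subseteq> half_space"
  shows "integrable lborel (\<lambda>z. indicator K z * v z)"
proof -
  have [measurable]: "v \<in> borel_measurable borel" using r by (rule borel_rep_measurable)
  have [measurable]: "K \<in> sets borel" by (intro borel_closed compact_imp_closed K)
  have "integrable lebesgue (\<lambda>z. indicator K z *\<^sub>R u z)"
    using r K unfolding borel_rep_def L1_loc_def set_integrable_def by blast
  then have "integrable lebesgue (\<lambda>z. indicator K z * v z)"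
  proof (rule integrable_cong_AE_imp)
    show "(\<lambda>z. indicator K z * v z) \<in> borel_measurable lebesgue"
      by (intro measurable_completion) measurable
    have "AE z in lebesgue. indicator half_space z * u z = v z"
      using r unfolding borel_rep_def by (blast intro: AE_completion)
    then show "AE z in lebesgue. indicator K z *\<^sub>R u z = indicator K z * v z"
    proof eventually_elim
      case (elim z)
      then show ?case using K(2) by (cases "z \<in> K") auto
    qed
  qed
  then show ?thesis by (subst (asm) integrable_completion) measurable
qed

lemma borel_rep_integrable_Cc:
  assumes r: "borel_rep u v" and \<phi>: "\<phi> \<in> Cc_infty half_space"
  shows "integrable lborel (\<lambda>z. v z * \<phi> z)"
proof -
  obtain K where K: "compact K" "K \<subseteq> half_space" "\<And>x. x \<notin> K \<Longrightarrow> \<phi> x = 0"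
    using Cc_infty_support[OF \<phi>] by metis
  obtain B where B: "\<And>x. \<bar>\<phi> x\<bar> \<le> B" using Cc_infty_bounded[OF \<phi>] by blast
  have [measurable]: "v \<in> borel_measurable borel" "\<phi> \<in> borel_measurable borel"
    using r \<phi> by (auto intro: borel_rep_measurable smooth_borel_measurable Cc_infty_smooth)
  show ?thesis
  proof (rule Bochner_Integration.integrable_bound)
    show "integrable lborel (\<lambda>z. B * (indicator K z * v z))"
      by (intro integrable_mult_right borel_rep_integrable_compact[OF r K(1,2)])
    have "\<bar>v z * \<phi> z\<bar> \<le> \<bar>B * (indicator K z * v z)\<bar>" for z
    proof (cases "z \<in> K")
      case True
      have "\<bar>\<phi> z\<bar> \<le> \<bar>B\<bar>" using B[of z] by linarith
      then show ?thesis using True mult_right_mono[of "\<bar>\<phi> z\<bar>" "\<bar>B\<bar>" "\<bar>v z\<bar>"] by (simp add: abs_mult mult.commute)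
    qed (simp add: K)
    then show "AE z in lborel. norm (v z * \<phi> z) \<le> norm (B * (indicator K z * v z))" by simp
  qed measurable
qed

lemma has_weak_deriv_borel:
  assumes w: "has_weak_deriv half_space bs u g" and r: "borel_rep u v" "borel_rep g w"
    and \<phi>: "\<phi> \<in> Cc_infty half_space" and bs: "set bs \<subseteq> Basis"
  shows "(\<integral>z. v z * iter_partial bs \<phi> z \<partial>lborel) = (-1) ^ length bs * (\<integral>z. w z * \<phi> z \<partial>lborel)"
proof -
  have m: "\<phi> \<in> borel_measurable borel" "iter_partial bs \<phi> \<in> borel_measurable borel"
    using \<phi> bs by (auto intro: smooth_borel_measurable Cc_infty_smooth iter_partial_Cc_infty)
  have "(LINT z:half_space|lebesgue. u z * iter_partial bs \<phi> z) =
        (-1) ^ length bs * (LINT z:half_space|lebesgue. g z * \<phi> z)"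
    using w \<phi> unfolding has_weak_deriv_def by blast
  then show ?thesis
    unfolding borel_rep_integral[OF r(1) m(2)] borel_rep_integral[OF r(2) m(1)] .
qed

text \<open>This makes the average at \<open>z\<close> a pairing with an admissible test function,
  so that the identity defining weak derivatives, or the vanishing of pairings, can be applied for
  each \<open>z\<close>.\<close>

lemma translate_Cc_infty:
  fixes \<rho> :: "(real ^ 'n::finite) \<times> real \<Rightarrow> real"
  assumes \<rho>: "\<rho> \<in> Cc_infty UNIV" and r: "0 < r" "\<And>y. \<rho> y \<noteq> 0 \<Longrightarrow> r \<le> snd y" and z: "z \<in> half_space"
  shows "(\<lambda>y. \<rho> (y - z)) \<in> Cc_infty half_space"
proof -
  obtain K where K: "compact K" "\<And>x. x \<notin> K \<Longrightarrow> \<rho> x = 0"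
    using Cc_infty_support[OF \<rho>] by metis
  define K' where "K' = (\<lambda>y. y + z) ` (K \<inter> {y. r \<le> snd y})"
  have "compact K'" unfolding K'_def
    by (intro compact_continuous_image compact_Int_closed K closed_Collect_le continuous_intros)
  moreover have "K' \<subseteq> half_space" using z r(1) by (auto simp: K'_def mem_half_space)
  moreover have "\<rho> (y - z) = 0" if "y \<notin> K'" for y
  proof (rule ccontr)
    assume "\<rho> (y - z) \<noteq> 0"
    then have "y - z \<in> K \<inter> {y. r \<le> snd y}" using K(2) r(2) by blast
    then have "(y - z) + z \<in> K'" unfolding K'_def by blast
    then show False using that by simp
  qed
  moreover have "smooth (\<lambda>y. \<rho> (y - z))"
    using smooth_affine[OF Cc_infty_smooth[OF \<rho>], of 1 "- z"] by simp
  ultimately show ?thesis by (intro Cc_inftyI[of _ K'])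
qed

lemma mollifier_half_space:
  assumes "d > 0"
  shows "\<exists>(\<rho> :: (real ^ 'n::finite) \<times> real \<Rightarrow> real) r. \<rho> \<in> Cc_infty UNIV \<and> 0 < r \<and> (\<forall>y. 0 \<le> \<rho> y) \<and>
    (\<integral>y. \<rho> y \<partial>lborel) = 1 \<and> (\<forall>y. \<rho> y \<noteq> 0 \<longrightarrow> norm y < d \<and> r \<le> snd y)"
proof -
  \<comment> \<open>The ball of radius \<open>r\<close> about height \<open>2 * r\<close> occupies
    heights from \<open>r\<close> to \<open>3 * r\<close>, and its points have norm at most
    \<open>3 * r < d\<close>.\<close>
  define r where "r = d / 4"
  define p :: "(real ^ 'n) \<times> real" where "p = (0, 2 * r)"
  have r: "r > 0" using assms by (simp add: r_def)
  obtain \<rho> where \<rho>: "\<rho> \<in> Cc_infty UNIV" "\<forall>x. \<rho> x \<ge> 0" "\<And>x. x \<notin> cball p r \<Longrightarrow> \<rho> x = 0" "(\<integral>x. \<rho> x \<partial>lborel) = 1"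
    using mollifier_exists[OF r, of p] by blast
  have "norm y < d \<and> r \<le> snd y" if "\<rho> y \<noteq> 0" for y
  proof -
    have y: "norm (y - p) \<le> r" using \<rho>(3)[of y] that by (auto simp: dist_norm norm_minus_commute)
    have "norm p = 2 * r" using r by (simp add: p_def norm_Pair real_sqrt_mult)
    then have "norm y \<le> 3 * r" using y norm_triangle_ineq[of "y - p" p] by simp
    moreover have "\<bar>snd y - 2 * r\<bar> \<le> r"
    proof -
      have "norm (snd (y - p)) \<le> norm (y - p)"
        using norm_snd_le[where x = "fst (y - p)" and y = "snd (y - p)"] unfolding prod.collapse .
      then show ?thesis using y by (simp add: p_def)
    qed
    moreover have "3 * r < d" using assms by (simp add: r_def)
    ultimately show ?thesis by linarith
  qed
  then show ?thesis using \<rho> r by blast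
qed

text \<open>Averages of the difference \<open>v\<close> are pairings with test functions, hence 0;
  after restriction to a compact set they also approximate \<open>v\<close> in L1. Exponent 0 turns
  \<open>weighted_mollify\<close> into the unweighted statement needed here.\<close>

lemma fundamental_lemma:
  fixes g1 g2 :: "(real ^ 'n::finite) \<times> real \<Rightarrow> real"
  assumes r1: "borel_rep g1 w1" and r2: "borel_rep g2 w2"
    and eq: "\<And>\<phi>. \<phi> \<in> Cc_infty half_space \<Longrightarrow> (\<integral>z. w1 z * \<phi> z \<partial>lborel) = (\<integral>z. w2 z * \<phi> z \<partial>lborel)"
  shows "AE z in lborel. z \<in> half_space \<longrightarrow> w1 z = w2 z"
proof -
  define v where "v z = w1 z - w2 z" for z
  have [measurable]: "w1 \<in> borel_measurable borel" "w2 \<in> borel_measurable borel"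
    using r1 r2 by (auto intro: borel_rep_measurable)
  have [measurable]: "v \<in> borel_measurable borel" unfolding v_def by measurable
  have v0: "(\<integral>z. v z * \<phi> z \<partial>lborel) = 0" if \<phi>: "\<phi> \<in> Cc_infty half_space" for \<phi>
  proof -
    have "(\<integral>z. v z * \<phi> z \<partial>lborel) = (\<integral>z. w1 z * \<phi> z - w2 z * \<phi> z \<partial>lborel)"
      by (simp add: v_def left_diff_distrib)
    also have "\<dots> = 0" using eq[OF \<phi>] borel_rep_integrable_Cc[OF r1 \<phi>] borel_rep_integrable_Cc[OF r2 \<phi>] by simp
    finally show ?thesis .
  qed
  \<comment> \<open>The margin 1 in the radius keeps the region seen by a kernel of radius below 1
    inside \<open>exhaustion n\<close>. The lower face takes no margin because the kernel only looks
    upwards.\<close>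
  define A :: "nat \<Rightarrow> ((real ^ 'n) \<times> real) set" where "A n = exhaustion n \<inter> {z. norm z \<le> real n - 1}" for n
  have "AE z in lborel. z \<in> A n \<longrightarrow> v z = 0" for n
  proof -
    define h where "h z = indicator (exhaustion n) z * v z" for z
    have hm [measurable]: "h \<in> borel_measurable borel" unfolding h_def by measurable
    have hi: "integrable lborel h"
      using borel_rep_integrable_compact[OF r1 compact_exhaustion exhaustion_subset, of n]
        borel_rep_integrable_compact[OF r2 compact_exhaustion exhaustion_subset, of n]
      unfolding h_def v_def right_diff_distrib by (rule Bochner_Integration.integrable_diff)
    have "weighted_err 0 h \<le> (\<integral>\<^sup>+z. ennreal (norm (h z)) \<partial>lborel)"
      unfolding weighted_err_def by (intro nn_integral_mono) (auto simp: indicator_def mem_half_space)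
    also have "\<dots> < \<infinity>" using hi by (simp add: integrable_iff_bounded)
    finally have fin: "weighted_err 0 h < \<infinity>" .
    have Am [measurable]: "A n \<in> sets borel" unfolding A_def by measurable
    have small: "(\<integral>\<^sup>+z. indicator (A n) z * ennreal \<bar>v z\<bar> \<partial>lborel) \<le> ennreal e" if e: "e > 0" for e
    proof -
      obtain d where d: "d > 0" "\<And>\<rho>. integrable lborel \<rho> \<and> (\<forall>y. 0 \<le> \<rho> y) \<and> (\<integral>y. \<rho> y \<partial>lborel) = 1 \<and>
          (\<forall>y. \<rho> y \<noteq> 0 \<longrightarrow> norm y < d \<and> 0 \<le> snd y) \<Longrightarrow> weighted_err 0 (\<lambda>z. conv_against h \<rho> z - h z) \<le> e"
        using weighted_mollify[OF hm order_refl fin e] by blast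
      have md: "0 < min d 1" using d(1) by simp
      obtain \<rho> :: "(real ^ 'n) \<times> real \<Rightarrow> real" and r where \<rho>: "\<rho> \<in> Cc_infty UNIV" "0 < r" "\<And>y. 0 \<le> \<rho> y"
        "(\<integral>y. \<rho> y \<partial>lborel) = 1" "\<And>y. \<rho> y \<noteq> 0 \<Longrightarrow> norm y < min d 1 \<and> r \<le> snd y"
        using mollifier_half_space[OF md] by blast
      have "weighted_err 0 (\<lambda>z. conv_against h \<rho> z - h z) \<le> e"
        using \<rho> by (intro d(2)) (auto intro!: Cc_infty_integrable intro: order.trans[OF less_imp_le[OF \<rho>(2)]])
      moreover have "conv_against h \<rho> z = 0 \<and> h z = v z" if z: "z \<in> A n" for z
      proof -
        have zh: "z \<in> half_space" using z exhaustion_subset unfolding A_def by blast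
        have "h y * \<rho> (y - z) = v y * \<rho> (y - z)" for y
        proof (cases "\<rho> (y - z) = 0")
          case False
          then have "norm (y - z) < 1" "snd y \<ge> snd z" using \<rho>(2) \<rho>(5)[of "y - z"] by auto
          then have "y \<in> exhaustion n"
            using z norm_triangle_ineq[of "y - z" z] by (auto simp: A_def exhaustion_def)
          then show ?thesis by (simp add: h_def)
        qed simp
        then have "conv_against h \<rho> z = (\<integral>y. v y * \<rho> (y - z) \<partial>lborel)"
          unfolding conv_against_def by (simp only:)
        also have "\<dots> = 0"
          by (intro v0 translate_Cc_infty[OF \<rho>(1,2) _ zh]) (use \<rho>(5) in blast)
        finally show ?thesis using z by (simp add: h_def A_def)
      qed
      then have "(\<integral>\<^sup>+z. indicator (A n) z * ennreal \<bar>v z\<bar> \<partial>lborel) \<le> weighted_err 0 (\<lambda>z. conv_against h \<rho> z - h z)"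
        unfolding weighted_err_def
      proof (intro nn_integral_mono)
        fix z :: "(real ^ 'n) \<times> real"
        assume *: "\<And>z. z \<in> A n \<Longrightarrow> conv_against h \<rho> z = 0 \<and> h z = v z"
        show "indicator (A n) z * ennreal \<bar>v z\<bar> \<le> indicator half_space z * ennreal (snd z powr 0 * \<bar>conv_against h \<rho> z - h z\<bar>)"
        proof (cases "z \<in> A n")
          case True
          then have "z \<in> half_space" using exhaustion_subset unfolding A_def by blast
          then show ?thesis using *[OF True] True by (simp add: mem_half_space)
        qed simp
      qed
      ultimately show ?thesis by (rule order_trans[rotated])
    qed
    have "(\<integral>\<^sup>+z. indicator (A n) z * ennreal \<bar>v z\<bar> \<partial>lborel) = 0"
    proof -
      have "(\<integral>\<^sup>+z. indicator (A n) z * ennreal \<bar>v z\<bar> \<partial>lborel) \<le> 0"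
        by (rule ennreal_le_epsilon) (use small in simp)
      then show ?thesis by simp
    qed
    then have "AE z in lborel. indicator (A n) z * ennreal \<bar>v z\<bar> = 0"
      by (subst (asm) nn_integral_0_iff_AE) auto
    then show ?thesis by eventually_elim (auto simp: indicator_def split: if_splits)
  qed
  then have "AE z in lborel. \<forall>n. z \<in> A n \<longrightarrow> v z = 0"
    unfolding AE_all_countable by blast
  then show ?thesis
  proof eventually_elim
    case (elim z)
    show ?case
    proof
      assume "z \<in> half_space"
      moreover have "\<forall>\<^sub>F n in sequentially. norm z \<le> real n - 1"
        using eventually_ge_at_top[of "nat \<lceil>norm z + 1\<rceil>"] by eventually_elim linarith
      ultimately have "\<forall>\<^sub>F n in sequentially. z \<in> A n"
        using eventually_exhaustion[of z] unfolding A_def by (auto elim: eventually_elim2)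
      then obtain n where "z \<in> A n" by (auto simp: eventually_sequentially)
      then show "w1 z = w2 z" using elim by (auto simp: v_def)
    qed
  qed
qed

section \<open>Weak derivatives after subtraction of a test function\<close>

lemma smooth_L1_loc:
  assumes f: "smooth f"
  shows "f \<in> L1_loc \<Omega>"
proof -
  have "set_integrable lebesgue K f" if K: "compact K" for K
  proof -
    have "integrable lborel (\<lambda>x. indicator K x *\<^sub>R f x)"
      by (rule borel_integrable_compact[OF K]) (use f smooth_continuous continuous_on_subset in blast)
    moreover have "(\<lambda>x. indicator K x *\<^sub>R f x) \<in> borel_measurable borel"
      using borel_measurable_integrable[OF calculation] by simp
    ultimately show ?thesis unfolding set_integrable_def by (subst integrable_completion) auto
  qed
  then show ?thesis by (simp add: L1_loc_def)
qed

lemma L1_loc_diff: "u \<in> L1_loc \<Omega> \<Longrightarrow> v \<in> L1_loc \<Omega> \<Longrightarrow> (\<lambda>z. u z - v z) \<in> L1_loc \<Omega>"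
  unfolding L1_loc_def set_integrable_def by (auto simp: algebra_simps)

lemma borel_rep_diff_smooth:
  assumes r: "borel_rep u v" and f: "smooth f"
  shows "borel_rep (\<lambda>z. u z - f z) (\<lambda>z. v z - indicator half_space z * f z)"
proof -
  have [measurable]: "v \<in> borel_measurable borel" "f \<in> borel_measurable borel"
    using r f by (auto intro: borel_rep_measurable smooth_borel_measurable)
  have "AE z in lborel. indicator half_space z * u z = v z" using r by (simp add: borel_rep_def)
  then have "AE z in lborel. indicator half_space z * (u z - f z) = v z - indicator half_space z * f z"
    by eventually_elim (simp add: right_diff_distrib)
  then show ?thesis
    using r unfolding borel_rep_def by (auto intro: L1_loc_diff smooth_L1_loc f)
qed

text \<open>\<open>weak_deriv\<close> is an arbitrary choice, so its value for
  \<open>u - \<phi>\<close> has to be identified. Integration by parts shows that the difference of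
  the derivatives is a weak derivative, hence the choice is one too, and
  \<open>fundamental_lemma\<close> makes the two agree almost everywhere.\<close>

lemma weak_deriv_diff_Cc:
  fixes u :: "(real ^ 'n::finite) \<times> real \<Rightarrow> real"
  assumes w: "has_weak_deriv half_space bs u g" and bs: "set bs \<subseteq> Basis" and \<phi>: "\<phi> \<in> Cc_infty half_space"
    and rg: "borel_rep g w"
  shows "AE z in lborel. z \<in> half_space \<longrightarrow>
    weak_deriv half_space bs (\<lambda>z. u z - \<phi> z) z = w z - iter_partial bs \<phi> z"
proof -
  have p\<phi>: "iter_partial bs \<phi> \<in> Cc_infty half_space" using \<phi> bs by (rule iter_partial_Cc_infty)
  have u: "u \<in> L1_loc half_space" and g: "g \<in> L1_loc half_space" using w by (auto simp: has_weak_deriv_def)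
  obtain v where v: "borel_rep u v" using borel_rep_exists[OF u] by blast
  have sm: "smooth \<phi>" "smooth (iter_partial bs \<phi>)" using \<phi> p\<phi> by (auto intro: Cc_infty_smooth)
  define w' where "w' z = w z - indicator half_space z * iter_partial bs \<phi> z" for z
  define v' where "v' z = v z - indicator half_space z * \<phi> z" for z
  have rv': "borel_rep (\<lambda>z. u z - \<phi> z) v'" unfolding v'_def by (rule borel_rep_diff_smooth[OF v sm(1)])
  have rw': "borel_rep (\<lambda>z. g z - iter_partial bs \<phi> z) w'" unfolding w'_def by (rule borel_rep_diff_smooth[OF rg sm(2)])
  have ind: "indicator half_space z * f z = f z" if f: "f \<in> Cc_infty half_space" for f z
  proof (cases "z \<in> half_space")
    case False
    then have "f z = 0" using Cc_infty_support[OF f] by blast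
    then show ?thesis by simp
  qed simp
  have eq: "(\<integral>z. v' z * iter_partial bs \<psi> z \<partial>lborel) = (-1) ^ length bs * (\<integral>z. w' z * \<psi> z \<partial>lborel)"
    if \<psi>: "\<psi> \<in> Cc_infty half_space" for \<psi>
  proof -
    have p\<psi>: "iter_partial bs \<psi> \<in> Cc_infty half_space" using \<psi> bs by (rule iter_partial_Cc_infty)
    have "(\<integral>z. v' z * iter_partial bs \<psi> z \<partial>lborel) = (\<integral>z. v z * iter_partial bs \<psi> z - \<phi> z * iter_partial bs \<psi> z \<partial>lborel)"
      unfolding v'_def ind[OF \<phi>] by (simp add: left_diff_distrib)
    also have "\<dots> = (\<integral>z. v z * iter_partial bs \<psi> z \<partial>lborel) - (\<integral>z. \<phi> z * iter_partial bs \<psi> z \<partial>lborel)"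
      by (intro Bochner_Integration.integral_diff borel_rep_integrable_Cc[OF v p\<psi>]
        Cc_infty_integrable[where \<Omega> = half_space] Cc_infty_mult sm p\<psi>)
    also have "\<dots> = (-1) ^ length bs * ((\<integral>z. w z * \<psi> z \<partial>lborel) - (\<integral>z. iter_partial bs \<phi> z * \<psi> z \<partial>lborel))"
      unfolding has_weak_deriv_borel[OF w v rg \<psi> bs] integration_by_parts[OF Cc_infty_UNIV[OF \<psi>] sm(1) bs]
      by (simp add: right_diff_distrib)
    also have "(\<integral>z. w z * \<psi> z \<partial>lborel) - (\<integral>z. iter_partial bs \<phi> z * \<psi> z \<partial>lborel)
        = (\<integral>z. w z * \<psi> z - iter_partial bs \<phi> z * \<psi> z \<partial>lborel)"
      by (intro Bochner_Integration.integral_diff[symmetric] borel_rep_integrable_Cc[OF rg \<psi>]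
        Cc_infty_integrable[where \<Omega> = half_space] Cc_infty_mult sm \<psi>)
    also have "\<dots> = (\<integral>z. w' z * \<psi> z \<partial>lborel)"
      unfolding w'_def ind[OF p\<phi>] by (simp add: left_diff_distrib)
    finally show ?thesis .
  qed
  have "has_weak_deriv half_space bs (\<lambda>z. u z - \<phi> z) (\<lambda>z. g z - iter_partial bs \<phi> z)"
    unfolding has_weak_deriv_def
  proof (intro conjI ballI)
    show "(\<lambda>z. u z - \<phi> z) \<in> L1_loc half_space" "(\<lambda>z. g z - iter_partial bs \<phi> z) \<in> L1_loc half_space"
      using rv' rw' by (auto simp: borel_rep_def)
    fix \<psi> :: "(real ^ 'n) \<times> real \<Rightarrow> real" assume \<psi>: "\<psi> \<in> Cc_infty half_space"
    have m: "\<psi> \<in> borel_measurable borel" "iter_partial bs \<psi> \<in> borel_measurable borel"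
      using \<psi> bs by (auto intro: smooth_borel_measurable Cc_infty_smooth iter_partial_Cc_infty)
    show "(LINT z:half_space|lebesgue. (u z - \<phi> z) * iter_partial bs \<psi> z) =
        (-1) ^ length bs * (LINT z:half_space|lebesgue. (g z - iter_partial bs \<phi> z) * \<psi> z)"
      unfolding borel_rep_integral[OF rv' m(2)] borel_rep_integral[OF rw' m(1)] by (rule eq[OF \<psi>])
  qed
  then have wd: "has_weak_deriv half_space bs (\<lambda>z. u z - \<phi> z) (weak_deriv half_space bs (\<lambda>z. u z - \<phi> z))"
    unfolding weak_deriv_def by (rule someI[of "has_weak_deriv half_space bs (\<lambda>z. u z - \<phi> z)"])
  then obtain W where W: "borel_rep (weak_deriv half_space bs (\<lambda>z. u z - \<phi> z)) W"
    using borel_rep_exists unfolding has_weak_deriv_def by blast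
  have "AE z in lborel. z \<in> half_space \<longrightarrow> W z = w' z"
  proof (rule fundamental_lemma[OF W rw'])
    fix \<psi> :: "(real ^ 'n) \<times> real \<Rightarrow> real" assume \<psi>: "\<psi> \<in> Cc_infty half_space"
    have "(-1) ^ length bs * (\<integral>z. W z * \<psi> z \<partial>lborel) = (-1) ^ length bs * (\<integral>z. w' z * \<psi> z \<partial>lborel)"
      using has_weak_deriv_borel[OF wd rv' W \<psi> bs] eq[OF \<psi>] by simp
    then show "(\<integral>z. W z * \<psi> z \<partial>lborel) = (\<integral>z. w' z * \<psi> z \<partial>lborel)" by simp
  qed
  then show ?thesis
    using borel_rep_AE[OF W] by eventually_elim (auto simp: w'_def)
qed

text \<open>Differentiating the average and moving the derivative off the translated kernel each
  cost (-1)^n, and the signs cancel. Truncation at height \<open>r\<close> gives a function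
  integrable on the whole space; at points \<open>z\<close> of the half space the kernel does not
  see the part that was removed.\<close>

lemma mollified_weak_deriv:
  fixes u :: "(real ^ 'n::finite) \<times> real \<Rightarrow> real"
  assumes w: "has_weak_deriv half_space bs u g" and bs: "set bs \<subseteq> Basis"
    and r: "borel_rep u v" "borel_rep g w"
    and \<rho>: "\<rho> \<in> Cc_infty UNIV" and r0: "0 < r" "\<And>y. \<rho> y \<noteq> 0 \<Longrightarrow> r \<le> snd y"
    and U: "integrable lborel (\<lambda>z. indicator {z. r \<le> snd z} z * v z)" and z: "z \<in> half_space"
  shows "iter_partial bs (conv_against (\<lambda>z. indicator {z. r \<le> snd z} z * v z) \<rho>) z = conv_against w \<rho> z"
proof -
  have tr: "(\<lambda>y. \<rho> (y - z)) \<in> Cc_infty half_space" by (rule translate_Cc_infty[OF \<rho> r0 z])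
  have p: "iter_partial bs (\<lambda>y. \<rho> (y - z)) = (\<lambda>y. iter_partial bs \<rho> (y - z))"
    using iter_partial_affine[OF Cc_infty_smooth[OF \<rho>] bs, of 1 "- z"] by simp
  have cl: "closed {y :: (real ^ 'n) \<times> real. r \<le> snd y}" by (intro closed_Collect_le continuous_intros)
  have "indicator {z. r \<le> snd z} y * v y * iter_partial bs \<rho> (y - z) = v y * iter_partial bs \<rho> (y - z)" for y
  proof (cases "r \<le> snd y")
    case False
    then have "y - z \<notin> {y. r \<le> snd y}" using z by (simp add: mem_half_space)
    then have "iter_partial bs \<rho> (y - z) = 0" using r0(2) by (intro iter_partial_eq_0[OF cl]) auto
    then show ?thesis by simp
  qed simp
  then have "conv_against (\<lambda>z. indicator {z. r \<le> snd z} z * v z) (iter_partial bs \<rho>) z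
      = (\<integral>y. v y * iter_partial bs (\<lambda>y. \<rho> (y - z)) y \<partial>lborel)"
    unfolding conv_against_def p by (simp only:)
  also have "\<dots> = (-1) ^ length bs * conv_against w \<rho> z"
    unfolding has_weak_deriv_borel[OF w r tr bs] conv_against_def ..
  finally show ?thesis
    unfolding conv_iter_partial[OF U \<rho> bs] by (simp flip: power_mult_distrib)
qed

text \<open>Where t \<ge> r the weight is at least r^a, so the weighted norm controls the plain L1
  norm there.\<close>

lemma integrable_away_from_boundary:
  fixes v :: "(real ^ 'n::finite) \<times> real \<Rightarrow> real"
  assumes [measurable]: "v \<in> borel_measurable borel" and fin: "weighted_err a v < \<infinity>" and a: "a \<ge> 0" and r: "r > 0"
  shows "integrable lborel (\<lambda>z. indicator {z. r \<le> snd z} z * v z)"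
proof (rule integrableI_bounded)
  have "(\<integral>\<^sup>+z. ennreal (norm (indicator {z. r \<le> snd z} z * v z)) \<partial>lborel)
    \<le> (\<integral>\<^sup>+z. ennreal (1 / r powr a) * (indicator half_space z * ennreal (snd z powr a * \<bar>v z\<bar>)) \<partial>lborel)"
  proof (rule nn_integral_mono)
    fix z :: "(real ^ 'n) \<times> real"
    show "ennreal (norm (indicator {z. r \<le> snd z} z * v z))
      \<le> ennreal (1 / r powr a) * (indicator half_space z * ennreal (snd z powr a * \<bar>v z\<bar>))"
    proof (cases "r \<le> snd z")
      case True
      then have z: "z \<in> half_space" using r by (simp add: mem_half_space)
      have "r powr a \<le> snd z powr a" using True a r by (intro powr_mono2) auto
      then have "r powr a * \<bar>v z\<bar> \<le> snd z powr a * \<bar>v z\<bar>" by (intro mult_right_mono) auto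
      then have "\<bar>v z\<bar> \<le> 1 / r powr a * (snd z powr a * \<bar>v z\<bar>)" using r by (simp add: field_simps)
      then have "ennreal \<bar>v z\<bar> \<le> ennreal (1 / r powr a * (snd z powr a * \<bar>v z\<bar>))" by (rule ennreal_leI)
      also have "\<dots> = ennreal (1 / r powr a) * ennreal (snd z powr a * \<bar>v z\<bar>)" by (rule ennreal_mult') simp
      finally show ?thesis using True z by simp
    qed simp
  qed
  also have "\<dots> = ennreal (1 / r powr a) * weighted_err a v"
    unfolding weighted_err_def by (rule nn_integral_cmult) measurable
  also have "\<dots> < \<infinity>" using fin by (simp add: ennreal_mult_less_top)
  finally show "(\<integral>\<^sup>+z. ennreal (norm (indicator {z. r \<le> snd z} z * v z)) \<partial>lborel) < \<infinity>" .
qed measurable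

section \<open>Cutoffs\<close>

lemma abs_sum_list_le:
  fixes F :: "'b \<Rightarrow> real"
  assumes "\<And>x. x \<in> set xs \<Longrightarrow> \<bar>F x\<bar> \<le> B"
  shows "\<bar>\<Sum>x\<leftarrow>xs. F x\<bar> \<le> real (length xs) * B"
  using assms
proof (induction xs)
  case (Cons x xs)
  have "\<bar>F x + (\<Sum>x\<leftarrow>xs. F x)\<bar> \<le> B + real (length xs) * B"
    using Cons by (intro order_trans[OF abs_triangle_ineq] add_mono) auto
  then show ?case by (simp add: algebra_simps)
qed simp

text \<open>Shared by both cutoffs. The factor is eventually 1 on a neighbourhood of each point, so
  the derivatives of the product eventually agree with those of \<open>w\<close> there.
  \<open>D\<close> dominates each term of the product rule, and \<open>L\<close>, the number of
  terms, turns it into a bound for the sum.\<close>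

lemma cutoff_converges:
  fixes f :: "nat \<Rightarrow> (real ^ 'n::finite) \<times> real \<Rightarrow> real"
  assumes f: "\<And>k. smooth (f k)" and w: "smooth w" and bs: "set bs \<subseteq> Basis"
    and ev: "\<And>z. z \<in> half_space \<Longrightarrow> \<exists>A. open A \<and> z \<in> A \<and> (\<forall>\<^sub>F k in sequentially. \<forall>y\<in>A. f k y = 1)"
    and D [measurable]: "D \<in> borel_measurable borel"
    and D_fin: "(\<integral>\<^sup>+z. indicator half_space z * ennreal (D z) \<partial>lborel) < \<infinity>"
    and bound: "\<And>k p q z. (p, q) \<in> set (splits bs) \<Longrightarrow> z \<in> half_space \<Longrightarrow>
      snd z powr a * \<bar>iter_partial p (f k) z * iter_partial q w z\<bar> \<le> D z"
  shows "(\<lambda>k. weighted_err a (\<lambda>z. iter_partial bs (\<lambda>z. f k z * w z) z - iter_partial bs w z)) \<longlonglongrightarrow> 0"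
proof -
  define L where "L = real (length (splits bs))"
  define g where "g k z = indicator half_space z * (snd z powr a * iter_partial bs (\<lambda>z. f k z * w z) z)" for k z
  define g' where "g' z = indicator half_space z * (snd z powr a * iter_partial bs w z)" for z
  have [measurable]: "iter_partial bs (\<lambda>z. f k z * w z) \<in> borel_measurable borel" for k
    by (intro smooth_borel_measurable smooth_iter_partial smooth_mult f w bs)
  have [measurable]: "iter_partial bs w \<in> borel_measurable borel"
    by (intro smooth_borel_measurable smooth_iter_partial w bs)
  have "(\<lambda>k. \<integral>\<^sup>+z. ennreal (norm (g' z - g k z)) \<partial>lborel) \<longlonglongrightarrow> 0"
  proof (rule nn_integral_dominated_convergence_norm[where w = "\<lambda>z. indicator half_space z * (L * D z)"])
    show "g k \<in> borel_measurable lborel" for k unfolding g_def by measurable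
    show "g' \<in> borel_measurable lborel" unfolding g'_def by measurable
    show "AE z in lborel. norm (g k z) \<le> indicator half_space z * (L * D z)" for k
    proof (rule AE_I2)
      fix z :: "(real ^ 'n) \<times> real"
      show "norm (g k z) \<le> indicator half_space z * (L * D z)"
      proof (cases "z \<in> half_space")
        case True
        have "\<bar>\<Sum>(p, q)\<leftarrow>splits bs. snd z powr a * (iter_partial p (f k) z * iter_partial q w z)\<bar> \<le> L * D z"
          unfolding L_def
        proof (rule abs_sum_list_le)
          fix s assume s: "s \<in> set (splits bs)"
          obtain p q where pq: "s = (p, q)" by (rule prod.exhaust)
          show "\<bar>case s of (p, q) \<Rightarrow> snd z powr a * (iter_partial p (f k) z * iter_partial q w z)\<bar> \<le> D z"
            using bound[of p q z k] s True unfolding pq by (simp add: abs_mult)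
        qed
        also have "(\<Sum>(p, q)\<leftarrow>splits bs. snd z powr a * (iter_partial p (f k) z * iter_partial q w z))
            = snd z powr a * iter_partial bs (\<lambda>z. f k z * w z) z"
          unfolding Leibniz[OF f w bs] by (simp add: sum_list_const_mult case_prod_unfold)
        finally show ?thesis using True by (simp add: g_def)
      qed (simp add: g_def)
    qed
    have "(\<integral>\<^sup>+z. ennreal (indicator half_space z * (L * D z)) \<partial>lborel)
        = (\<integral>\<^sup>+z. ennreal L * (indicator half_space z * ennreal (D z)) \<partial>lborel)"
      by (intro nn_integral_cong) (auto simp: indicator_def L_def ennreal_mult')
    also have "\<dots> = ennreal L * (\<integral>\<^sup>+z. indicator half_space z * ennreal (D z) \<partial>lborel)"
      by (rule nn_integral_cmult) measurable
    also have "\<dots> < \<infinity>" using D_fin by (simp add: ennreal_mult_less_top)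
    finally show "(\<integral>\<^sup>+z. ennreal (indicator half_space z * (L * D z)) \<partial>lborel) < \<infinity>" .
    show "AE z in lborel. (\<lambda>k. g k z) \<longlonglongrightarrow> g' z"
    proof (rule AE_I2)
      fix z :: "(real ^ 'n) \<times> real"
      show "(\<lambda>k. g k z) \<longlonglongrightarrow> g' z"
      proof (cases "z \<in> half_space")
        case True
        then obtain A where A: "open A" "z \<in> A" "\<forall>\<^sub>F k in sequentially. \<forall>y\<in>A. f k y = 1" using ev by blast
        have "\<forall>\<^sub>F k in sequentially. g k z = g' z"
          using A(3)
        proof eventually_elim
          case (elim k)
          have "iter_partial bs (\<lambda>z. f k z * w z) z = iter_partial bs w z"
            by (rule iter_partial_cong_open[OF A(1) _ A(2)]) (use elim in simp)
          then show ?case by (simp add: g_def g'_def)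
        qed
        then show ?thesis by (rule tendsto_eventually)
      qed (simp add: g_def g'_def)
    qed
  qed measurable
  also have "(\<lambda>k. \<integral>\<^sup>+z. ennreal (norm (g' z - g k z)) \<partial>lborel)
      = (\<lambda>k. weighted_err a (\<lambda>z. iter_partial bs (\<lambda>z. f k z * w z) z - iter_partial bs w z))"
    unfolding weighted_err_def g_def g'_def
    by (intro ext nn_integral_cong)
      (auto simp: indicator_def abs_minus_commute abs_mult simp flip: right_diff_distrib)
  finally show ?thesis .
qed

section \<open>Cutoff at infinity\<close>

definition plateau :: "'a::euclidean_space \<Rightarrow> real" where
  "plateau z = smooth_step (2 - z \<bullet> z)"

text \<open>The argument 2 - \<bar>z\<bar>^2 is at least 1 on the unit ball and nonpositive once
  \<bar>z\<bar>^2 \<ge> 2. The squared norm is used because it is smooth at the origin.\<close>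

lemma plateau_Cc_infty: "plateau \<in> Cc_infty UNIV"
proof (rule Cc_inftyI[of _ "cball 0 2"])
  show "smooth plateau"
    unfolding plateau_def[abs_def] by (intro smooth_compose[OF smooth_smooth_step] smooth_diff smooth_const smooth_inner_self)
  fix z :: 'a assume "z \<notin> cball 0 2"
  then have "2\<^sup>2 \<le> (norm z)\<^sup>2" by (intro power_mono) auto
  then show "plateau z = 0" by (simp add: plateau_def power2_norm_eq_inner smooth_step_eq_0)
qed auto

lemma plateau_eq_1: "norm z \<le> 1 \<Longrightarrow> plateau z = 1"
proof -
  assume "norm z \<le> 1"
  then have "(norm z)\<^sup>2 \<le> 1\<^sup>2" by (intro power_mono) auto
  then show ?thesis by (simp add: plateau_def power2_norm_eq_inner smooth_step_eq_1)
qed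

lemma finite_lists_Basis: "finite {p. set p \<subseteq> (Basis :: 'a::euclidean_space set) \<and> length p \<le> n}"
  by (rule finite_lists_length_le) simp

text \<open>Stretching the plateau only shrinks its derivatives, so one constant \<open>C\<close>
  bounds them for all \<open>k\<close>; weighted integrability of the derivatives of
  \<open>w\<close> up to the same order supplies the dominating function.\<close>

lemma cutoff_at_infinity:
  fixes w :: "(real ^ 'n::finite) \<times> real \<Rightarrow> real"
  assumes w: "smooth w" and bs: "set bs \<subseteq> Basis"
    and fin: "\<And>q. set q \<subseteq> Basis \<Longrightarrow> length q \<le> length bs \<Longrightarrow> weighted_err a (iter_partial q w) < \<infinity>"
  shows "(\<lambda>k. weighted_err a (\<lambda>z. iter_partial bs (\<lambda>z. plateau ((1 / real (Suc k)) *\<^sub>R z) * w z) z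
    - iter_partial bs w z)) \<longlonglongrightarrow> 0"
proof -
  define S :: "((real ^ 'n) \<times> real) list set" where "S = {p. set p \<subseteq> Basis \<and> length p \<le> length bs}"
  have S: "finite S" unfolding S_def by (rule finite_lists_Basis)
  have mem: "p \<in> S \<and> q \<in> S" if "(p, q) \<in> set (splits bs)" for p q
    using splits_props[OF that] bs by (auto simp: S_def)
  have sp: "smooth (plateau :: (real ^ 'n) \<times> real \<Rightarrow> real)" using plateau_Cc_infty by (rule Cc_infty_smooth)
  have "\<exists>B\<ge>0. \<forall>x. \<bar>iter_partial p plateau x\<bar> \<le> B" if p: "p \<in> S" for p :: "((real ^ 'n) \<times> real) list"
  proof -
    have "set p \<subseteq> Basis" using p by (simp add: S_def)
    from Cc_infty_bounded[OF iter_partial_Cc_infty[OF plateau_Cc_infty this]] show ?thesis by blast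
  qed
  then obtain B where B: "\<And>p. p \<in> S \<Longrightarrow> 0 \<le> B p \<and> (\<forall>x. \<bar>iter_partial p plateau x\<bar> \<le> B p)" by metis
  define C where "C = (\<Sum>p\<in>S. B p)"
  have C0: "0 \<le> C" unfolding C_def using B by (intro sum_nonneg) blast
  have C: "\<bar>iter_partial p plateau x\<bar> \<le> C" if "p \<in> S" for p x
  proof -
    have "B p \<le> C" unfolding C_def using B by (intro member_le_sum[OF that _ S]) blast
    then show ?thesis using B[OF that] order_trans by blast
  qed
  have fb: "\<bar>iter_partial p (\<lambda>z. plateau ((1 / real (Suc k)) *\<^sub>R z)) z\<bar> \<le> C" if p: "p \<in> S" for p k z
  proof -
    have "iter_partial p (\<lambda>z. plateau ((1 / real (Suc k)) *\<^sub>R z)) z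
        = (1 / real (Suc k)) ^ length p * iter_partial p plateau ((1 / real (Suc k)) *\<^sub>R z)"
      using iter_partial_affine[OF sp, of p "1 / real (Suc k)" 0] p by (simp add: S_def)
    also have "\<bar>\<dots>\<bar> \<le> 1 * C"
      unfolding abs_mult using C[OF p] by (intro mult_mono) (auto intro!: power_le_one simp: power_abs)
    finally show ?thesis by simp
  qed
  have pw [measurable]: "iter_partial q w \<in> borel_measurable borel" if "q \<in> S" for q
    using that unfolding S_def by (intro smooth_borel_measurable smooth_iter_partial w) auto
  define D where "D z = (\<Sum>q\<in>S. C * (snd z powr a * \<bar>iter_partial q w z\<bar>))" for z
  show ?thesis
  proof (rule cutoff_converges[where D = D])
    show "smooth (\<lambda>z :: (real ^ 'n) \<times> real. plateau ((1 / real (Suc k)) *\<^sub>R z))" for k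
      using smooth_affine[OF sp, of "1 / real (Suc k)" 0] by simp
    show "\<exists>A. open A \<and> z \<in> A \<and> (\<forall>\<^sub>F k in sequentially. \<forall>y\<in>A. plateau ((1 / real (Suc k)) *\<^sub>R y) = (1::real))"
      for z :: "(real ^ 'n) \<times> real"
    proof (intro exI[of _ "ball 0 (norm z + 1)"] conjI)
      show "\<forall>\<^sub>F k in sequentially. \<forall>y\<in>ball (0 :: (real ^ 'n) \<times> real) (norm z + 1). plateau ((1 / real (Suc k)) *\<^sub>R y) = (1::real)"
        using eventually_ge_at_top[of "nat \<lceil>norm z\<rceil>"]
      proof eventually_elim
        case (elim k)
        show ?case
        proof
          fix y :: "(real ^ 'n) \<times> real" assume "y \<in> ball 0 (norm z + 1)"
          then have "norm y \<le> real (Suc k)" using elim by (simp add: dist_norm)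
          then show "plateau ((1 / real (Suc k)) *\<^sub>R y) = (1::real)"
            by (intro plateau_eq_1) (simp add: divide_le_eq)
        qed
      qed
    qed auto
    show "D \<in> borel_measurable borel" unfolding D_def by measurable
    have "(\<integral>\<^sup>+z. indicator half_space z * ennreal (D z) \<partial>lborel)
        = (\<integral>\<^sup>+z. (\<Sum>q\<in>S. ennreal C * (indicator half_space z * ennreal (snd z powr a * \<bar>iter_partial q w z\<bar>))) \<partial>lborel)"
    proof (rule nn_integral_cong)
      fix z :: "(real ^ 'n) \<times> real"
      have "ennreal (D z) = (\<Sum>q\<in>S. ennreal (C * (snd z powr a * \<bar>iter_partial q w z\<bar>)))"
        unfolding D_def using C0 by (intro sum_ennreal[symmetric]) simp
      also have "\<dots> = (\<Sum>q\<in>S. ennreal C * ennreal (snd z powr a * \<bar>iter_partial q w z\<bar>))"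
        by (intro sum.cong refl ennreal_mult' C0)
      finally have "ennreal (D z) = (\<Sum>q\<in>S. ennreal C * ennreal (snd z powr a * \<bar>iter_partial q w z\<bar>))" .
      then show "indicator half_space z * ennreal (D z)
        = (\<Sum>q\<in>S. ennreal C * (indicator half_space z * ennreal (snd z powr a * \<bar>iter_partial q w z\<bar>)))"
        by (simp add: sum_distrib_left mult_ac)
    qed
    also have "\<dots> = (\<Sum>q\<in>S. ennreal C * weighted_err a (iter_partial q w))"
      unfolding weighted_err_def by (subst nn_integral_sum) (auto intro!: sum.cong nn_integral_cmult)
    also have "\<dots> < \<infinity>"
      using S fin by (auto simp: S_def ennreal_mult_less_top)
    finally show "(\<integral>\<^sup>+z. indicator half_space z * ennreal (D z) \<partial>lborel) < \<infinity>" .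
    fix k p q and z :: "(real ^ 'n) \<times> real" assume pq: "(p, q) \<in> set (splits bs)"
    have "snd z powr a * \<bar>iter_partial p (\<lambda>z. plateau ((1 / real (Suc k)) *\<^sub>R z)) z * iter_partial q w z\<bar>
        \<le> C * (snd z powr a * \<bar>iter_partial q w z\<bar>)"
      using mult_right_mono[OF fb[of p k z], of "snd z powr a * \<bar>iter_partial q w z\<bar>"] mem[OF pq]
      by (simp add: abs_mult mult_ac)
    also have "\<dots> \<le> D z"
      unfolding D_def using mem[OF pq] C0
      by (intro member_le_sum[OF _ _ S, of q "\<lambda>q. C * (snd z powr a * \<bar>iter_partial q w z\<bar>)"]) auto
    finally show "snd z powr a * \<bar>iter_partial p (\<lambda>z. plateau ((1 / real (Suc k)) *\<^sub>R z)) z * iter_partial q w z\<bar> \<le> D z" .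
  qed (rule w bs)+
qed

section \<open>Cutoff at the boundary\<close>

lemma iter_partial_ridge:
  fixes F :: "real \<Rightarrow> real" and e :: "'a::euclidean_space"
  assumes F: "smooth F"
  shows "iter_partial p (\<lambda>z. F (z \<bullet> e)) = (\<lambda>z. prod_list (map (\<lambda>b. b \<bullet> e) p) * iter_partial (replicate (length p) 1) F (z \<bullet> e))"
proof (induction p)
  case (Cons b p)
  define G where "G = iter_partial (replicate (length p) 1) F"
  have G: "smooth G" unfolding G_def by (intro smooth_iter_partial F) auto
  define c where "c = prod_list (map (\<lambda>b. b \<bullet> e) p)"
  have "((\<lambda>z. c * G (z \<bullet> e)) has_derivative (\<lambda>h. c * frechet_derivative G (at (z \<bullet> e)) (h \<bullet> e))) (at z)" for z
    by (intro has_derivative_mult_right has_derivative_compose[where f = "\<lambda>z. z \<bullet> e" and g = G, OF _ smooth_has_derivative[OF G]])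
      (auto intro!: derivative_eq_intros)
  moreover have "frechet_derivative G (at t) s = s * frechet_derivative G (at t) 1" for t s
    using linear_scale[OF has_derivative_linear[OF smooth_has_derivative[OF G]], of t s 1] by simp
  ultimately have "frechet_derivative (\<lambda>z. c * G (z \<bullet> e)) (at z) b = (b \<bullet> e) * c * frechet_derivative G (at (z \<bullet> e)) 1" for z
    using frechet_derivative_eq by (metis mult.commute mult.left_commute)
  then show ?case unfolding iter_partial.simps Cons.IH by (simp add: c_def G_def)
qed simp

lemma smooth_step_derivative_const:
  assumes "t < 0 \<or> 1 < t" "bs \<noteq> []"
  shows "iter_partial bs smooth_step t = 0"
proof -
  have "iter_partial bs smooth_step t = iter_partial bs (\<lambda>_. if t < 0 then 0 else 1) t"
    by (rule iter_partial_cong_open[of "if t < 0 then {..<0} else {1<..}"])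
      (use assms in \<open>auto simp: smooth_step_eq_0 smooth_step_eq_1\<close>)
  then show ?thesis using assms(2) by (simp add: iter_partial_const)
qed

lemma smooth_step_derivative_bounded:
  assumes "set bs \<subseteq> Basis"
  shows "\<exists>B\<ge>0. \<forall>t. \<bar>iter_partial bs smooth_step t\<bar> \<le> B"
proof -
  have "compact (iter_partial bs smooth_step ` {0..1})"
    using smooth_continuous[OF smooth_iter_partial[OF smooth_smooth_step assms]]
    by (intro compact_continuous_image) (auto intro: continuous_on_subset)
  then have "bounded (iter_partial bs smooth_step ` {0..1})" by (rule compact_imp_bounded)
  then obtain B where "\<forall>y\<in>iter_partial bs smooth_step ` {0..1}. norm y \<le> B"
    unfolding bounded_iff by blast
  then have B: "\<bar>iter_partial bs smooth_step t\<bar> \<le> B" if "t \<in> {0..1}" for t using that by simp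
  \<comment> \<open>Outside [0, 1] all derivatives of positive order vanish; the 1 accounts for
    order zero, where the step itself takes the value 1.\<close>
  have "\<bar>iter_partial bs smooth_step t\<bar> \<le> max B 1" for t
  proof (cases "t \<in> {0..1}")
    case True
    then show ?thesis using B by fastforce
  next
    case False
    then show ?thesis
      using smooth_step_derivative_const[of t bs] smooth_step_eq_0[of t] smooth_step_eq_1[of t]
      by (cases "bs = []") (auto simp: not_le)
  qed
  then show ?thesis by (intro exI[of _ "max B 1"]) auto
qed

text \<open>The shift by -1 makes the cutoff vanish on the whole strip t \<le> 1 / (k + 1), so its
  product with a compactly supported function has compact support in the open half space. From t = 2
  / (k + 1) on it equals 1.\<close>

definition bdry_cutoff :: "nat \<Rightarrow> (real ^ 'n::finite) \<times> real \<Rightarrow> real" where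
  "bdry_cutoff k z = smooth_step (real (Suc k) * snd z - 1)"

lemma snd_eq_inner: "snd z = z \<bullet> (0, 1 :: real)"
  by (cases z) simp

lemma smooth_scaled_step: "smooth (\<lambda>t. smooth_step (c * t - 1))"
  using smooth_affine[OF smooth_smooth_step, of c "-1"] by simp

lemma smooth_bdry_cutoff: "smooth (bdry_cutoff k)"
  unfolding bdry_cutoff_def[abs_def] snd_eq_inner
  by (rule smooth_compose[OF smooth_scaled_step smooth_inner])

text \<open>Each derivative costs a factor k + 1, but derivatives of positive order live only where
  (k + 1) t \<le> 2, and there k + 1 \<le> 2 / t. This makes the bound independent of
  \<open>k\<close>.\<close>

lemma bdry_cutoff_derivative_bound:
  assumes p: "set p \<subseteq> (Basis :: ((real ^ 'n::finite) \<times> real) set)"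
  shows "\<exists>B\<ge>0. \<forall>k z. z \<in> half_space \<longrightarrow> \<bar>iter_partial p (bdry_cutoff k) z\<bar> \<le> B * (1 / snd z) ^ length p"
proof -
  define n where "n = length p"
  have s1: "set (replicate n (1::real)) \<subseteq> Basis" by auto
  obtain B where B: "B \<ge> 0" "\<And>t. \<bar>iter_partial (replicate n 1) smooth_step t\<bar> \<le> B"
    using smooth_step_derivative_bounded[OF s1] by blast
  \<comment> \<open>The cutoff is a function of the inner product with (0, 1) alone. Hence
    \<open>P\<close>, a product of height components of basis vectors, is 0 as soon as one direction
    is horizontal and 1 otherwise.\<close>
  define P where "P = prod_list (map (\<lambda>b. b \<bullet> (0, 1 :: real)) p)"
  have eq: "iter_partial p (bdry_cutoff k) z
      = P * (real (Suc k) ^ n * iter_partial (replicate n 1) smooth_step (real (Suc k) * snd z - 1))" for k z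
  proof -
    have "iter_partial p (bdry_cutoff k) z = P * iter_partial (replicate n 1) (\<lambda>t. smooth_step (real (Suc k) * t - 1)) (snd z)"
      unfolding bdry_cutoff_def[abs_def] snd_eq_inner P_def n_def
      by (simp only: iter_partial_ridge[OF smooth_scaled_step])
    also have "iter_partial (replicate n 1) (\<lambda>t. smooth_step (real (Suc k) * t - 1)) (snd z)
        = real (Suc k) ^ n * iter_partial (replicate n 1) smooth_step (real (Suc k) * snd z - 1)"
      using iter_partial_affine[OF smooth_smooth_step s1, of "real (Suc k)" "-1"] by (simp del: of_nat_Suc)
    finally show ?thesis .
  qed
  have "\<bar>iter_partial p (bdry_cutoff k) z\<bar> \<le> (\<bar>P\<bar> * B * 2 ^ n) * (1 / snd z) ^ n" if z: "z \<in> half_space" for k z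
  proof -
    have t: "snd z > 0" using z by (simp add: mem_half_space)
    have "real (Suc k) ^ n * \<bar>iter_partial (replicate n 1) smooth_step (real (Suc k) * snd z - 1)\<bar> \<le> (2 / snd z) ^ n * B"
    proof (cases "n = 0 \<or> real (Suc k) * snd z - 1 \<le> 1")
      case True
      then have "real (Suc k) ^ n \<le> (2 / snd z) ^ n"
        using t by (cases "n = 0") (auto intro!: power_mono simp: le_divide_eq simp del: of_nat_Suc)
      then show ?thesis using B t by (intro mult_mono) auto
    next
      case False
      then have "iter_partial (replicate n 1) smooth_step (real (Suc k) * snd z - 1) = 0"
        by (intro smooth_step_derivative_const) auto
      then show ?thesis using B t by simp
    qed
    then have "\<bar>P\<bar> * (real (Suc k) ^ n * \<bar>iter_partial (replicate n 1) smooth_step (real (Suc k) * snd z - 1)\<bar>)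
        \<le> \<bar>P\<bar> * ((2 / snd z) ^ n * B)" by (rule mult_left_mono) simp
    then show ?thesis unfolding eq by (simp add: abs_mult power_divide mult_ac del: of_nat_Suc)
  qed
  then show ?thesis using B(1) unfolding n_def by (intro exI[of _ "\<bar>P\<bar> * B * 2 ^ n"]) (auto simp: n_def)
qed

text \<open>The half ball lies in a cylinder over a bounded base, and Tonelli leaves the
  one-dimensional integral of t^s over [0, L], finite for s > -1.\<close>

lemma integrable_powr_near_boundary:
  assumes s: "s > -1" and L: "L \<ge> 0"
  shows "(\<integral>\<^sup>+z. indicator half_space z * ennreal (indicator (cball 0 L) z * snd z powr s)
    \<partial>(lborel :: ((real ^ 'n::finite) \<times> real) measure)) < \<infinity>"
proof -
  have "(\<integral>\<^sup>+z. indicator half_space z * ennreal (indicator (cball 0 L) z * snd z powr s)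
    \<partial>(lborel :: ((real ^ 'n) \<times> real) measure))
    \<le> (\<integral>\<^sup>+z. indicator (cball 0 L) (fst z) * (indicator {0..L} (snd z) * ennreal (snd z powr s))
        \<partial>(lborel :: ((real ^ 'n) \<times> real) measure))"
  proof (rule nn_integral_mono)
    fix z :: "(real ^ 'n) \<times> real"
    show "indicator half_space z * ennreal (indicator (cball 0 L) z * snd z powr s)
      \<le> indicator (cball 0 L) (fst z) * (indicator {0..L} (snd z) * ennreal (snd z powr s))"
    proof (cases "z \<in> half_space \<and> z \<in> cball 0 L")
      case True
      have "norm (fst z) \<le> norm z" "norm (snd z) \<le> norm z"
        using norm_fst_le[where x = "fst z" and y = "snd z"] norm_snd_le[where x = "fst z" and y = "snd z"]
        unfolding prod.collapse .
      then show ?thesis using True by (auto simp: mem_half_space)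
    qed auto
  qed
  also have "\<dots> = (\<integral>\<^sup>+x. (\<integral>\<^sup>+t. indicator (cball 0 L) x * (indicator {0..L} t * ennreal (t powr s)) \<partial>lborel) \<partial>(lborel :: (real ^ 'n) measure))"
  proof -
    have fst: "fst \<in> borel_measurable (borel :: ((real ^ 'n) \<times> real) measure)"
      by (intro borel_measurable_continuous_onI continuous_on_fst continuous_on_id)
    have 1: "(\<lambda>x :: real ^ 'n. indicator (cball 0 L) x :: ennreal) \<in> borel_measurable borel"
      by (intro borel_measurable_indicator) simp
    have "(\<lambda>t. indicator {0..L} t :: ennreal) \<in> borel_measurable borel"
      by (intro borel_measurable_indicator) simp
    moreover have "(\<lambda>t. ennreal (t powr s)) \<in> borel_measurable borel" by measurable
    ultimately have 2: "(\<lambda>t. indicator {0..L} t * ennreal (t powr s)) \<in> borel_measurable borel"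
      by (rule borel_measurable_times_ennreal)
    have "(\<lambda>z :: (real ^ 'n) \<times> real. indicator (cball 0 L) (fst z) * (indicator {0..L} (snd z) * ennreal (snd z powr s)))
        \<in> borel_measurable borel"
      by (rule borel_measurable_times_ennreal[OF measurable_compose[OF fst 1] measurable_compose[OF snd_borel_measurable 2]])
    then have "(\<lambda>z :: (real ^ 'n) \<times> real. indicator (cball 0 L) (fst z) * (indicator {0..L} (snd z) * ennreal (snd z powr s)))
        \<in> borel_measurable (lborel \<Otimes>\<^sub>M lborel)"
      unfolding lborel_prod by simp
    from lborel.nn_integral_fst[OF this] show ?thesis unfolding lborel_prod by simp
  qed
  also have "\<dots> = (\<integral>\<^sup>+x. indicator (cball 0 L) x * (\<integral>\<^sup>+t. indicator {0..L} t * ennreal (t powr s) \<partial>lborel) \<partial>(lborel :: (real ^ 'n) measure))"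
    by (intro nn_integral_cong nn_integral_cmult) measurable
  also have "\<dots> = emeasure lborel (cball 0 L :: (real ^ 'n) set) * (\<integral>\<^sup>+t. indicator {0..L} t * ennreal (t powr s) \<partial>lborel)"
    by (subst nn_integral_multc) (auto intro!: borel_measurable_indicator)
  also have "\<dots> < \<infinity>"
  proof -
    have "(\<integral>\<^sup>+t. indicator {0..L} t * ennreal (t powr s) \<partial>lborel) = ennreal (L powr (s + 1) / (s + 1))"
    proof -
      have "(\<integral>\<^sup>+t. indicator {0..L} t * ennreal (t powr s) \<partial>lborel) = (\<integral>\<^sup>+t. ennreal (indicator {0..L} t * t powr s) \<partial>lborel)"
        by (intro nn_integral_cong) (auto simp: indicator_def)
      also have "\<dots> = ennreal (L powr (s + 1) / (s + 1))"
        using nn_integral_has_integral_lebesgue[OF _ has_integral_powr_from_0[OF s L]] by simp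
      finally show ?thesis .
    qed
    moreover have "emeasure lborel (cball 0 L :: (real ^ 'n) set) < \<infinity>"
      by (rule emeasure_bounded_finite) simp
    ultimately show ?thesis by (simp add: ennreal_mult_less_top)
  qed
  finally show ?thesis .
qed

text \<open>Here the bounded derivatives of \<open>v\<close> pay off: a term of the product rule is
  at most a constant times t^(a - p) with p \<le> M, the length of \<open>bs\<close>. On the bounded
  support this is at most a constant times t^(a - M), which is integrable because a - M >
  -1.\<close>

lemma cutoff_at_boundary:
  fixes v :: "(real ^ 'n::finite) \<times> real \<Rightarrow> real"
  assumes v: "v \<in> Cc_infty UNIV" and bs: "set bs \<subseteq> Basis" and a: "a - real (length bs) > -1"
  shows "(\<lambda>k. weighted_err a (\<lambda>z. iter_partial bs (\<lambda>z. bdry_cutoff k z * v z) z - iter_partial bs v z)) \<longlonglongrightarrow> 0"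
proof -
  define S :: "((real ^ 'n) \<times> real) list set" where "S = {p. set p \<subseteq> Basis \<and> length p \<le> length bs}"
  define M where "M = length bs"
  have S: "finite S" unfolding S_def by (rule finite_lists_Basis)
  have mem: "p \<in> S \<and> q \<in> S" if "(p, q) \<in> set (splits bs)" for p q
    using splits_props[OF that] bs by (auto simp: S_def)
  have sv: "smooth v" using v by (rule Cc_infty_smooth)
  obtain K where K: "compact K" "\<And>x. x \<notin> K \<Longrightarrow> v x = 0" using Cc_infty_support[OF v] by metis
  obtain L0 where L0: "\<And>x. x \<in> K \<Longrightarrow> norm x \<le> L0" using compact_imp_bounded[OF K(1)] unfolding bounded_iff by blast
  define L where "L = max L0 1"
  have L: "x \<in> cball 0 L" if "x \<in> K" for x using L0[OF that] by (simp add: L_def)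
  have L1: "L \<ge> 1" by (simp add: L_def)
  obtain B where B: "\<And>p. p \<in> S \<Longrightarrow> 0 \<le> B p \<and> (\<forall>k z. z \<in> half_space \<longrightarrow> \<bar>iter_partial p (bdry_cutoff k) z\<bar> \<le> B p * (1 / snd z) ^ length p)"
    using bdry_cutoff_derivative_bound unfolding S_def by (metis (mono_tags, lifting) mem_Collect_eq)
  have "\<exists>B\<ge>0. \<forall>x. \<bar>iter_partial q v x\<bar> \<le> B" if q: "q \<in> S" for q
  proof -
    have "set q \<subseteq> Basis" using q by (simp add: S_def)
    from Cc_infty_bounded[OF iter_partial_Cc_infty[OF v this]] show ?thesis by blast
  qed
  then obtain B' where B': "\<And>q. q \<in> S \<Longrightarrow> 0 \<le> B' q \<and> (\<forall>x. \<bar>iter_partial q v x\<bar> \<le> B' q)" by metis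
  define C where "C = (\<Sum>p\<in>S. B p)"
  define C' where "C' = (\<Sum>q\<in>S. B' q)"
  have C: "B p \<le> C" if "p \<in> S" for p unfolding C_def using B by (intro member_le_sum[OF that _ S]) auto
  have C': "B' q \<le> C'" if "q \<in> S" for q unfolding C'_def using B' by (intro member_le_sum[OF that _ S]) auto
  have C0: "C \<ge> 0" "C' \<ge> 0" unfolding C_def C'_def using B B' by (auto intro: sum_nonneg)
  \<comment> \<open>\<open>L ^ M\<close> absorbs t^(M - p) for all orders p \<le> M at once; this is
    why \<open>L\<close> is chosen at least 1.\<close>
  define E where "E = C * C' * L ^ M"
  have E0: "E \<ge> 0" unfolding E_def using C0 L1 by simp
  have [measurable]: "cball (0 :: (real ^ 'n) \<times> real) L \<in> sets borel" by simp
  define D where "D z = E * (indicator (cball 0 L) z * snd z powr (a - real M))" for z :: "(real ^ 'n) \<times> real"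
  show ?thesis
  proof (rule cutoff_converges[where D = D])
    show "\<exists>A. open A \<and> z \<in> A \<and> (\<forall>\<^sub>F k in sequentially. \<forall>y\<in>A. bdry_cutoff k y = 1)"
      if z: "z \<in> half_space" for z :: "(real ^ 'n) \<times> real"
    proof (intro exI[of _ "{y. snd z / 2 < snd y}"] conjI)
      have t: "snd z > 0" using z by (simp add: mem_half_space)
      show "open {y :: (real ^ 'n) \<times> real. snd z / 2 < snd y}" by (intro open_Collect_less continuous_intros)
      show "z \<in> {y. snd z / 2 < snd y}" using t by simp
      show "\<forall>\<^sub>F k in sequentially. \<forall>y\<in>{y :: (real ^ 'n) \<times> real. snd z / 2 < snd y}. bdry_cutoff k y = 1"
        using eventually_ge_at_top[of "nat \<lceil>4 / snd z\<rceil>"]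
      proof eventually_elim
        case (elim k)
        \<comment> \<open>Above height \<open>snd z / 2\<close> the argument of the step is at least
          1 as soon as k + 1 times \<open>snd z / 2\<close> is at least 2, which explains the
          4.\<close>
        then have k: "4 / snd z \<le> real (Suc k)" by linarith
        show ?case
        proof
          fix y :: "(real ^ 'n) \<times> real" assume "y \<in> {y. snd z / 2 < snd y}"
          then have "(4 / snd z) * (snd z / 2) \<le> real (Suc k) * snd y"
            using k t by (intro mult_mono) auto
          then show "bdry_cutoff k y = 1" using t by (simp add: bdry_cutoff_def smooth_step_eq_1 del: of_nat_Suc)
        qed
      qed
    qed
    show "D \<in> borel_measurable borel" unfolding D_def by measurable
    have "(\<integral>\<^sup>+z. indicator half_space z * ennreal (D z) \<partial>lborel)
      = (\<integral>\<^sup>+z. ennreal E * (indicator half_space z * ennreal (indicator (cball 0 L) z * snd z powr (a - real M)))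
        \<partial>(lborel :: ((real ^ 'n) \<times> real) measure))"
      unfolding D_def using E0 by (intro nn_integral_cong) (simp add: ennreal_mult' mult_ac)
    also have "\<dots> = ennreal E * (\<integral>\<^sup>+z. indicator half_space z * ennreal (indicator (cball 0 L) z * snd z powr (a - real M))
        \<partial>(lborel :: ((real ^ 'n) \<times> real) measure))"
      by (rule nn_integral_cmult) measurable
    also have "\<dots> < \<infinity>"
      unfolding infinity_ennreal_def ennreal_mult_less_top
      by (intro disjI2 conjI ennreal_less_top integrable_powr_near_boundary[unfolded infinity_ennreal_def])
        (use a L1 in \<open>auto simp: M_def\<close>)
    finally show "(\<integral>\<^sup>+z. indicator half_space z * ennreal (D z) \<partial>lborel) < \<infinity>" .
    fix k p q and z :: "(real ^ 'n) \<times> real" assume pq: "(p, q) \<in> set (splits bs)" and z: "z \<in> half_space"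
    have t: "snd z > 0" using z by (simp add: mem_half_space)
    have pS: "p \<in> S" and qS: "q \<in> S" using mem[OF pq] by auto
    have lp: "length p \<le> M" using splits_props[OF pq] by (simp add: M_def)
    show "snd z powr a * \<bar>iter_partial p (bdry_cutoff k) z * iter_partial q v z\<bar> \<le> D z"
    proof (cases "z \<in> K")
      case False
      then have "iter_partial q v z = 0" by (intro iter_partial_eq_0[OF compact_imp_closed[OF K(1)] K(2)])
      then show ?thesis using E0 by (simp add: D_def)
    next
      case True
      have zL: "snd z \<le> L"
        using L[OF True] norm_snd_le[where x = "fst z" and y = "snd z"] by simp
      have "snd z ^ M * (1 / snd z) ^ length p = snd z ^ (M - length p)"
        using t lp by (simp add: power_diff power_one_over)
      also have "\<dots> \<le> L ^ (M - length p)" using t zL by (intro power_mono) auto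
      also have "\<dots> \<le> L ^ M" using L1 by (intro power_increasing) auto
      finally have pw: "snd z ^ M * (1 / snd z) ^ length p \<le> L ^ M" .
      have "\<bar>iter_partial p (bdry_cutoff k) z\<bar> \<le> C * (1 / snd z) ^ length p"
        using B[OF pS] z C[OF pS] t by (meson mult_right_mono order_trans zero_le_power zero_le_divide_1_iff less_imp_le)
      moreover have "\<bar>iter_partial q v z\<bar> \<le> C'" using B'[OF qS] C'[OF qS] by (meson order_trans)
      ultimately have "\<bar>iter_partial p (bdry_cutoff k) z * iter_partial q v z\<bar> \<le> C * (1 / snd z) ^ length p * C'"
        unfolding abs_mult using C0 t by (intro mult_mono) auto
      then have "snd z powr a * \<bar>iter_partial p (bdry_cutoff k) z * iter_partial q v z\<bar>
          \<le> snd z powr a * (C * (1 / snd z) ^ length p * C')" by (rule mult_left_mono) simp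
      also have "\<dots> = (C * C' * snd z powr (a - real M)) * (snd z ^ M * (1 / snd z) ^ length p)"
        using t by (simp add: powr_diff powr_realpow)
      also have "\<dots> \<le> (C * C' * snd z powr (a - real M)) * L ^ M"
        using pw C0 by (intro mult_left_mono) auto
      also have "\<dots> = D z" using L[OF True] by (simp add: D_def E_def)
      finally show ?thesis .
    qed
  qed (rule smooth_bdry_cutoff sv bs)+
qed

lemma bdry_cutoff_Cc_infty:
  assumes v: "v \<in> Cc_infty UNIV"
  shows "(\<lambda>z. bdry_cutoff k z * v z) \<in> Cc_infty (half_space :: ((real ^ 'n::finite) \<times> real) set)"
proof -
  obtain K where K: "compact K" "\<And>x. x \<notin> K \<Longrightarrow> v x = 0" using Cc_infty_support[OF v] by metis
  define K' where "K' = K \<inter> {z. 1 / real (Suc k) \<le> snd z}"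
  have pos: "0 < 1 / real (Suc k)" by simp
  show ?thesis
  proof (rule Cc_inftyI[of _ K'])
    show "smooth (\<lambda>z. bdry_cutoff k z * v z)" by (intro smooth_mult smooth_bdry_cutoff Cc_infty_smooth[OF v])
    show "compact K'" unfolding K'_def by (intro compact_Int_closed K closed_Collect_le continuous_intros)
    show "K' \<subseteq> half_space"
    proof
      fix z assume "z \<in> K'"
      then have "1 / real (Suc k) \<le> snd z" by (simp add: K'_def)
      then show "z \<in> half_space" using pos unfolding mem_half_space by linarith
    qed
    fix z assume "z \<notin> K'"
    then consider "z \<notin> K" | "snd z < 1 / real (Suc k)" unfolding K'_def by (auto simp: not_le)
    then show "bdry_cutoff k z * v z = 0"
    proof cases
      case 2
      then have "real (Suc k) * snd z - 1 \<le> 0" by (simp add: field_simps)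
      then show ?thesis by (simp add: bdry_cutoff_def smooth_step_eq_0 del: of_nat_Suc)
    qed (simp add: K)
  qed
qed

section \<open>Density of test functions\<close>

lemma nn_integral_eq_weighted_err:
  fixes f v :: "(real ^ 'n::finite) \<times> real \<Rightarrow> real"
  assumes "AE z in lborel. z \<in> half_space \<longrightarrow> f z = v z"
  shows "(\<integral>\<^sup>+z\<in>half_space. ennreal (snd z powr a * \<bar>f z\<bar>) \<partial>lebesgue) = weighted_err a v"
  unfolding weighted_err_def nn_integral_completion
proof (rule nn_integral_cong_AE)
  show "AE z in lborel. ennreal (snd z powr a * \<bar>f z\<bar>) * indicator half_space z
      = indicator half_space z * ennreal (snd z powr a * \<bar>v z\<bar>)"
    using assms by eventually_elim (simp add: indicator_def)
qed

lemma weighted_err_cong: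
  assumes "\<And>z. z \<in> half_space \<Longrightarrow> \<bar>f z\<bar> = \<bar>g z\<bar>"
  shows "weighted_err a f = weighted_err a g"
  unfolding weighted_err_def using assms by (intro nn_integral_cong) (simp add: indicator_def)

lemma finite_lists_of_length: "finite {bs. set bs \<subseteq> (Basis :: 'a::euclidean_space set) \<and> length bs = j}"
  by (rule finite_lists_length_eq) simp

lemma weighted_weak_deriv_finite:
  fixes u :: "(real ^ 'n::finite) \<times> real \<Rightarrow> real"
  assumes fin: "wnorm k a u < \<infinity>" and bs: "set bs \<subseteq> Basis" "1 \<le> length bs" "length bs \<le> k"
  shows "(\<integral>\<^sup>+z\<in>half_space. ennreal (snd z powr a * \<bar>weak_deriv half_space bs u z\<bar>) \<partial>lebesgue) < \<infinity>"
proof -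
  define I where "I j = (\<integral>\<^sup>+z\<in>half_space. ennreal (snd z powr a * norm_weak_grad half_space j u z) \<partial>lebesgue)" for j
  have le: "\<bar>weak_deriv half_space bs u z\<bar> \<le> norm_weak_grad half_space (length bs) u z" for z
  proof -
    have "(weak_deriv half_space bs u z)\<^sup>2 \<le> (\<Sum>cs | set cs \<subseteq> Basis \<and> length cs = length bs. (weak_deriv half_space cs u z)\<^sup>2)"
      by (rule member_le_sum[of bs _ "\<lambda>cs. (weak_deriv half_space cs u z)\<^sup>2"]) (use bs finite_lists_of_length in auto)
    then show ?thesis unfolding norm_weak_grad_def by (intro real_le_rsqrt) simp
  qed
  have "(\<integral>\<^sup>+z\<in>half_space. ennreal (snd z powr a * \<bar>weak_deriv half_space bs u z\<bar>) \<partial>lebesgue) \<le> I (length bs)"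
    unfolding I_def using le by (intro nn_integral_mono mult_right_mono ennreal_leI mult_left_mono) auto
  also have "\<dots> \<le> (\<Sum>j=1..k. I j)" using bs by (intro member_le_sum) auto
  also have "\<dots> \<le> wnorm k a u" unfolding wnorm_def I_def by simp
  finally show ?thesis using fin by (rule le_less_trans)
qed

text \<open>Replaces the chosen weak derivatives by explicit differences: outside one null set, a
  finite union, all entries of the tensor of \<open>u - \<phi>\<close> are known, and the Euclidean
  norm of these entries is at most the sum of their absolute values.\<close>

lemma wnorm_diff_le:
  fixes u \<phi> :: "(real ^ 'n::finite) \<times> real \<Rightarrow> real"
  assumes wd: "\<And>bs. set bs \<subseteq> Basis \<Longrightarrow> length bs \<le> k \<Longrightarrow> has_weak_deriv half_space bs u (g bs)"
    and rep: "\<And>bs. set bs \<subseteq> Basis \<Longrightarrow> length bs \<le> k \<Longrightarrow> borel_rep (g bs) (w bs)"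
    and g0: "g [] = u" and \<phi>: "\<phi> \<in> Cc_infty half_space"
  shows "wnorm k a (\<lambda>z. u z - \<phi> z) \<le> weighted_err a (\<lambda>z. w [] z - \<phi> z) +
    (\<Sum>j=1..k. \<Sum>bs | set bs \<subseteq> Basis \<and> length bs = j. weighted_err a (\<lambda>z. w bs z - iter_partial bs \<phi> z))"
  unfolding wnorm_def
proof (intro add_mono sum_mono)
  have "AE z in lborel. z \<in> half_space \<longrightarrow> u z = w [] z" using rep[of "[]"] g0 borel_rep_AE by auto
  then have "AE z in lborel. z \<in> half_space \<longrightarrow> u z - \<phi> z = w [] z - \<phi> z" by eventually_elim simp
  from nn_integral_eq_weighted_err[OF this, of a]
  show "(\<integral>\<^sup>+z\<in>half_space. ennreal (snd z powr a * \<bar>u z - \<phi> z\<bar>) \<partial>lebesgue) \<le> weighted_err a (\<lambda>z. w [] z - \<phi> z)"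
    by simp
next
  fix j assume j: "j \<in> {1..k}"
  define B where "B = {bs. set bs \<subseteq> (Basis :: ((real ^ 'n) \<times> real) set) \<and> length bs = j}"
  have B: "finite B" unfolding B_def by (rule finite_lists_of_length)
  define E where "E bs z = w bs z - iter_partial bs \<phi> z" for bs z
  have AE: "AE z in lborel. \<forall>bs\<in>B. z \<in> half_space \<longrightarrow> weak_deriv half_space bs (\<lambda>z. u z - \<phi> z) z = E bs z"
    unfolding AE_finite_all[OF B] E_def
    using wd rep j \<phi> by (auto simp: B_def intro!: weak_deriv_diff_Cc)
  have [measurable]: "E bs \<in> borel_measurable borel" if "bs \<in> B" for bs
  proof -
    have "w bs \<in> borel_measurable borel" using rep[of bs] that j by (auto simp: B_def intro: borel_rep_measurable)
    moreover have "iter_partial bs \<phi> \<in> borel_measurable borel"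
      using that by (intro smooth_borel_measurable smooth_iter_partial Cc_infty_smooth[OF \<phi>]) (simp add: B_def)
    ultimately show ?thesis unfolding E_def by measurable
  qed
  have "(\<integral>\<^sup>+z\<in>half_space. ennreal (snd z powr a * norm_weak_grad half_space j (\<lambda>z. u z - \<phi> z) z) \<partial>lebesgue)
     \<le> (\<integral>\<^sup>+z. (\<Sum>bs\<in>B. indicator half_space z * ennreal (snd z powr a * \<bar>E bs z\<bar>)) \<partial>lborel)"
    unfolding nn_integral_completion
  proof (rule nn_integral_mono_AE)
    show "AE z in lborel. ennreal (snd z powr a * norm_weak_grad half_space j (\<lambda>z. u z - \<phi> z) z) * indicator half_space z
      \<le> (\<Sum>bs\<in>B. indicator half_space z * ennreal (snd z powr a * \<bar>E bs z\<bar>))"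
      using AE
    proof eventually_elim
      case (elim z)
      show ?case
      proof (cases "z \<in> half_space")
        case True
        have "norm_weak_grad half_space j (\<lambda>z. u z - \<phi> z) z = sqrt (\<Sum>bs\<in>B. (E bs z)\<^sup>2)"
          unfolding norm_weak_grad_def B_def[symmetric] using elim True by (intro arg_cong[of _ _ sqrt] sum.cong) auto
        also have "\<dots> \<le> (\<Sum>bs\<in>B. \<bar>E bs z\<bar>)"
          using L2_set_le_sum_abs[of "\<lambda>bs. E bs z" B] by (simp add: L2_set_def)
        finally have "snd z powr a * norm_weak_grad half_space j (\<lambda>z. u z - \<phi> z) z \<le> (\<Sum>bs\<in>B. snd z powr a * \<bar>E bs z\<bar>)"
          unfolding sum_distrib_left[symmetric] by (rule mult_left_mono) simp
        then have "ennreal (snd z powr a * norm_weak_grad half_space j (\<lambda>z. u z - \<phi> z) z) \<le> ennreal (\<Sum>bs\<in>B. snd z powr a * \<bar>E bs z\<bar>)"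
          by (rule ennreal_leI)
        also have "\<dots> = (\<Sum>bs\<in>B. ennreal (snd z powr a * \<bar>E bs z\<bar>))"
          by (intro sum_ennreal[symmetric]) simp
        finally show ?thesis using True by simp
      qed simp
    qed
  qed
  also have "\<dots> = (\<Sum>bs\<in>B. weighted_err a (E bs))"
    unfolding weighted_err_def by (rule nn_integral_sum) measurable
  finally show "(\<integral>\<^sup>+z\<in>half_space. ennreal (snd z powr a * norm_weak_grad half_space j (\<lambda>z. u z - \<phi> z) z) \<partial>lebesgue)
    \<le> (\<Sum>bs | set bs \<subseteq> Basis \<and> length bs = j. weighted_err a (\<lambda>z. w bs z - iter_partial bs \<phi> z))"
    unfolding B_def E_def .
qed

text \<open>The radii from \<open>weighted_mollify\<close> depend only on the functions, so their
  minimum serves all of them. One common kernel is needed because the averages of all derivatives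
  have to be the derivatives of one function.\<close>

lemma simultaneous_mollify:
  fixes w :: "'i \<Rightarrow> (real ^ 'n::finite) \<times> real \<Rightarrow> real"
  assumes S: "finite S" and wm: "\<And>i. i \<in> S \<Longrightarrow> w i \<in> borel_measurable borel" and a: "a \<ge> 0"
    and fin: "\<And>i. i \<in> S \<Longrightarrow> weighted_err a (w i) < \<infinity>" and e: "(e::real) > 0"
  shows "\<exists>\<rho> r. \<rho> \<in> Cc_infty UNIV \<and> 0 < r \<and> (\<forall>y. \<rho> y \<noteq> 0 \<longrightarrow> r \<le> snd y) \<and>
    (\<forall>i\<in>S. weighted_err a (\<lambda>z. conv_against (w i) \<rho> z - w i z) \<le> e)"
proof -
  define P where "P i d \<longleftrightarrow> (\<forall>\<rho>. integrable lborel \<rho> \<and> (\<forall>y. 0 \<le> \<rho> y) \<and> (\<integral>y. \<rho> y \<partial>lborel) = 1 \<and>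
    (\<forall>y. \<rho> y \<noteq> 0 \<longrightarrow> norm y < d \<and> 0 \<le> snd y) \<longrightarrow>
    weighted_err a (\<lambda>z. conv_against (w i) \<rho> z - w i z) \<le> e)" for i d
  have "\<exists>d>0. P i d" if "i \<in> S" for i
    unfolding P_def by (rule weighted_mollify[OF wm[OF that] a fin[OF that] e])
  then obtain d where d: "\<And>i. i \<in> S \<Longrightarrow> d i > 0" "\<And>i. i \<in> S \<Longrightarrow> P i (d i)" by metis
  \<comment> \<open>Inserting 1 keeps the minimum defined when \<open>S\<close> is empty.\<close>
  define d0 where "d0 = Min (insert 1 (d ` S))"
  have d0: "d0 > 0" unfolding d0_def using S d(1) by auto
  have d0_le: "d0 \<le> d i" if "i \<in> S" for i unfolding d0_def using S that by auto
  obtain \<rho> :: "(real ^ 'n) \<times> real \<Rightarrow> real" and r where \<rho>: "\<rho> \<in> Cc_infty UNIV" "0 < r" "\<forall>y. 0 \<le> \<rho> y"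
    "(\<integral>y. \<rho> y \<partial>lborel) = 1" "\<forall>y. \<rho> y \<noteq> 0 \<longrightarrow> norm y < d0 \<and> r \<le> snd y"
    using mollifier_half_space[OF d0] by blast
  have "weighted_err a (\<lambda>z. conv_against (w i) \<rho> z - w i z) \<le> e" if i: "i \<in> S" for i
  proof (rule d(2)[OF i, unfolded P_def, rule_format], intro conjI allI impI)
    fix y assume "\<rho> y \<noteq> 0"
    then have "norm y < d0" "r \<le> snd y" using \<rho>(5) by blast+
    then show "norm y < d i" "0 \<le> snd y" using d0_le[OF i] \<rho>(2) by linarith+
  qed (use \<rho> Cc_infty_integrable in blast)+
  then show ?thesis using \<rho> by blast
qed

text \<open>The bound collects three errors of size \<open>e\<close>: mollification, cutoff at
  infinity and cutoff at the boundary. There are finitely many derivatives up to order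
  \<open>k\<close>, so each parameter can be fixed for all of them at once before the next one is
  chosen.\<close>

lemma weighted_approximation:
  fixes u :: "(real ^ 'n::finite) \<times> real \<Rightarrow> real"
  assumes wd: "\<And>bs. set bs \<subseteq> Basis \<Longrightarrow> length bs \<le> k \<Longrightarrow> has_weak_deriv half_space bs u (g bs)"
    and rep: "\<And>bs. set bs \<subseteq> Basis \<Longrightarrow> length bs \<le> k \<Longrightarrow> borel_rep (g bs) (w bs)"
    and g0: "g [] = u"
    and fin: "\<And>bs. set bs \<subseteq> Basis \<Longrightarrow> length bs \<le> k \<Longrightarrow> weighted_err a (w bs) < \<infinity>"
    and a: "a \<ge> 0" "a - real k > -1" and e: "(e::real) > 0"
  shows "\<exists>\<phi>\<in>Cc_infty half_space. \<forall>bs. set bs \<subseteq> Basis \<and> length bs \<le> k \<longrightarrow>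
    weighted_err a (\<lambda>z. w bs z - iter_partial bs \<phi> z) \<le> ennreal (3 * e)"
proof -
  define S :: "((real ^ 'n) \<times> real) list set" where "S = {bs. set bs \<subseteq> Basis \<and> length bs \<le> k}"
  have S: "finite S" unfolding S_def by (rule finite_lists_Basis)
  have nil: "[] \<in> S" by (simp add: S_def)
  have bsS: "set bs \<subseteq> Basis" "length bs \<le> k" if "bs \<in> S" for bs using that by (auto simp: S_def)
  have wm: "w bs \<in> borel_measurable borel" if "bs \<in> S" for bs
    using rep bsS[OF that] borel_rep_measurable by blast
  have finS: "weighted_err a (w bs) < \<infinity>" if "bs \<in> S" for bs using fin bsS[OF that] by blast
  obtain \<rho> :: "(real ^ 'n) \<times> real \<Rightarrow> real" and r where \<rho>: "\<rho> \<in> Cc_infty UNIV" "0 < r" "\<And>y. \<rho> y \<noteq> 0 \<Longrightarrow> r \<le> snd y"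
    and \<rho>_err: "\<And>bs. bs \<in> S \<Longrightarrow> weighted_err a (\<lambda>z. conv_against (w bs) \<rho> z - w bs z) \<le> e"
    using simultaneous_mollify[where w = w, OF S wm a(1) finS e] by blast
  \<comment> \<open>Values below height \<open>r\<close> never enter the average at a point of the
    half space; without them the function is integrable on the whole space, so that its average is
    smooth across the boundary.\<close>
  define U where "U = (\<lambda>z. indicator {z. r \<le> snd z} z * w [] z)"
  have U: "integrable lborel U"
    unfolding U_def by (rule integrable_away_from_boundary[OF wm[OF nil] finS[OF nil] a(1) \<rho>(2)])
  define W where "W = conv_against U \<rho>"
  have W: "smooth W" unfolding W_def by (rule conv_smooth[OF U \<rho>(1)])
  have W_eq: "iter_partial bs W z = conv_against (w bs) \<rho> z" if "bs \<in> S" "z \<in> half_space" for bs z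
    unfolding W_def U_def
    by (rule mollified_weak_deriv[OF wd[OF bsS[OF that(1)]] bsS(1)[OF that(1)] _ rep[OF bsS[OF that(1)]] \<rho> _ that(2)])
      (use U rep[OF bsS[OF nil]] g0 in \<open>simp_all add: U_def\<close>)
  have Wm: "iter_partial bs W \<in> borel_measurable borel" if "bs \<in> S" for bs
    by (intro smooth_borel_measurable smooth_iter_partial W bsS that)
  have W_err: "weighted_err a (\<lambda>z. iter_partial bs W z - w bs z) \<le> e" if "bs \<in> S" for bs
  proof -
    have "weighted_err a (\<lambda>z. iter_partial bs W z - w bs z) = weighted_err a (\<lambda>z. conv_against (w bs) \<rho> z - w bs z)"
      by (rule weighted_err_cong) (simp add: W_eq that)
    then show ?thesis using \<rho>_err[OF that] by simp
  qed
  \<comment> \<open>The cutoff at infinity needs finite weighted norms of the derivatives of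
    \<open>W\<close>; each of them is within \<open>e\<close> of the corresponding
    \<open>w bs\<close>.\<close>
  have W_fin: "weighted_err a (iter_partial bs W) < \<infinity>" if bs: "bs \<in> S" for bs
  proof -
    have "weighted_err a (iter_partial bs W) \<le> weighted_err a (\<lambda>z. iter_partial bs W z - w bs z) + weighted_err a (w bs)"
      by (intro weighted_err_add borel_measurable_diff wm[OF bs] Wm[OF bs]) linarith
    also have "\<dots> < \<infinity>"
      using W_err[OF bs] finS[OF bs] by (auto simp: le_less_trans[OF _ ennreal_less_top])
    finally show ?thesis .
  qed
  have "\<forall>\<^sub>F k in sequentially. \<forall>bs\<in>S. weighted_err a
      (\<lambda>z. iter_partial bs (\<lambda>z. plateau ((1 / real (Suc k)) *\<^sub>R z) * W z) z - iter_partial bs W z) < ennreal e"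
  proof (intro eventually_ball_finite[OF S] ballI order_tendstoD(2)[OF cutoff_at_infinity])
    show "weighted_err a (iter_partial q W) < \<infinity>" if "bs \<in> S" "set q \<subseteq> Basis" "length q \<le> length bs" for bs q
      using W_fin[of q] that bsS(2)[of bs] by (simp add: S_def)
  qed (use e W bsS in auto)
  then obtain l where l: "\<And>bs. bs \<in> S \<Longrightarrow> weighted_err a
      (\<lambda>z. iter_partial bs (\<lambda>z. plateau ((1 / real (Suc l)) *\<^sub>R z) * W z) z - iter_partial bs W z) < ennreal e"
    by (auto simp: eventually_sequentially)
  define V where "V = (\<lambda>z. plateau ((1 / real (Suc l)) *\<^sub>R z) * W z)"
  have V: "V \<in> Cc_infty UNIV"
  proof -
    have sp: "smooth (\<lambda>z :: (real ^ 'n) \<times> real. plateau ((1 / real (Suc l)) *\<^sub>R z))"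
      using smooth_affine[OF Cc_infty_smooth[OF plateau_Cc_infty], of "1 / real (Suc l)" 0] by simp
    obtain K :: "((real ^ 'n) \<times> real) set" where K: "compact K" "\<And>x. x \<notin> K \<Longrightarrow> plateau x = 0"
      using Cc_infty_support[OF plateau_Cc_infty] by metis
    show ?thesis
    proof (rule Cc_inftyI[of _ "(\<lambda>z. real (Suc l) *\<^sub>R z) ` K"])
      show "smooth V" unfolding V_def by (rule smooth_mult[OF sp W])
      show "compact ((\<lambda>z. real (Suc l) *\<^sub>R z) ` K)" by (intro compact_continuous_image K continuous_intros)
      fix z assume z: "z \<notin> (\<lambda>z. real (Suc l) *\<^sub>R z) ` K"
      have "(1 / real (Suc l)) *\<^sub>R z \<notin> K"
      proof
        assume "(1 / real (Suc l)) *\<^sub>R z \<in> K"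
        then have "real (Suc l) *\<^sub>R ((1 / real (Suc l)) *\<^sub>R z) \<in> (\<lambda>z. real (Suc l) *\<^sub>R z) ` K" by (rule imageI)
        then show False using z by simp
      qed
      then show "V z = 0" unfolding V_def by (simp add: K(2))
    qed simp
  qed
  have "\<forall>\<^sub>F k in sequentially. \<forall>bs\<in>S. weighted_err a
      (\<lambda>z. iter_partial bs (\<lambda>z. bdry_cutoff k z * V z) z - iter_partial bs V z) < ennreal e"
  proof (intro eventually_ball_finite[OF S] ballI order_tendstoD(2)[OF cutoff_at_boundary[OF V]])
    show "-1 < a - real (length bs)" if "bs \<in> S" for bs using a(2) bsS(2)[OF that] by simp
  qed (use e bsS in auto)
  then obtain j where j: "\<And>bs. bs \<in> S \<Longrightarrow> weighted_err a
      (\<lambda>z. iter_partial bs (\<lambda>z. bdry_cutoff j z * V z) z - iter_partial bs V z) < ennreal e"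
    by (auto simp: eventually_sequentially)
  define \<phi> where "\<phi> = (\<lambda>z. bdry_cutoff j z * V z)"
  have \<phi>: "\<phi> \<in> Cc_infty half_space" unfolding \<phi>_def by (rule bdry_cutoff_Cc_infty[OF V])
  have "weighted_err a (\<lambda>z. w bs z - iter_partial bs \<phi> z) \<le> ennreal (3 * e)" if bs: "bs \<in> S" for bs
  proof -
    have bm: "w bs \<in> borel_measurable borel" "iter_partial bs W \<in> borel_measurable borel"
      "iter_partial bs V \<in> borel_measurable borel" "iter_partial bs \<phi> \<in> borel_measurable borel"
      using bs bsS[OF bs] wm Wm V \<phi> by (auto intro: smooth_borel_measurable smooth_iter_partial Cc_infty_smooth)
    have "weighted_err a (\<lambda>z. w bs z - iter_partial bs \<phi> z)
      \<le> weighted_err a (\<lambda>z. iter_partial bs W z - w bs z) + weighted_err a (\<lambda>z. iter_partial bs W z - iter_partial bs \<phi> z)"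
      by (intro weighted_err_add borel_measurable_diff bm) linarith
    also have "weighted_err a (\<lambda>z. iter_partial bs W z - iter_partial bs \<phi> z)
      \<le> weighted_err a (\<lambda>z. iter_partial bs V z - iter_partial bs W z) + weighted_err a (\<lambda>z. iter_partial bs \<phi> z - iter_partial bs V z)"
      by (intro weighted_err_add borel_measurable_diff bm) linarith
    finally have "weighted_err a (\<lambda>z. w bs z - iter_partial bs \<phi> z)
      \<le> weighted_err a (\<lambda>z. iter_partial bs W z - w bs z) + (weighted_err a (\<lambda>z. iter_partial bs V z - iter_partial bs W z)
        + weighted_err a (\<lambda>z. iter_partial bs \<phi> z - iter_partial bs V z))"
      by (simp add: add_left_mono)
    also have "\<dots> \<le> ennreal e + (ennreal e + ennreal e)"
      using W_err[OF bs] l[OF bs] j[OF bs] unfolding V_def[symmetric] \<phi>_def[symmetric]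
      by (intro add_mono) (auto intro: less_imp_le)
    also have "\<dots> = ennreal (3 * e)" using e by (simp flip: ennreal_plus)
    finally show ?thesis .
  qed
  then show ?thesis using \<phi> by (auto simp: S_def)
qed

theorem theorem1p5:
  fixes m :: nat and a :: real
  assumes "a > real m"
  shows "(W1_weighted (m + 1) a :: ((real ^ 'n::finite) \<times> real \<Rightarrow> real) set) = W1_weighted_0 (m + 1) a"
proof
  show "W1_weighted_0 (m + 1) a \<subseteq> (W1_weighted (m + 1) a :: ((real ^ 'n) \<times> real \<Rightarrow> real) set)"
    by (auto simp: W1_weighted_0_def)
  show "(W1_weighted (m + 1) a :: ((real ^ 'n) \<times> real \<Rightarrow> real) set) \<subseteq> W1_weighted_0 (m + 1) a"
  proof
    fix u :: "(real ^ 'n) \<times> real \<Rightarrow> real" assume u: "u \<in> W1_weighted (m + 1) a"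
    define k where "k = m + 1"
    have uk: "u \<in> W1_loc k half_space" "wnorm k a u < \<infinity>" using u by (auto simp: W1_weighted_def k_def)
    then have uL: "u \<in> L1_loc half_space" by (simp add: W1_loc_def)
    \<comment> \<open>At order zero \<open>u\<close> itself is taken rather than the choice
      \<open>weak_deriv half_space [] u\<close>, because the first term of \<open>wnorm\<close>
      refers to \<open>u\<close>.\<close>
    define g where "g bs = (if bs = [] then u else weak_deriv half_space bs u)" for bs
    have wd: "has_weak_deriv half_space bs u (g bs)" if "set bs \<subseteq> Basis" "length bs \<le> k" for bs
    proof (cases "bs = []")
      case True
      then show ?thesis using uL by (simp add: g_def has_weak_deriv_def)
    next
      case False
      have "\<exists>g. has_weak_deriv half_space bs u g" using uk(1) that unfolding W1_loc_def by blast
      then show ?thesis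
        using False someI_ex[of "has_weak_deriv half_space bs u"] by (simp add: g_def weak_deriv_def)
    qed
    have "\<exists>w. borel_rep (g bs) w" if "set bs \<subseteq> Basis" "length bs \<le> k" for bs
      using wd[OF that] borel_rep_exists unfolding has_weak_deriv_def by blast
    then obtain w where rep: "\<And>bs. set bs \<subseteq> Basis \<Longrightarrow> length bs \<le> k \<Longrightarrow> borel_rep (g bs) (w bs)" by metis
    have fin: "weighted_err a (w bs) < \<infinity>" if bs: "set bs \<subseteq> Basis" "length bs \<le> k" for bs
    proof -
      have "(\<integral>\<^sup>+z\<in>half_space. ennreal (snd z powr a * \<bar>g bs z\<bar>) \<partial>lebesgue) < \<infinity>"
      proof (cases "bs = []")
        case True
        have "(\<integral>\<^sup>+z\<in>half_space. ennreal (snd z powr a * \<bar>u z\<bar>) \<partial>lebesgue) \<le> wnorm k a u"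
          unfolding wnorm_def by simp
        then show ?thesis using uk(2) True by (simp add: g_def le_less_trans)
      next
        case False
        then show ?thesis
          using weighted_weak_deriv_finite[OF uk(2) bs(1) _ bs(2)] by (simp add: g_def Suc_le_eq)
      qed
      then show ?thesis using nn_integral_eq_weighted_err[OF borel_rep_AE[OF rep[OF bs]]] by simp
    qed
    have "\<exists>\<phi>\<in>Cc_infty half_space. wnorm k a (\<lambda>z. u z - \<phi> z) < ennreal \<epsilon>" if \<epsilon>: "\<epsilon> > 0" for \<epsilon>
    proof -
      \<comment> \<open>\<open>N\<close> counts the terms of the final bound: one for order zero and
        one for each list of directions. The extra 1 in \<open>3 * real N + 1\<close> makes the last
        inequality strict.\<close>
      define N where "N = 1 + (\<Sum>j=1..k. card {bs. set bs \<subseteq> (Basis :: ((real ^ 'n) \<times> real) set) \<and> length bs = j})"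
      define e where "e = \<epsilon> / (3 * real N + 1)"
      have e: "e > 0" using \<epsilon> by (simp add: e_def add_nonneg_pos)
      have g0: "g [] = u" by (simp add: g_def)
      have a: "a \<ge> 0" "a - real k > -1" using assms by (auto simp: k_def)
      obtain \<phi> where \<phi>: "\<phi> \<in> Cc_infty half_space" and err: "\<And>bs. set bs \<subseteq> Basis \<Longrightarrow> length bs \<le> k \<Longrightarrow>
          weighted_err a (\<lambda>z. w bs z - iter_partial bs \<phi> z) \<le> ennreal (3 * e)"
        using weighted_approximation[where u = u and g = g and w = w, OF wd rep g0 fin a e] by blast
      have "wnorm k a (\<lambda>z. u z - \<phi> z) \<le> weighted_err a (\<lambda>z. w [] z - \<phi> z) +
          (\<Sum>j=1..k. \<Sum>bs | set bs \<subseteq> Basis \<and> length bs = j. weighted_err a (\<lambda>z. w bs z - iter_partial bs \<phi> z))"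
        by (rule wnorm_diff_le[where g = g, OF wd rep g0 \<phi>])
      also have "\<dots> \<le> ennreal (3 * e) + (\<Sum>j=1..k. \<Sum>bs | set bs \<subseteq> (Basis :: ((real ^ 'n) \<times> real) set) \<and> length bs = j. ennreal (3 * e))"
        using err[of "[]"] err by (intro add_mono sum_mono) auto
      also have "\<dots> = of_nat N * ennreal (3 * e)"
        by (simp add: N_def distrib_right sum_distrib_right)
      also have "\<dots> = ennreal (real N * (3 * e))"
        using e by (simp add: ennreal_mult ennreal_of_nat_eq_real_of_nat)
      also have "\<dots> < ennreal \<epsilon>"
        using \<epsilon> by (intro ennreal_lessI) (auto simp: e_def divide_less_eq add_nonneg_pos)
      finally show ?thesis using \<phi> by blast
    qed
    then show "u \<in> W1_weighted_0 (m + 1) a" using u by (auto simp: W1_weighted_0_def k_def)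
  qed
qed

end
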